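(* Let $(\Omega,\Sigma,\mu)$ be a probability space such that $\mu$ is not purely atomic, let $E$ be an order continuous Köthe function space over $(\Omega,\Sigma,\mu)$, and let $X$ be a Banach space. Suppose that the closed unit ball $B_{E^*(X^* )}$ of $E^*(X^* )$, regarded as a subset of $B_{E(X)^*}$, has the Rainwater property for $E(X)$. Then $X^*$ has the Radon-Nikodým property.
   Context: All Banach spaces are real. For a Banach space $Z$, $B_Z$ denotes its closed unit ball and $Z^*$ its topological dual; $\langle z^*,z\rangle$ denotes the evaluation of $z^*\in Z^*$ at $z\in Z$. A Köthe function space over a probability space $(\Omega,\Sigma,\mu)$ is a Banach space $E$ consisting of ($\mu$-a.e. equivalence classes of) $\mu$-integrable real-valued functions on $\Omega$ such that: (i) $\chi_A\in E$ for every $A\in\Sigma$; (ii) if $f$ is a $\mu$-measurable real-valued function on $\Omega$, $g\in E$ and $|f|\le |g|$ $\mu$-a.e., then $f\in E$ and $\|f\|_E\le\|g\|_E$. $E$ is order continuous if $\|f_\alpha\|_E\to 0$ for every decreasing net $(f_\alpha)$ in $E$ with $\inf f_\alpha=0$. When $E$ is order continuous, $E^*$ is also a Köthe function space over $(\Omega,\Sigma,\mu)$: it is identified with the space of (classes of) $\mu$-measurable functions $g$ such that $fg\in L_1(\mu)$ for all $f\in E$, acting by $\langle g,f\rangle=\int_\Omega fg\,d\mu$ and equipped with the dual norm. A function $f:\Omega\to Z$ with values in a Banach space $Z$ is strongly $\mu$-measurable if it is the $\mu$-a.e. pointwise norm limit of a sequence of simple functions, i.e. functions of the form $\sum_{i=0}^p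 z_i\chi_{A_i}$ with $z_i\in Z$, $A_i\in\Sigma$. For a Köthe function space $E$ over $(\Omega,\Sigma,\mu)$ and a Banach space $X$, the Köthe-Bochner space $E(X)$ is the Banach space of all ($\mu$-a.e. equivalence classes of) strongly $\mu$-measurable functions $f:\Omega\to X$ such that $\|f(\cdot)\|_X\in E$, with norm $\|f\|_{E(X)}:=\big\|\,\|f(\cdot)\|_X\,\big\|_E$. The space $E^*(X^* )$ is defined in the same way from the Köthe function space $E^*$ and the Banach space $X^*$. For $E$ order continuous, $E^*(X^* )$ is identified with a (norming) subspace of $E(X)^*$ via the duality $\langle g,f\rangle=\int_\Omega\langle g(\cdot),f(\cdot)\rangle\,d\mu$ for $g\in E^*(X^* )$, $f\in E(X)$. For a Banach space $Z$, a set $H\subseteq B_{Z^*}$ has the Rainwater property for $Z$ if every bounded sequence $(z_n)$ in $Z$ such that $\langle z^*,z_n\rangle\to 0$ for every $z^*\in H$ is weakly null. *)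

theory Defs
  imports "HOL-Probability.Probability"
begin

text \<open>
  Spaces of classes of functions modulo almost everywhere equality are represented by sets of
  functions that are closed under almost everywhere equality, together with a function assigning
  to each member the norm of its class. Measurability of a real function with respect to a
  measure \<open>M\<close> means measurability for the completion of \<open>M\<close>; hence no measurable representative
  has to be chosen in a class.
\<close>

subsection \<open>Measure spaces\<close>

definition is_atom :: "'a measure \<Rightarrow> 'a set \<Rightarrow> bool" where
  "is_atom M A \<longleftrightarrow> A \<in> sets M \<and> measure M A > 0 \<and>
     (\<forall>B\<in>sets M. B \<subseteq> A \<longrightarrow> measure M B = 0 \<or> measure M (A - B) = 0)"

definition purely_atomic :: "'a measure \<Rightarrow> bool" where
  "purely_atomic M \<longleftrightarrow> (\<forall>A\<in>sets M. measure M A > 0 \<longrightarrow> (\<exists>B\<subseteq>A. is_atom M B))"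

definition strongly_measurable :: "'a measure \<Rightarrow> ('a \<Rightarrow> 'z::real_normed_vector) \<Rightarrow> bool" where
  "strongly_measurable M f \<longleftrightarrow>
     (\<exists>s. (\<forall>n. simple_function M (s n)) \<and> (AE \<omega> in M. (\<lambda>n. s n \<omega>) \<longlonglongrightarrow> f \<omega>))"

subsection \<open>Normed spaces of functions, their duals, and the Rainwater property\<close>

definition in_dual :: "('a \<Rightarrow> 'z::real_normed_vector) set \<Rightarrow> (('a \<Rightarrow> 'z) \<Rightarrow> real)
    \<Rightarrow> (('a \<Rightarrow> 'z) \<Rightarrow> real) \<Rightarrow> bool" where
  "in_dual V p \<phi> \<longleftrightarrow>
     (\<forall>f\<in>V. \<forall>g\<in>V. \<phi> (\<lambda>\<omega>. f \<omega> + g \<omega>) = \<phi> f + \<phi> g) \<and>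
     (\<forall>c. \<forall>f\<in>V. \<phi> (\<lambda>\<omega>. c *\<^sub>R f \<omega>) = c * \<phi> f) \<and>
     (\<exists>C. \<forall>f\<in>V. \<bar>\<phi> f\<bar> \<le> C * p f)"

definition dual_norm :: "('a \<Rightarrow> 'z::real_normed_vector) set \<Rightarrow> (('a \<Rightarrow> 'z) \<Rightarrow> real)
    \<Rightarrow> (('a \<Rightarrow> 'z) \<Rightarrow> real) \<Rightarrow> real" where
  "dual_norm V p \<phi> = (SUP f\<in>{f \<in> V. p f \<le> 1}. \<bar>\<phi> f\<bar>)"

definition weakly_null :: "('a \<Rightarrow> 'z::real_normed_vector) set \<Rightarrow> (('a \<Rightarrow> 'z) \<Rightarrow> real)
    \<Rightarrow> (nat \<Rightarrow> 'a \<Rightarrow> 'z) \<Rightarrow> bool" where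
  "weakly_null V p z \<longleftrightarrow> (\<forall>\<phi>. in_dual V p \<phi> \<longrightarrow> (\<lambda>n. \<phi> (z n)) \<longlonglongrightarrow> 0)"

definition rainwater_property :: "('a \<Rightarrow> 'z::real_normed_vector) set \<Rightarrow> (('a \<Rightarrow> 'z) \<Rightarrow> real)
    \<Rightarrow> (('a \<Rightarrow> 'z) \<Rightarrow> real) set \<Rightarrow> bool" where
  "rainwater_property V p H \<longleftrightarrow>
     (\<forall>z. (\<forall>n. z n \<in> V) \<longrightarrow> (\<exists>C. \<forall>n. p (z n) \<le> C) \<longrightarrow>
        (\<forall>\<phi>\<in>H. (\<lambda>n. \<phi> (z n)) \<longlonglongrightarrow> 0) \<longrightarrow> weakly_null V p z)"

subsection \<open>Koethe function spaces\<close>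

definition koethe_space :: "'a measure \<Rightarrow> ('a \<Rightarrow> real) set \<Rightarrow> (('a \<Rightarrow> real) \<Rightarrow> real) \<Rightarrow> bool" where
  "koethe_space M E nrm \<longleftrightarrow>
     (\<forall>f\<in>E. integrable (completion M) f) \<and>
     \<comment> \<open>vector space\<close>
     (\<forall>f\<in>E. \<forall>g\<in>E. (\<lambda>\<omega>. f \<omega> + g \<omega>) \<in> E) \<and>
     (\<forall>c. \<forall>f\<in>E. (\<lambda>\<omega>. c * f \<omega>) \<in> E) \<and>
     \<comment> \<open>norm\<close>
     (\<forall>f\<in>E. \<forall>g\<in>E. nrm (\<lambda>\<omega>. f \<omega> + g \<omega>) \<le> nrm f + nrm g) \<and>
     (\<forall>c. \<forall>f\<in>E. nrm (\<lambda>\<omega>. c * f \<omega>) = \<bar>c\<bar> * nrm f) \<and>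
     (\<forall>f\<in>E. nrm f = 0 \<longleftrightarrow> (AE \<omega> in M. f \<omega> = 0)) \<and>
     \<comment> \<open>completeness\<close>
     (\<forall>u. (\<forall>n. u n \<in> E) \<longrightarrow>
        (\<forall>e>0. \<exists>k. \<forall>m\<ge>k. \<forall>n\<ge>k. nrm (\<lambda>\<omega>. u m \<omega> - u n \<omega>) < e) \<longrightarrow>
        (\<exists>f\<in>E. (\<lambda>n. nrm (\<lambda>\<omega>. u n \<omega> - f \<omega>)) \<longlonglongrightarrow> 0)) \<and>
     \<comment> \<open>the two axioms of Koethe function spaces\<close>
     (\<forall>A\<in>sets M. indicator A \<in> E) \<and>
     (\<forall>f g. f \<in> borel_measurable (completion M) \<longrightarrow> g \<in> E \<longrightarrow>
        (AE \<omega> in M. \<bar>f \<omega>\<bar> \<le> \<bar>g \<omega>\<bar>) \<longrightarrow> f \<in> E \<and> nrm f \<le> nrm g)"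

text \<open>
  Nets are indexed by directed preordered subsets of the type \<open>'a \<Rightarrow> real\<close> itself. This is no
  restriction: whether a decreasing net \<open>(f\<^sub>\<alpha>)\<close> has infimum 0 and whether its norms tend
  to 0 depends only on the downward directed set of its members, which may serve as index set.
\<close>

definition directed_preorder :: "'i set \<Rightarrow> ('i \<Rightarrow> 'i \<Rightarrow> bool) \<Rightarrow> bool" where
  "directed_preorder I le \<longleftrightarrow> I \<noteq> {} \<and>
     (\<forall>i\<in>I. le i i) \<and>
     (\<forall>i\<in>I. \<forall>j\<in>I. \<forall>k\<in>I. le i j \<longrightarrow> le j k \<longrightarrow> le i k) \<and>
     (\<forall>i\<in>I. \<forall>j\<in>I. \<exists>k\<in>I. le i k \<and> le j k)"

definition order_continuous :: "'a measure \<Rightarrow> ('a \<Rightarrow> real) set \<Rightarrow> (('a \<Rightarrow> real) \<Rightarrow> real) \<Rightarrow> bool" where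
  "order_continuous M E nrm \<longleftrightarrow>
     (\<forall>(I :: ('a \<Rightarrow> real) set) le (f :: ('a \<Rightarrow> real) \<Rightarrow> 'a \<Rightarrow> real).
        directed_preorder I le \<longrightarrow>
        (\<forall>i\<in>I. f i \<in> E) \<longrightarrow>
        (\<forall>i\<in>I. \<forall>j\<in>I. le i j \<longrightarrow> (AE \<omega> in M. f j \<omega> \<le> f i \<omega>)) \<longrightarrow>
        \<comment> \<open>the infimum in the ordered space of classes is 0\<close>
        (\<forall>i\<in>I. AE \<omega> in M. 0 \<le> f i \<omega>) \<longrightarrow>
        (\<forall>g\<in>E. (\<forall>i\<in>I. AE \<omega> in M. g \<omega> \<le> f i \<omega>) \<longrightarrow> (AE \<omega> in M. g \<omega> \<le> 0)) \<longrightarrow>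
        (\<forall>e>0. \<exists>i\<in>I. \<forall>j\<in>I. le i j \<longrightarrow> nrm (f j) < e))"

definition koethe_dual :: "'a measure \<Rightarrow> ('a \<Rightarrow> real) set \<Rightarrow> ('a \<Rightarrow> real) set" where
  "koethe_dual M E = {g \<in> borel_measurable (completion M).
     \<forall>f\<in>E. integrable (completion M) (\<lambda>\<omega>. f \<omega> * g \<omega>)}"

definition koethe_dual_norm :: "'a measure \<Rightarrow> ('a \<Rightarrow> real) set \<Rightarrow> (('a \<Rightarrow> real) \<Rightarrow> real)
    \<Rightarrow> ('a \<Rightarrow> real) \<Rightarrow> real" where
  "koethe_dual_norm M E nrm g = dual_norm E nrm (\<lambda>f. LINT \<omega>|completion M. f \<omega> * g \<omega>)"

subsection \<open>Koethe-Bochner spaces\<close>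

definition koethe_bochner :: "'a measure \<Rightarrow> ('a \<Rightarrow> real) set \<Rightarrow> ('a \<Rightarrow> 'z::real_normed_vector) set" where
  "koethe_bochner M E = {f. strongly_measurable M f \<and> (\<lambda>\<omega>. norm (f \<omega>)) \<in> E}"

definition koethe_bochner_norm :: "(('a \<Rightarrow> real) \<Rightarrow> real) \<Rightarrow> ('a \<Rightarrow> 'z::real_normed_vector) \<Rightarrow> real" where
  "koethe_bochner_norm nrm f = nrm (\<lambda>\<omega>. norm (f \<omega>))"

text \<open>The closed unit ball of \<open>E\<^sup>*(X\<^sup>*)\<close>, as a set of functionals on \<open>E(X)\<close>:\<close>

definition dual_bochner_ball :: "'a measure \<Rightarrow> ('a \<Rightarrow> real) set \<Rightarrow> (('a \<Rightarrow> real) \<Rightarrow> real)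
    \<Rightarrow> (('a \<Rightarrow> 'x::real_normed_vector) \<Rightarrow> real) set" where
  "dual_bochner_ball M E nrm =
     (\<lambda>(g :: 'a \<Rightarrow> 'x \<Rightarrow>\<^sub>L real) f. LINT \<omega>|completion M. blinfun_apply (g \<omega>) (f \<omega>)) `
       {g \<in> koethe_bochner M (koethe_dual M E).
          koethe_bochner_norm (koethe_dual_norm M E nrm) g \<le> 1}"

subsection \<open>The Radon-Nikodym property\<close>

text \<open>
  The Bochner integral of the library is restricted to second countable spaces. The following is
  the same definition, with Borel measurability replaced by strong measurability.
\<close>

definition has_strong_bochner_integral ::
    "'b measure \<Rightarrow> ('b \<Rightarrow> 'z::real_normed_vector) \<Rightarrow> 'z \<Rightarrow> bool" where
  "has_strong_bochner_integral N f x \<longleftrightarrow> strongly_measurable N f \<and>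
     (\<exists>s. (\<forall>i. Bochner_Integration.simple_bochner_integrable N (s i)) \<and>
        (\<lambda>i. \<integral>\<^sup>+\<omega>. ennreal (norm (f \<omega> - s i \<omega>)) \<partial>N) \<longlonglongrightarrow> 0 \<and>
        (\<lambda>i. Bochner_Integration.simple_bochner_integral N (s i)) \<longlonglongrightarrow> x)"

definition vector_measure :: "'b measure \<Rightarrow> ('b set \<Rightarrow> 'z::real_normed_vector) \<Rightarrow> bool" where
  "vector_measure N \<nu> \<longleftrightarrow>
     (\<forall>A :: nat \<Rightarrow> 'b set. range A \<subseteq> sets N \<longrightarrow> disjoint_family A \<longrightarrow>
        (\<lambda>i. \<nu> (A i)) sums \<nu> (\<Union>i. A i))"

definition has_bounded_variation :: "'b measure \<Rightarrow> ('b set \<Rightarrow> 'z::real_normed_vector) \<Rightarrow> bool" where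
  "has_bounded_variation N \<nu> \<longleftrightarrow>
     (\<exists>C. \<forall>P. finite P \<longrightarrow> P \<subseteq> sets N \<longrightarrow> partition_on (space N) P \<longrightarrow> (\<Sum>A\<in>P. norm (\<nu> A)) \<le> C)"

text \<open>
  The first type argument is the type of the points of the measure spaces considered. Leaving it
  a free type variable in the conclusion of a theorem expresses that all finite measure spaces
  are considered.
\<close>

definition radon_nikodym_property :: "'b itself \<Rightarrow> 'z::banach itself \<Rightarrow> bool" where
  "radon_nikodym_property _ _ \<longleftrightarrow>
     (\<forall>(N :: 'b measure) (\<nu> :: 'b set \<Rightarrow> 'z).
        finite_measure N \<longrightarrow> vector_measure N \<nu> \<longrightarrow> has_bounded_variation N \<nu> \<longrightarrow>
        (\<forall>A\<in>null_sets N. \<nu> A = 0) \<longrightarrow>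
        (\<exists>f. \<forall>A\<in>sets N. has_strong_bochner_integral N (\<lambda>\<omega>. indicator A \<omega> *\<^sub>R f \<omega>) (\<nu> A)))"

end

theory Submission
  imports Defs
begin

text \<open>
  Assume that \<open>X\<^sup>*\<close> fails the Radon-Nikodym property. The proof produces a bounded sequence in
  \<open>E(X)\<close> that tends to 0 against every \<open>g \<in> L\<^sub>1(X\<^sup>*)\<close>, in particular against the ball of
  \<open>E\<^sup>*(X\<^sup>*)\<close>, but is not weakly null.
  
  A vector measure \<open>\<nu>\<close> of bounded variation, absolutely continuous with respect to a finite measure
  \<open>N\<close>, has a Bochner density as soon as its averages \<open>\<nu>(A) / N(A)\<close> over finite partitions form a
  Cauchy net in \<open>L\<^sub>1(N; X\<^sup>*)\<close> (\<open>stable_spread_imp_density\<close>). If they do not, then, after \<open>\<nu>\<close> has been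
  restricted to a large set on which \<open>\<parallel>\<nu>(A)\<parallel> \<le> K N(A)\<close> (\<open>bounded_variation_truncation\<close>), there are
  refining partitions whose averages form a bounded martingale \<open>(M\<^sub>n)\<close> with values in \<open>X\<^sup>*\<close> and with
  \<open>\<parallel>M\<^sub>n\<^sub>+\<^sub>1 - M\<^sub>n\<parallel>\<^sub>1 \<ge> \<delta>\<close> for all \<open>n\<close>. Such a martingale is determined by the
  masses of the cells and the values of \<open>\<nu>\<close> on them. Hence it can be copied to the given space: a part of \<open>\<Omega>\<close> without atoms contains
  events with any prescribed joint distribution (\<open>realize_events\<close>, from Sierpinski's theorem).
  
  Choose simple functions \<open>x\<^sub>n\<^sub>+\<^sub>1\<close> with values in the unit ball of \<open>X\<close>, measurable with respect to the
  partition \<open>n + 1\<close>, that norm \<open>M\<^sub>n\<^sub>+\<^sub>1 - M\<^sub>n\<close> up to a factor 2, and let \<open>f\<^sub>n\<close> be \<open>x\<^sub>n\<^sub>+\<^sub>1\<close> minus its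
  conditional expectation with respect to the partition \<open>n\<close>. For a fixed \<open>z \<in> X\<^sup>*\<close> the functions
  \<open>\<langle>z, f\<^sub>n\<rangle>\<close> are bounded martingale differences, thus orthogonal in \<open>L\<^sub>2\<close>, and by Bessel's inequality
  their integrals over any set tend to 0. Approximation by simple functions extends this to all
  \<open>g \<in> L\<^sub>1(X\<^sup>*)\<close> (\<open>martingale_difference_null\<close>). On the other hand, let \<open>\<psi>\<close> be a weak* cluster point of the
  functionals \<open>f \<mapsto> \<integral>\<langle>M\<^sub>n, f\<rangle>\<close>. For \<open>m > n\<close> the martingale property gives
  \<open>\<integral>\<langle>M\<^sub>m, f\<^sub>n\<rangle> = \<integral>\<langle>M\<^sub>n\<^sub>+\<^sub>1, f\<^sub>n\<rangle> = \<integral>\<langle>M\<^sub>n\<^sub>+\<^sub>1 - M\<^sub>n, x\<^sub>n\<^sub>+\<^sub>1\<rangle> \<ge> \<delta> / 2\<close>, so that \<open>\<psi>(f\<^sub>n) \<ge> \<delta> / 2\<close> for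
  all \<open>n\<close> (\<open>rainwater_imp_martingale_Cauchy\<close>).
  
  Refining partitions are generated by sequences of events \<open>D\<^sub>0, D\<^sub>1, \<dots>\<close>. A cell of the \<open>n\<close>-th partition
  is named by a word of \<open>n\<close> bits that tells which of the first \<open>n\<close> events occur, the most recent one
  first, so that \<open>u @ a\<close> names a part of the cell \<open>a\<close>. A martingale becomes a pair of additive functions
  on words: \<open>w\<close> for the masses of the cells and \<open>v\<close> for the values of \<open>\<nu>\<close> on them.
\<close>

section \<open>Martingales on binary trees of events\<close>

definition words :: "nat \<Rightarrow> bool list set" where
  "words n = {l. length l = n}"

lemma words_0 [simp]: "words 0 = {[]}"
  by (auto simp: words_def)

lemma finite_words [simp]: "finite (words n)"
  using finite_lists_length_eq[of "UNIV :: bool set" n] by (simp add: words_def)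

lemma words_Suc: "words (Suc n) = (\<lambda>l. True # l) ` words n \<union> (\<lambda>l. False # l) ` words n"
  by (auto simp: words_def length_Suc_conv image_iff)

lemma sum_words_Suc:
  fixes F :: "bool list \<Rightarrow> 'c::comm_monoid_add"
  shows "(\<Sum>l\<in>words (Suc n). F l) = (\<Sum>l\<in>words n. F (True # l) + F (False # l))"
proof -
  have "(\<Sum>l\<in>words (Suc n). F l) = sum F ((\<lambda>l. True # l) ` words n) + sum F ((\<lambda>l. False # l) ` words n)"
    unfolding words_Suc by (rule sum.union_disjoint) auto
  also have "\<dots> = (\<Sum>l\<in>words n. F (True # l)) + (\<Sum>l\<in>words n. F (False # l))"
    by (simp add: sum.reindex)
  finally show ?thesis by (simp add: sum.distrib)
qed

lemma sum_words_add:
  fixes F :: "bool list \<Rightarrow> 'c::comm_monoid_add"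
  shows "(\<Sum>l\<in>words (m + d). F l) = (\<Sum>a\<in>words m. \<Sum>u\<in>words d. F (u @ a))"
proof (induction d arbitrary: F)
  case 0
  then show ?case by simp
next
  case (Suc d)
  show ?case by (simp add: sum_words_Suc Suc)
qed

definition tree_additive :: "(bool list \<Rightarrow> 'z::comm_monoid_add) \<Rightarrow> bool" where
  "tree_additive v \<longleftrightarrow> (\<forall>l. v l = v (True # l) + v (False # l))"

lemma sum_descendants:
  assumes "tree_additive v"
  shows "(\<Sum>u\<in>words d. v (u @ a)) = v a"
proof (induction d)
  case (Suc d)
  have "v (True # l) + v (False # l) = v l" for l
    using assms unfolding tree_additive_def by metis
  with Suc show ?case by (simp add: sum_words_Suc)
qed simp

lemma tree_weight_le:
  fixes w :: "bool list \<Rightarrow> real"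
  assumes "tree_additive w" "\<And>l. 0 \<le> w l"
  shows "w (u @ a) \<le> w a"
proof -
  have "u \<in> words (length u)" by (simp add: words_def)
  then have "w (u @ a) \<le> (\<Sum>u\<in>words (length u). w (u @ a))"
    using assms(2) by (intro member_le_sum) auto
  then show ?thesis by (simp add: sum_descendants[OF assms(1)])
qed

fun code :: "(nat \<Rightarrow> 'a set) \<Rightarrow> nat \<Rightarrow> 'a \<Rightarrow> bool list" where
  "code D 0 \<omega> = []"
| "code D (Suc n) \<omega> = (\<omega> \<in> D n) # code D n \<omega>"

definition cell :: "'a set \<Rightarrow> (nat \<Rightarrow> 'a set) \<Rightarrow> bool list \<Rightarrow> 'a set" where
  "cell S D l = {\<omega>\<in>S. code D (length l) \<omega> = l}"

lemma length_code [simp]: "length (code D n \<omega>) = n"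
  by (induction n) auto

lemma code_in_words [simp]: "code D n \<omega> \<in> words n"
  by (simp add: words_def)

lemma drop_code: "drop d (code D (m + d) \<omega>) = code D m \<omega>"
  by (induction d) auto

lemma cell_Nil [simp]: "cell S D [] = S"
  by (auto simp: cell_def)

lemma cell_Cons: "cell S D (b # l) = (if b then cell S D l \<inter> D (length l) else cell S D l - D (length l))"
  by (auto simp: cell_def)

lemma sets_cell [measurable]:
  assumes "S \<in> sets M" "\<And>i. D i \<in> sets M"
  shows "cell S D l \<in> sets M"
  using assms by (induction l) (auto simp: cell_Cons)

lemma cell_cong:
  assumes "\<And>i. i < length l \<Longrightarrow> C i = D i"
  shows "cell S C l = cell S D l"
  using assms by (induction l) (auto simp: cell_Cons)

lemma cell_inter: "cell S D l \<inter> T = cell (S \<inter> T) D l"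
  by (auto simp: cell_def)

text \<open>
  Additivity on words is finite additivity of the set function along the splitting of a cell into its
  two halves.
\<close>

lemma tree_additive_cell:
  assumes "S \<in> sets M" "\<And>i. D i \<in> sets M"
    and "\<And>A B. A \<in> sets M \<Longrightarrow> B \<in> sets M \<Longrightarrow> A \<inter> B = {} \<Longrightarrow> \<nu> (A \<union> B) = \<nu> A + \<nu> B"
  shows "tree_additive (\<lambda>l. \<nu> (cell S D l))"
  unfolding tree_additive_def
proof
  fix l
  have c: "cell S D l \<in> sets M" using assms(1,2) by (rule sets_cell)
  have "\<nu> (cell S D l) = \<nu> (cell S D l \<inter> D (length l) \<union> (cell S D l - D (length l)))"
    by (rule arg_cong[of _ _ \<nu>]) auto
  also have "\<dots> = \<nu> (cell S D l \<inter> D (length l)) + \<nu> (cell S D l - D (length l))"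
    using c assms(2) by (intro assms(3)) auto
  finally show "\<nu> (cell S D l) = \<nu> (cell S D (True # l)) + \<nu> (cell S D (False # l))"
    by (simp add: cell_Cons)
qed

lemma tree_additive_measure_cell:
  assumes "finite_measure M" "S \<in> sets M" "\<And>i. D i \<in> sets M"
  shows "tree_additive (\<lambda>l. measure M (cell S D l))"
  using assms finite_measure.finite_measure_Union[OF assms(1)]
  by (intro tree_additive_cell[where M=M and \<nu>="measure M"]) auto

lemma code_sum_indicator:
  fixes F :: "bool list \<Rightarrow> 'z::real_vector"
  assumes "\<omega> \<in> S"
  shows "F (code D n \<omega>) = (\<Sum>l\<in>words n. indicator (cell S D l) \<omega> *\<^sub>R F l)"
proof -
  have "(\<Sum>l\<in>words n. indicator (cell S D l) \<omega> *\<^sub>R F l)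
      = (\<Sum>l\<in>words n. if code D n \<omega> = l then F l else 0)"
    using assms by (intro sum.cong) (auto simp: cell_def words_def indicator_def)
  then show ?thesis by (simp add: sum.delta)
qed

lemma simple_function_code:
  assumes "\<And>i. D i \<in> sets M"
  shows "simple_function M (code D n)"
  unfolding simple_function_def
proof (intro conjI ballI)
  show "finite (code D n ` space M)"
    by (rule finite_subset[OF _ finite_words[of n]]) auto
  fix l
  assume "l \<in> code D n ` space M"
  then have "length l = n" by auto
  then have "code D n -` {l} \<inter> space M = cell (space M) D l"
    by (auto simp: cell_def)
  also have "\<dots> \<in> sets M" using assms by (intro sets_cell) auto
  finally show "code D n -` {l} \<inter> space M \<in> sets M" .
qed

lemma integral_code:
  fixes F :: "bool list \<Rightarrow> real"
  assumes "finite_measure M" "S \<in> sets M" "\<And>i. D i \<in> sets M"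
  shows "integrable M (\<lambda>\<omega>. indicator S \<omega> * F (code D n \<omega>))" (is ?I)
    and "(LINT \<omega>|M. indicator S \<omega> * F (code D n \<omega>)) = (\<Sum>l\<in>words n. measure M (cell S D l) * F l)" (is ?E)
proof -
  interpret finite_measure M by fact
  have eq: "indicator S \<omega> * F (code D n \<omega>) = (\<Sum>l\<in>words n. indicator (cell S D l) \<omega> * F l)" for \<omega>
  proof (cases "\<omega> \<in> S")
    case True
    then show ?thesis using code_sum_indicator[of \<omega> S F D n] by simp
  next
    case False
    then have "\<omega> \<notin> cell S D l" for l by (auto simp: cell_def)
    with False show ?thesis by simp
  qed
  have i: "integrable M (indicator (cell S D l) :: _ \<Rightarrow> real)" for l
    using sets_cell[OF assms(2,3)] emeasure_finite
    by (intro integrable_real_indicator) (auto simp: less_top[symmetric])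
  show ?I unfolding eq using i by (intro Bochner_Integration.integrable_sum) auto
  show ?E unfolding eq
    using i sets.sets_into_space[OF sets_cell[OF assms(2,3)]]
    by (subst Bochner_Integration.integral_sum) (auto simp: Int_absorb2)
qed

text \<open>
  The \<open>L\<^sub>1\<close> distance between the levels \<open>m\<close> and \<open>m + d\<close> of the martingale with value \<open>v l / w l\<close> on the
  cell \<open>l\<close>. The summand is the mass \<open>w (u @ a)\<close> times the norm of the increment, multiplied out so that
  cells of mass 0 (where the quotients are 0 by convention) need no special treatment.
\<close>

definition spread :: "(bool list \<Rightarrow> real) \<Rightarrow> (bool list \<Rightarrow> 'z::real_normed_vector) \<Rightarrow> nat \<Rightarrow> nat \<Rightarrow> real" where
  "spread w v m d = (\<Sum>a\<in>words m. \<Sum>u\<in>words d. norm (v (u @ a) - (w (u @ a) / w a) *\<^sub>R v a))"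

text \<open>
  Rescaling the masses does not change the spread; so a copy of a martingale may live on a set of any
  positive measure.
\<close>

lemma spread_scale:
  assumes "c \<noteq> 0"
  shows "spread (\<lambda>l. c * w l) v m d = spread w v m d"
  using assms by (simp add: spread_def)

lemma spread_le_variation:
  assumes w: "tree_additive w" "\<And>l. 0 \<le> w l"
  shows "spread w v m d \<le> (\<Sum>l\<in>words (m + d). norm (v l)) + (\<Sum>l\<in>words m. norm (v l))"
proof -
  have "norm (v (u @ a) - (w (u @ a) / w a) *\<^sub>R v a) \<le> norm (v (u @ a)) + w (u @ a) / w a * norm (v a)" for u a
    using norm_triangle_ineq4[of "v (u @ a)" "(w (u @ a) / w a) *\<^sub>R v a"] w(2) by simp
  then have "spread w v m d \<le> (\<Sum>a\<in>words m. \<Sum>u\<in>words d. norm (v (u @ a)) + w (u @ a) / w a * norm (v a))"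
    unfolding spread_def by (intro sum_mono) auto
  also have "\<dots> = (\<Sum>l\<in>words (m + d). norm (v l)) + (\<Sum>a\<in>words m. (\<Sum>u\<in>words d. w (u @ a)) / w a * norm (v a))"
    by (simp add: sum.distrib sum_words_add sum_divide_distrib sum_distrib_right)
  also have "(\<Sum>a\<in>words m. (\<Sum>u\<in>words d. w (u @ a)) / w a * norm (v a)) \<le> (\<Sum>a\<in>words m. norm (v a))"
    by (intro sum_mono) (auto simp: sum_descendants[OF w(1)])
  finally show ?thesis by simp
qed

lemma spread_triangle:
  assumes "\<And>l. v l = v1 l + v2 l"
  shows "spread w v m d \<le> spread w v1 m d + spread w v2 m d"
  unfolding spread_def sum.distrib[symmetric]
  by (intro sum_mono norm_triangle_le order_trans[OF _ norm_triangle_ineq] eq_refl arg_cong[where f=norm])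
     (simp add: assms algebra_simps)

lemma spread_cong:
  assumes "\<And>l. length l \<le> m + d \<Longrightarrow> w l = w' l" "\<And>l. length l \<le> m + d \<Longrightarrow> v l = v' l"
  shows "spread w v m d = spread w' v' m d"
  unfolding spread_def using assms by (intro sum.cong refl) (auto simp: words_def)

section \<open>Nonatomic measures realize all joint distributions\<close>

text \<open>
  A set of positive measure that is not an atom splits into two parts of positive measure, and one of
  them has at most half the measure. Repeated halving makes the measure as small as desired.
\<close>

lemma nonatomic_small_subset:
  assumes "finite_measure M" and S: "S \<in> sets M" "measure M S > 0"
    and na: "\<And>B. B \<subseteq> S \<Longrightarrow> \<not> is_atom M B" and "\<epsilon> > 0"
  shows "\<exists>T\<in>sets M. T \<subseteq> S \<and> 0 < measure M T \<and> measure M T < \<epsilon>"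
proof -
  interpret finite_measure M by fact
  have *: "\<exists>T\<in>sets M. T \<subseteq> S \<and> 0 < measure M T \<and> measure M T \<le> measure M S / 2 ^ n" for n
  proof (induction n)
    case 0
    then show ?case using S by auto
  next
    case (Suc n)
    then obtain T where T: "T \<in> sets M" "T \<subseteq> S" "0 < measure M T" "measure M T \<le> measure M S / 2 ^ n"
      by blast
    with na obtain B where B: "B \<in> sets M" "B \<subseteq> T" "measure M B \<noteq> 0" "measure M (T - B) \<noteq> 0"
      unfolding is_atom_def by blast
    have pos: "measure M B > 0" "measure M (T - B) > 0"
      using B(3,4) zero_less_measure_iff by blast+
    have sum: "measure M (T - B) = measure M T - measure M B"
      using B T by (intro finite_measure_Diff) auto
    have half: "measure M T / 2 \<le> measure M S / 2 ^ Suc n" using T(4) by simp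
    show ?case
    proof (cases "measure M B \<le> measure M T / 2")
      case True
      with half have "measure M B \<le> measure M S / 2 ^ Suc n" by linarith
      then show ?thesis using B T pos by blast
    next
      case False
      with half sum have "measure M (T - B) \<le> measure M S / 2 ^ Suc n" by linarith
      then show ?thesis using B T pos by (intro bexI[of _ "T - B"]) auto
    qed
  qed
  have "(\<lambda>n. measure M S * (1 / 2) ^ n) \<longlonglongrightarrow> measure M S * 0"
    by (intro tendsto_intros LIMSEQ_realpow_zero) auto
  then have "eventually (\<lambda>n. measure M S * (1 / 2) ^ n < \<epsilon>) sequentially"
    using \<open>\<epsilon> > 0\<close> by (intro order_tendstoD(2)) auto
  then obtain n where "measure M S * (1 / 2) ^ n < \<epsilon>"
    using eventually_happens'[OF sequentially_bot] by blast
  then have "measure M S / 2 ^ n < \<epsilon>" by (simp add: power_one_over field_simps)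
  moreover obtain T where "T \<in> sets M" "T \<subseteq> S" "0 < measure M T" "measure M T \<le> measure M S / 2 ^ n"
    using *[of n] by blast
  ultimately show ?thesis by (meson order_le_less_trans)
qed

text \<open>
  A supremum need not be attained, but half of the possible increase always is; this is the step of the
  exhaustion argument below.
\<close>

lemma nearly_largest_increment:
  fixes A :: "real set"
  assumes "a \<in> A" "\<And>x. x \<in> A \<Longrightarrow> x \<le> t"
  shows "\<exists>b\<in>A. \<forall>x\<in>A. x - a \<le> 2 * (b - a)"
proof (cases "Sup A = a")
  case True
  have "bdd_above A" using assms(2) by (intro bdd_aboveI)
  then have "\<forall>x\<in>A. x \<le> Sup A" by (auto intro: cSup_upper)
  with True assms(1) show ?thesis by (intro bexI[of _ a]) auto
next
  case False
  have bdd: "bdd_above A" using assms(2) by (intro bdd_aboveI)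
  then have le: "\<forall>x\<in>A. x \<le> Sup A" by (auto intro: cSup_upper)
  with False assms(1) have "a < Sup A" by force
  then have "(a + Sup A) / 2 < Sup A" by simp
  then obtain b where "b \<in> A" "(a + Sup A) / 2 < b"
    using less_cSup_iff[OF _ bdd] assms(1) by blast
  moreover have "x - a \<le> 2 * (b - a)" if "x \<in> A" for x
    using le that \<open>(a + Sup A) / 2 < b\<close> by (force simp: field_simps)
  ultimately show ?thesis by blast
qed

text \<open>
  Sierpinski's theorem, by exhaustion: enlarge a set of measure at most \<open>t\<close> again and again, each time by
  at least half of what is possible. If the union had measure less than \<open>t\<close>, a small set of positive
  measure could still be added, and this would have forced each step to add a fixed amount.
\<close>

lemma nonatomic_intermediate_value:
  assumes "finite_measure M" and S: "S \<in> sets M"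
    and na: "\<And>B. B \<subseteq> S \<Longrightarrow> \<not> is_atom M B" and t: "0 \<le> t" "t \<le> measure M S"
  shows "\<exists>T\<in>sets M. T \<subseteq> S \<and> measure M T = t"
proof -
  interpret finite_measure M by fact
  define good where "good T \<longleftrightarrow> T \<in> sets M \<and> T \<subseteq> S \<and> measure M T \<le> t" for T
  define big where "big T T' \<longleftrightarrow> T \<subseteq> T' \<and>
    (\<forall>R. good R \<longrightarrow> T \<subseteq> R \<longrightarrow> measure M R - measure M T \<le> 2 * (measure M T' - measure M T))" for T T'
  have step: "\<exists>T'. good T' \<and> big T T'" if "good T" for T
  proof -
    define A where "A = {measure M R |R. good R \<and> T \<subseteq> R}"
    have "measure M T \<in> A" using that unfolding A_def by blast
    moreover have "x \<le> t" if "x \<in> A" for x using that unfolding A_def good_def by blast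
    ultimately have "\<exists>b\<in>A. \<forall>x\<in>A. x - measure M T \<le> 2 * (b - measure M T)"
      by (rule nearly_largest_increment)
    then obtain T' where T': "good T'" "T \<subseteq> T'"
        "\<forall>R. good R \<and> T \<subseteq> R \<longrightarrow> measure M R - measure M T \<le> 2 * (measure M T' - measure M T)"
      unfolding A_def by blast
    then show ?thesis unfolding big_def by blast
  qed
  have "good {}" using t by (simp add: good_def)
  then obtain T where T: "\<And>n. good (T n)" "\<And>n. big (T n) (T (Suc n))"
    using dependent_nat_choice[of "\<lambda>_. good" "\<lambda>_. big"] step by blast
  define U where "U = (\<Union>n. T n)"
  have "incseq T" using T(2) by (intro incseq_SucI) (auto simp: big_def)
  have Ts: "T n \<in> sets M" "T n \<subseteq> S" "measure M (T n) \<le> t" for n using T(1)[of n] by (auto simp: good_def)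
  have lim: "(\<lambda>n. measure M (T n)) \<longlonglongrightarrow> measure M U"
    unfolding U_def using Ts \<open>incseq T\<close> by (intro finite_Lim_measure_incseq) auto
  have Ule: "measure M U \<le> t" using lim Ts(3) by (intro LIMSEQ_le_const2) auto
  have Us: "U \<in> sets M" "U \<subseteq> S" unfolding U_def using Ts by auto
  have "measure M U = t"
  proof (rule ccontr)
    assume "measure M U \<noteq> t"
    with Ule have lt: "measure M U < t" by simp
    have "measure M (S - U) = measure M S - measure M U" using Us S by (intro finite_measure_Diff) auto
    with lt t have "measure M (S - U) > 0" by simp
    then have "\<exists>B\<in>sets M. B \<subseteq> S - U \<and> 0 < measure M B \<and> measure M B < t - measure M U"
      using lt S Us na by (intro nonatomic_small_subset finite_measure_axioms) auto
    then obtain B where B: "B \<in> sets M" "B \<subseteq> S - U" "0 < measure M B" "measure M B < t - measure M U"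
      by blast
    have inc: "measure M B \<le> 2 * (measure M (T (Suc n)) - measure M (T n))" for n
    proof -
      have "T n \<subseteq> U" unfolding U_def by auto
      then have m: "measure M (T n \<union> B) = measure M (T n) + measure M B" "measure M (T n) \<le> measure M U"
        using B Ts Us by (auto intro!: finite_measure_Union finite_measure_mono)
      then have "good (T n \<union> B)" using B Ts by (auto simp: good_def)
      with T(2)[of n] have "measure M (T n \<union> B) - measure M (T n) \<le> 2 * (measure M (T (Suc n)) - measure M (T n))"
        unfolding big_def by blast
      with m show ?thesis by simp
    qed
    have "(\<lambda>n. 2 * (measure M (T (Suc n)) - measure M (T n))) \<longlonglongrightarrow> 2 * (measure M U - measure M U)"
      by (intro tendsto_intros lim LIMSEQ_Suc[OF lim])
    then have "measure M B \<le> 2 * (measure M U - measure M U)"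
      by (rule LIMSEQ_le_const) (use inc in auto)
    with B show False by simp
  qed
  with Us show ?thesis by blast
qed

text \<open>
  Split cell after cell into two parts of prescribed measure, and let the event \<open>D\<^sub>n\<close> collect the first parts of
  all cells of level \<open>n\<close>.
\<close>

lemma realize_events:
  fixes w :: "bool list \<Rightarrow> real"
  assumes "finite_measure M" and S: "S \<in> sets M" and na: "\<And>B. B \<subseteq> S \<Longrightarrow> \<not> is_atom M B"
    and w: "\<And>l. 0 \<le> w l" "tree_additive w" "w [] = measure M S"
  shows "\<exists>D. (\<forall>i. D i \<in> sets M) \<and> (\<forall>l. measure M (cell S D l) = w l)"
proof -
  interpret finite_measure M by fact
  define part where "part R t = (SOME T. T \<in> sets M \<and> T \<subseteq> R \<and> measure M T = t)" for R t
  have part: "part R t \<in> sets M \<and> part R t \<subseteq> R \<and> measure M (part R t) = t"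
    if "R \<in> sets M" "R \<subseteq> S" "0 \<le> t" "t \<le> measure M R" for R t
  proof -
    have "\<exists>T\<in>sets M. T \<subseteq> R \<and> measure M T = t"
      by (rule nonatomic_intermediate_value[OF finite_measure_axioms that(1) _ that(3,4)])
         (use na that(2) in blast)
    then have "\<exists>T. T \<in> sets M \<and> T \<subseteq> R \<and> measure M T = t" by blast
    from someI_ex[OF this] show ?thesis unfolding part_def .
  qed
  define W where "W = rec_list S (\<lambda>b l R. if b then part R (w (True # l)) else R - part R (w (True # l)))"
  have W_Nil: "W [] = S" and W_Cons: "W (b # l) = (if b then part (W l) (w (True # l)) else W l - part (W l) (w (True # l)))" for b l
    by (auto simp: W_def)
  have ws: "w (True # l) + w (False # l) = w l" for l
    using w(2) unfolding tree_additive_def by metis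
  have W: "W l \<in> sets M \<and> W l \<subseteq> S \<and> measure M (W l) = w l" for l
  proof (induction l)
    case Nil
    then show ?case using S w by (simp add: W_Nil)
  next
    case (Cons b l)
    have "w (True # l) \<le> measure M (W l)" using Cons ws[of l] w(1)[of "False # l"] by simp
    then have p: "part (W l) (w (True # l)) \<in> sets M \<and> part (W l) (w (True # l)) \<subseteq> W l
        \<and> measure M (part (W l) (w (True # l))) = w (True # l)"
      using Cons w(1) by (intro part) auto
    have "measure M (W l - part (W l) (w (True # l))) = measure M (W l) - measure M (part (W l) (w (True # l)))"
      using p Cons by (intro finite_measure_Diff) auto
    then have "measure M (W l - part (W l) (w (True # l))) = w (False # l)" using p Cons ws[of l] by simp
    with p Cons show ?case by (cases b) (auto simp: W_Cons)
  qed
  have sub: "W (b # l) \<subseteq> W l" for b l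
  proof -
    have "w (True # l) \<le> measure M (W l)" using W ws[of l] w(1)[of "False # l"] by simp
    then show ?thesis using part[of "W l" "w (True # l)"] W w(1) by (auto simp: W_Cons)
  qed
  define D where "D n = (\<Union>l\<in>words n. W (True # l))" for n
  have Ds: "D n \<in> sets M" for n unfolding D_def using W by auto
  have disj: "W l \<inter> W l' = {}" if "length l = length l'" "l \<noteq> l'" for l l'
    using that
  proof (induction l l' rule: list_induct2)
    case (Cons b l b' l')
    show ?case
    proof (cases "l = l'")
      case True
      with Cons have "b \<noteq> b'" by simp
      with True show ?thesis by (cases b) (auto simp: W_Cons)
    next
      case False
      with Cons.IH sub[of b l] sub[of b' l'] show ?thesis by blast
    qed
  qed simp
  have "cell S D l = W l" for l
  proof (induction l)
    case Nil
    then show ?case by (simp add: W_Nil)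
  next
    case (Cons b l)
    have "W l \<inter> D (length l) = W (True # l)"
    proof
      show "W (True # l) \<subseteq> W l \<inter> D (length l)" using sub unfolding D_def words_def by fast
      show "W l \<inter> D (length l) \<subseteq> W (True # l)"
      proof
        fix \<omega>
        assume *: "\<omega> \<in> W l \<inter> D (length l)"
        then obtain l' where l': "length l' = length l" "\<omega> \<in> W (True # l')" unfolding D_def words_def by auto
        then have "\<omega> \<in> W l'" using sub by blast
        with * disj[of l l'] l' show "\<omega> \<in> W (True # l)" by fastforce
      qed
    qed
    moreover have "W (False # l) = W l - W (True # l)" by (simp add: W_Cons)
    ultimately show ?case using Cons by (cases b) (auto simp: cell_Cons)
  qed
  with W Ds show ?thesis by (intro exI[of _ D]) auto
qed

section \<open>Martingale differences are null against integrable functions\<close>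

text \<open>
  Strong measurability only gives limits almost everywhere. This is why all integrals are taken over the
  completion, where a function that agrees almost everywhere with a measurable one is measurable.
\<close>

lemma borel_measurable_completion_AE_LIMSEQ:
  fixes u :: "nat \<Rightarrow> 'a \<Rightarrow> real"
  assumes u: "\<And>k. u k \<in> borel_measurable (completion M)"
    and lim: "AE \<omega> in M. (\<lambda>k. u k \<omega>) \<longlonglongrightarrow> f \<omega>"
  shows "f \<in> borel_measurable (completion M)"
proof (rule measurableI)
  define g where "g \<omega> = lim (\<lambda>k. u k \<omega>)" for \<omega>
  have g: "g \<in> borel_measurable (completion M)"
    unfolding g_def by (rule borel_measurable_lim_metric) (rule u)
  have eq: "AE \<omega> in completion M. g \<omega> = f \<omega>"
    using AE_completion[OF lim] unfolding g_def by eventually_elim (rule limI)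
  fix A :: "real set"
  assume A: "A \<in> sets borel"
  show "f -` A \<inter> space (completion M) \<in> sets (completion M)"
  proof (rule completion.in_sets_AE)
    show "g -` A \<inter> space (completion M) \<in> sets (completion M)"
      using g A by (rule measurable_sets)
    show "AE \<omega> in completion M. \<omega> \<in> g -` A \<inter> space (completion M) \<longleftrightarrow> \<omega> \<in> f -` A \<inter> space (completion M)"
      using eq by eventually_elim auto
  qed auto
qed auto

lemma strongly_measurable_continuous_compose:
  fixes T :: "'z::real_normed_vector \<Rightarrow> real"
  assumes f: "strongly_measurable M f" and T: "continuous_on UNIV T"
  shows "(\<lambda>\<omega>. T (f \<omega>)) \<in> borel_measurable (completion M)"
proof -
  obtain s where s: "\<And>k. simple_function M (s k)" "AE \<omega> in M. (\<lambda>k. s k \<omega>) \<longlonglongrightarrow> f \<omega>"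
    using f unfolding strongly_measurable_def by blast
  show ?thesis
  proof (rule borel_measurable_completion_AE_LIMSEQ)
    have "simple_function M (\<lambda>\<omega>. T (s k \<omega>))" for k
      using simple_function_compose[OF s(1)[of k], of T] by (simp add: comp_def)
    then show "(\<lambda>\<omega>. T (s k \<omega>)) \<in> borel_measurable (completion M)" for k
      by (intro measurable_completion borel_measurable_simple_function)
    show "AE \<omega> in M. (\<lambda>k. T (s k \<omega>)) \<longlonglongrightarrow> T (f \<omega>)"
      using s(2) by eventually_elim (rule continuous_on_tendsto_compose[OF T], auto)
  qed
qed

lemma strongly_measurable_simple: "simple_function M f \<Longrightarrow> strongly_measurable M f"
  unfolding strongly_measurable_def by (intro exI[of _ "\<lambda>_. f"]) auto

text \<open>
  Simple functions that converge almost everywhere need not converge in \<open>L\<^sub>1\<close>. Cutting them off where they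
  exceed \<open>2 \<parallel>g\<parallel>\<close> keeps the pointwise limit and makes \<open>3 \<parallel>g\<parallel>\<close> a dominating function.
\<close>

lemma strongly_measurable_L1_approx:
  fixes g :: "'a \<Rightarrow> 'z::real_normed_vector"
  assumes g: "strongly_measurable M g" and int: "integrable (completion M) (\<lambda>\<omega>. norm (g \<omega>))"
    and "0 < e"
  shows "\<exists>s. simple_function (completion M) s \<and> integrable (completion M) (\<lambda>\<omega>. norm (g \<omega> - s \<omega>)) \<and>
     (LINT \<omega>|completion M. norm (g \<omega> - s \<omega>)) < e"
proof -
  obtain s where s: "\<And>k. simple_function M (s k)" "AE \<omega> in M. (\<lambda>k. s k \<omega>) \<longlonglongrightarrow> g \<omega>"
    using g unfolding strongly_measurable_def by blast
  have ng: "(\<lambda>\<omega>. norm (g \<omega>)) \<in> borel_measurable (completion M)" using int by simp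
  have ns: "(\<lambda>\<omega>. norm (s k \<omega>)) \<in> borel_measurable (completion M)" for k
    using simple_function_compose[OF s(1)[of k], of norm]
    by (intro measurable_completion borel_measurable_simple_function) (simp add: comp_def)
  define B where "B k = {\<omega> \<in> space (completion M). norm (s k \<omega>) \<le> 2 * norm (g \<omega>)}" for k
  have B: "B k \<in> sets (completion M)" for k
    unfolding B_def using ng ns by measurable
  \<comment> \<open>The cut-off is decided by \<open>\<parallel>g\<parallel>\<close>, so \<open>r k\<close> is simple for the completion only.\<close>
  define r where "r k \<omega> = (if \<omega> \<in> B k then s k \<omega> else 0)" for k \<omega>
  have r: "simple_function (completion M) (r k)" for k
    unfolding r_def using B simple_function_completion[OF s(1)]
    by (intro simple_function_If) (auto simp: B_def)
  have meas: "(\<lambda>\<omega>. norm (g \<omega> - r k \<omega>)) \<in> borel_measurable (completion M)" for k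
  proof (rule borel_measurable_completion_AE_LIMSEQ)
    show "(\<lambda>\<omega>. norm (s j \<omega> - r k \<omega>)) \<in> borel_measurable (completion M)" for j
      using simple_function_compose2[OF simple_function_completion[OF s(1)[of j]] r[of k], of "\<lambda>x y. norm (x - y)"]
      by (rule borel_measurable_simple_function)
    show "AE \<omega> in M. (\<lambda>j. norm (s j \<omega> - r k \<omega>)) \<longlonglongrightarrow> norm (g \<omega> - r k \<omega>)"
      using s(2) by eventually_elim (intro tendsto_intros)
  qed
  have bound: "norm (g \<omega> - r k \<omega>) \<le> 3 * norm (g \<omega>)" for k \<omega>
    using norm_triangle_ineq4[of "g \<omega>" "r k \<omega>"] by (auto simp: r_def B_def)
  have lim: "AE \<omega> in completion M. (\<lambda>k. norm (g \<omega> - r k \<omega>)) \<longlonglongrightarrow> 0"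
    using AE_completion[OF s(2)] AE_space[of "completion M"]
  proof eventually_elim
    fix \<omega>
    assume l: "(\<lambda>k. s k \<omega>) \<longlonglongrightarrow> g \<omega>" and sp: "\<omega> \<in> space (completion M)"
    have "(\<lambda>k. r k \<omega>) \<longlonglongrightarrow> g \<omega>"
    proof (cases "g \<omega> = 0")
      case True
      then have "r k \<omega> = 0" for k by (auto simp: r_def B_def)
      with True show ?thesis by simp
    next
      case False
      have "eventually (\<lambda>k. norm (s k \<omega>) < 2 * norm (g \<omega>)) sequentially"
        using False by (intro order_tendstoD(2)[OF tendsto_norm[OF l]]) auto
      then have "eventually (\<lambda>k. s k \<omega> = r k \<omega>) sequentially"
        by eventually_elim (use sp in \<open>auto simp: r_def B_def\<close>)
      with l show ?thesis by (rule Lim_transform_eventually)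
    qed
    from tendsto_norm[OF tendsto_diff[OF tendsto_const[of "g \<omega>"] this]]
    show "(\<lambda>k. norm (g \<omega> - r k \<omega>)) \<longlonglongrightarrow> 0" by simp
  qed
  have "(\<lambda>k. LINT \<omega>|completion M. norm (g \<omega> - r k \<omega>)) \<longlonglongrightarrow> (LINT \<omega>|completion M. 0)"
    by (rule integral_dominated_convergence[where w="\<lambda>\<omega>. 3 * norm (g \<omega>)"])
       (use meas lim int bound in auto)
  then have "eventually (\<lambda>k. (LINT \<omega>|completion M. norm (g \<omega> - r k \<omega>)) < e) sequentially"
    using \<open>0 < e\<close> by (intro order_tendstoD(2)) auto
  then obtain k where k: "(LINT \<omega>|completion M. norm (g \<omega> - r k \<omega>)) < e"
    using eventually_happens'[OF sequentially_bot] by blast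
  have "integrable (completion M) (\<lambda>\<omega>. norm (g \<omega> - r k \<omega>))"
    by (rule Bochner_Integration.integrable_bound[of _ "\<lambda>\<omega>. 3 * norm (g \<omega>)"])
       (use meas int bound in auto)
  with r k show ?thesis by blast
qed

text \<open>
  Bessel's inequality: if \<open>c\<^sub>n\<close> is the integral of \<open>u\<^sub>n\<close> over \<open>A\<close>, then the residual
  \<open>\<chi>\<^sub>A - \<Sum>\<^sub>n\<^sub><\<^sub>N c\<^sub>n u\<^sub>n / Q\<close> has nonnegative square integral, and with \<open>Q\<close> an upper bound of all \<open>\<integral> u\<^sub>n\<^sup>2\<close>
  this bounds \<open>\<Sum>\<^sub>n\<^sub><\<^sub>N c\<^sub>n\<^sup>2 / Q\<close> by the measure of \<open>A\<close>.
\<close>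

lemma bounded_orthogonal_weakly_null:
  fixes u :: "nat \<Rightarrow> 'a \<Rightarrow> real"
  assumes "finite_measure P" and u: "\<And>n. u n \<in> borel_measurable P" "\<And>n \<omega>. \<bar>u n \<omega>\<bar> \<le> B"
    and orth: "\<And>j k. j < k \<Longrightarrow> (LINT \<omega>|P. u j \<omega> * u k \<omega>) = 0"
    and A: "A \<in> sets P"
  shows "(\<lambda>n. LINT \<omega>|P. indicator A \<omega> * u n \<omega>) \<longlonglongrightarrow> 0"
proof -
  interpret finite_measure P by fact
  have B: "0 \<le> B" using u(2)[of 0 undefined] by linarith
  define c where "c n = (LINT \<omega>|P. indicator A \<omega> * u n \<omega>)" for n
  \<comment> \<open>The summand 1 only keeps \<open>Q\<close> positive.\<close>
  define Q where "Q = B\<^sup>2 * measure P (space P) + 1"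
  have Q: "Q > 0" unfolding Q_def by (intro add_nonneg_pos mult_nonneg_nonneg) auto
  define R where "R N \<omega> = indicator A \<omega> - (\<Sum>n<N. c n / Q * u n \<omega>)" for N \<omega>
  have [measurable]: "u n \<in> borel_measurable P" "A \<in> sets P" for n by (fact u(1) A)+
  have [measurable]: "R N \<in> borel_measurable P" for N unfolding R_def by measurable
  have Rb: "\<exists>K. \<forall>\<omega>. \<bar>R N \<omega>\<bar> \<le> K" for N
  proof (induction N)
    case 0
    show ?case by (rule exI[of _ 1]) (auto simp: R_def indicator_def)
  next
    case (Suc N)
    then obtain K where K: "\<And>\<omega>. \<bar>R N \<omega>\<bar> \<le> K" by blast
    show ?case
    proof (intro exI allI)
      fix \<omega>
      have "R (Suc N) \<omega> = R N \<omega> - c N / Q * u N \<omega>" by (simp add: R_def)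
      also have "\<bar>\<dots>\<bar> \<le> \<bar>R N \<omega>\<bar> + \<bar>c N / Q\<bar> * \<bar>u N \<omega>\<bar>" 
        unfolding abs_mult[symmetric] by (rule abs_triangle_ineq4)
      also have "\<dots> \<le> K + \<bar>c N / Q\<bar> * B" by (intro add_mono mult_left_mono K u(2)) auto
      finally show "\<bar>R (Suc N) \<omega>\<bar> \<le> K + \<bar>c N / Q\<bar> * B" .
    qed
  qed
  have bnd: "integrable P f" if "f \<in> borel_measurable P" "\<And>\<omega>. \<bar>f \<omega>\<bar> \<le> K" for f :: "'a \<Rightarrow> real" and K
    using that by (intro integrable_const_bound[of _ K]) auto
  have prod: "integrable P (\<lambda>\<omega>. f \<omega> * g \<omega>)"
    if "f \<in> borel_measurable P" "g \<in> borel_measurable P" "\<And>\<omega>. \<bar>f \<omega>\<bar> \<le> K" "\<And>\<omega>. \<bar>g \<omega>\<bar> \<le> L"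
    for f g :: "'a \<Rightarrow> real" and K L
  proof (rule bnd)
    show "(\<lambda>\<omega>. f \<omega> * g \<omega>) \<in> borel_measurable P" using that(1,2) by measurable
    show "\<bar>f \<omega> * g \<omega>\<bar> \<le> K * L" for \<omega>
      unfolding abs_mult using that(3)[of \<omega>] that(4)[of \<omega>] by (intro mult_mono) auto
  qed
  have iuu: "integrable P (\<lambda>\<omega>. u j \<omega> * u k \<omega>)" for j k
    by (rule prod) (use u in auto)
  have iAu: "integrable P (\<lambda>\<omega>. indicator A \<omega> * u k \<omega>)" for k
    by (rule prod[of _ _ 1]) (use u A in \<open>auto simp: indicator_def\<close>)
  have iRR: "integrable P (\<lambda>\<omega>. R N \<omega> * R N \<omega>)" for N
  proof -
    obtain K where "\<And>\<omega>. \<bar>R N \<omega>\<bar> \<le> K" using Rb by blast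
    then show ?thesis by (intro prod) auto
  qed
  have iRu: "integrable P (\<lambda>\<omega>. R N \<omega> * u k \<omega>)" for N k
  proof -
    obtain K where "\<And>\<omega>. \<bar>R N \<omega>\<bar> \<le> K" using Rb by blast
    then show ?thesis using u by (intro prod) auto
  qed
  have Ru: "(LINT \<omega>|P. R N \<omega> * u N \<omega>) = c N" for N
  proof -
    have "(LINT \<omega>|P. R N \<omega> * u N \<omega>)
        = (LINT \<omega>|P. indicator A \<omega> * u N \<omega> - (\<Sum>n<N. c n / Q * (u n \<omega> * u N \<omega>)))"
      by (simp add: R_def algebra_simps sum_distrib_left)
    also have "\<dots> = c N - (\<Sum>n<N. c n / Q * (LINT \<omega>|P. u n \<omega> * u N \<omega>))"
      unfolding c_def using iAu iuu
      by (subst Bochner_Integration.integral_diff) (auto simp: Bochner_Integration.integral_sum)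
    also have "\<dots> = c N" using orth by simp
    finally show ?thesis .
  qed
  have uu: "(LINT \<omega>|P. u n \<omega> * u n \<omega>) \<le> Q" for n
  proof -
    have "(LINT \<omega>|P. u n \<omega> * u n \<omega>) \<le> (LINT \<omega>|P. B\<^sup>2)"
    proof (rule integral_mono)
      show "u n \<omega> * u n \<omega> \<le> B\<^sup>2" for \<omega>
        using power_mono[OF u(2)[of n \<omega>] abs_ge_zero, of 2] by (simp add: power2_eq_square)
    qed (use iuu in auto)
    then show ?thesis by (simp add: Q_def mult.commute)
  qed
  have "(LINT \<omega>|P. R N \<omega> * R N \<omega>) + (\<Sum>n<N. (c n)\<^sup>2 / Q) \<le> measure P A" for N
  proof (induction N)
    case 0
    have "R 0 \<omega> * R 0 \<omega> = indicator A \<omega>" for \<omega> by (simp add: R_def indicator_def)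
    then show ?case using A sets.sets_into_space[OF A] by (simp add: Int_absorb2)
  next
    case (Suc N)
    have "R (Suc N) \<omega> * R (Suc N) \<omega>
        = R N \<omega> * R N \<omega> - 2 * (c N / Q) * (R N \<omega> * u N \<omega>) + (c N / Q)\<^sup>2 * (u N \<omega> * u N \<omega>)" for \<omega>
      by (simp add: R_def power2_eq_square algebra_simps)
    then have "(LINT \<omega>|P. R (Suc N) \<omega> * R (Suc N) \<omega>)
        = (LINT \<omega>|P. R N \<omega> * R N \<omega>) - 2 * (c N / Q) * c N + (c N / Q)\<^sup>2 * (LINT \<omega>|P. u N \<omega> * u N \<omega>)"
      using iRR[of N] iRu[of N N] iuu[of N N] by (simp add: Ru)
    also have "\<dots> \<le> (LINT \<omega>|P. R N \<omega> * R N \<omega>) - 2 * (c N / Q) * c N + (c N / Q)\<^sup>2 * Q"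
      using uu by (intro add_mono mult_left_mono) auto
    also have "\<dots> = (LINT \<omega>|P. R N \<omega> * R N \<omega>) - (c N)\<^sup>2 / Q"
      using Q by (simp add: power2_eq_square field_simps)
    finally show ?case using Suc by simp
  qed
  moreover have "0 \<le> (LINT \<omega>|P. R N \<omega> * R N \<omega>)" for N
    by (intro integral_nonneg_AE AE_I2) simp
  ultimately have "(\<Sum>n<N. (c n)\<^sup>2 / Q) \<le> measure P A" for N
    by (meson le_add_same_cancel2 order_trans)
  then have "summable (\<lambda>n. (c n)\<^sup>2 / Q)"
    using Q by (intro summableI_nonneg_bounded[of _ "measure P A"]) auto
  then have "(\<lambda>n. (c n)\<^sup>2 / Q) \<longlonglongrightarrow> 0" by (rule summable_LIMSEQ_zero)
  then have "(\<lambda>n. sqrt ((c n)\<^sup>2 / Q * Q)) \<longlonglongrightarrow> sqrt (0 * Q)" by (intro tendsto_intros)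
  then have "(\<lambda>n. \<bar>c n\<bar>) \<longlonglongrightarrow> 0" using Q by simp
  then show ?thesis unfolding c_def by (rule tendsto_rabs_zero_cancel)
qed

lemma completion_code_facts:
  assumes "prob_space M" "S \<in> sets M" "\<And>i. D i \<in> sets M"
  shows "finite_measure (completion M)" "S \<in> sets (completion M)" "\<And>i. D i \<in> sets (completion M)"
    "\<And>l. measure (completion M) (cell S D l) = measure M (cell S D l)"
proof -
  show "finite_measure (completion M)"
    using prob_space.prob_space_completion[OF assms(1)] by (rule prob_space.finite_measure)
  show "S \<in> sets (completion M)" "\<And>i. D i \<in> sets (completion M)"
    using assms(2,3) by (auto intro: sets_completionI_sets)
  show "\<And>l. measure (completion M) (cell S D l) = measure M (cell S D l)"
    using sets_cell[OF assms(2,3)] by (rule measure_completion)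
qed

text \<open>
  The earlier function is constant on the cells of level \<open>n k\<close>, while the later one has mean 0 on each of
  them.
\<close>

lemma martingale_difference_orthogonal:
  fixes Y :: "nat \<Rightarrow> bool list \<Rightarrow> 'x::real_normed_vector" and z :: "'x \<Rightarrow>\<^sub>L real"
  assumes P: "finite_measure P" "S \<in> sets P" "\<And>i. D i \<in> sets P"
    and n: "\<And>k. n (Suc k) = n k + d k"
    and mean: "\<And>k a. a \<in> words (n k) \<Longrightarrow> (\<Sum>u\<in>words (d k). measure P (cell S D (u @ a)) *\<^sub>R Y k (u @ a)) = 0"
    and "j < k"
  shows "(LINT \<omega>|P. (indicator S \<omega> * z (Y j (code D (n (Suc j)) \<omega>))) * (indicator S \<omega> * z (Y k (code D (n (Suc k)) \<omega>)))) = 0"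
proof -
  have "n i \<le> n (Suc i)" for i using n[of i] by simp
  then have "mono n" by (simp add: mono_iff_le_Suc)
  then have le: "n (Suc j) \<le> n k" using \<open>j < k\<close> by (intro monoD[OF \<open>mono n\<close>]) simp
  define r where "r = n k - n (Suc j)"
  have nk: "n k = n (Suc j) + r" using le by (simp add: r_def)
  define G where "G l = z (Y j (drop (d k + r) l)) * z (Y k l)" for l
  have eq: "code D (n (Suc j)) \<omega> = drop (d k + r) (code D (n (Suc k)) \<omega>)" for \<omega>
  proof -
    have "n (Suc k) = n (Suc j) + (d k + r)" unfolding n[of k] nk by simp
    then show ?thesis using drop_code[of "d k + r" D "n (Suc j)" \<omega>] by simp
  qed
  have "(indicator S \<omega> * z (Y j (code D (n (Suc j)) \<omega>))) * (indicator S \<omega> * z (Y k (code D (n (Suc k)) \<omega>)))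
      = indicator S \<omega> * G (code D (n (Suc k)) \<omega>)" for \<omega>
    unfolding eq G_def by (simp add: indicator_def)
  then have "(LINT \<omega>|P. (indicator S \<omega> * z (Y j (code D (n (Suc j)) \<omega>))) * (indicator S \<omega> * z (Y k (code D (n (Suc k)) \<omega>))))
      = (\<Sum>l\<in>words (n k + d k). measure P (cell S D l) * G l)"
    using integral_code(2)[OF P, where F=G and n="n k + d k"] by (simp only: n[of k])
  also have "\<dots> = (\<Sum>a\<in>words (n k). \<Sum>u\<in>words (d k).
      z (Y j (drop r a)) * z (measure P (cell S D (u @ a)) *\<^sub>R Y k (u @ a)))"
    unfolding sum_words_add
    by (intro sum.cong refl) (auto simp: G_def words_def blinfun.scaleR_right)
  also have "\<dots> = (\<Sum>a\<in>words (n k). z (Y j (drop r a)) *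
      z (\<Sum>u\<in>words (d k). measure P (cell S D (u @ a)) *\<^sub>R Y k (u @ a)))"
    by (simp add: sum_distrib_left blinfun.sum_right)
  also have "\<dots> = 0" using mean by simp
  finally show ?thesis .
qed

text \<open>
  Orthogonality settles the functions \<open>z \<chi>\<^sub>A\<close> with \<open>z \<in> X\<^sup>*\<close>, linearity the simple functions, and \<open>L\<^sub>1\<close>
  approximation all strongly measurable \<open>g\<close> with integrable norm. The set \<open>A\<close> is arbitrary, so the
  \<open>\<sigma>\<close>-algebra generated by the partitions never enters.
\<close>

lemma martingale_difference_null:
  fixes Y :: "nat \<Rightarrow> bool list \<Rightarrow> 'x::real_normed_vector" and g :: "'a \<Rightarrow> 'x \<Rightarrow>\<^sub>L real"
  assumes M: "prob_space M" "S \<in> sets M" "\<And>i. D i \<in> sets M"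
    and n: "\<And>k. n (Suc k) = n k + d k"
    and mean: "\<And>k a. a \<in> words (n k) \<Longrightarrow> (\<Sum>u\<in>words (d k). measure M (cell S D (u @ a)) *\<^sub>R Y k (u @ a)) = 0"
    and bnd: "\<And>k l. norm (Y k l) \<le> B"
    and g: "strongly_measurable M g" "integrable (completion M) (\<lambda>\<omega>. norm (g \<omega>))"
  shows "(\<lambda>k. LINT \<omega>|completion M. g \<omega> (indicator S \<omega> *\<^sub>R Y k (code D (n (Suc k)) \<omega>))) \<longlonglongrightarrow> 0"
proof -
  define P where "P = completion M"
  have P: "finite_measure P" "S \<in> sets P" "\<And>i. D i \<in> sets P"
    and mP: "\<And>l. measure P (cell S D l) = measure M (cell S D l)"
    unfolding P_def using completion_code_facts[OF M] by auto
  interpret finite_measure P by fact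
  have B: "0 \<le> B" using norm_ge_zero[of "Y 0 []"] bnd[of 0 "[]"] by linarith
  define f where "f k \<omega> = indicator S \<omega> *\<^sub>R Y k (code D (n (Suc k)) \<omega>)" for k \<omega>
  have fb: "norm (f k \<omega>) \<le> B" for k \<omega> using bnd B by (simp add: f_def indicator_def)
  have zf: "z (f k \<omega>) = indicator S \<omega> * z (Y k (code D (n (Suc k)) \<omega>))" for z :: "'x \<Rightarrow>\<^sub>L real" and k \<omega>
    by (simp add: f_def blinfun.scaleR_right)
  have zf_int: "integrable P (\<lambda>\<omega>. z (f k \<omega>))" for z :: "'x \<Rightarrow>\<^sub>L real" and k
    unfolding zf using integral_code(1)[OF P, of "\<lambda>l. z (Y k l)"] by simp
  have zb: "\<bar>z (f k \<omega>)\<bar> \<le> norm z * B" for z :: "'x \<Rightarrow>\<^sub>L real" and k \<omega>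
    using norm_blinfun[of z "f k \<omega>"] mult_left_mono[OF fb[of k \<omega>] norm_ge_zero[of z]] by simp
  have set_null: "(\<lambda>k. LINT \<omega>|P. indicator A \<omega> * z (f k \<omega>)) \<longlonglongrightarrow> 0" if "A \<in> sets P" for A and z :: "'x \<Rightarrow>\<^sub>L real"
  proof (rule bounded_orthogonal_weakly_null[OF P(1) _ zb _ that])
    show "(\<lambda>\<omega>. z (f k \<omega>)) \<in> borel_measurable P" for k using zf_int by simp
    show "(LINT \<omega>|P. z (f j \<omega>) * z (f k \<omega>)) = 0" if "j < k" for j k
      unfolding zf
    proof (rule martingale_difference_orthogonal[OF P, where n=n and d=d])
      show "n (Suc k) = n k + d k" for k by (rule n)
      show "(\<Sum>u\<in>words (d k). measure P (cell S D (u @ a)) *\<^sub>R Y k (u @ a)) = 0" if "a \<in> words (n k)" for k a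
        unfolding mP by (rule mean) (rule that)
    qed (rule that)
  qed
  have simple_null: "(\<lambda>k. LINT \<omega>|P. s \<omega> (f k \<omega>)) \<longlonglongrightarrow> 0"
    and simple_int: "\<And>k. integrable P (\<lambda>\<omega>. s \<omega> (f k \<omega>))"
    if s: "simple_function P s" for s :: "'a \<Rightarrow> 'x \<Rightarrow>\<^sub>L real"
  proof -
    define A where "A z = s -` {z} \<inter> space P" for z
    have fin: "finite (s ` space P)" by (rule simple_functionD(1)[OF s])
    have A: "A z \<in> sets P" for z unfolding A_def by (rule simple_functionD(2)[OF s])
    have eq: "s \<omega> (f k \<omega>) = (\<Sum>z\<in>s ` space P. indicator (A z) \<omega> * z (f k \<omega>))" if "\<omega> \<in> space P" for k \<omega>
    proof -
      have "(\<Sum>z\<in>s ` space P. indicator (A z) \<omega> * z (f k \<omega>)) = (\<Sum>z\<in>s ` space P. if z = s \<omega> then z (f k \<omega>) else 0)"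
        using that by (intro sum.cong) (auto simp: A_def indicator_def)
      also have "\<dots> = s \<omega> (f k \<omega>)" using fin that by (simp add: sum.delta)
      finally show ?thesis by simp
    qed
    have i: "integrable P (\<lambda>\<omega>. indicator (A z) \<omega> * z (f k \<omega>))" for z k
      using integrable_mult_indicator[OF A zf_int] by simp
    have "(\<lambda>k. LINT \<omega>|P. s \<omega> (f k \<omega>)) = (\<lambda>k. \<Sum>z\<in>s ` space P. LINT \<omega>|P. indicator (A z) \<omega> * z (f k \<omega>))"
      using i by (simp add: eq Bochner_Integration.integral_sum cong: Bochner_Integration.integral_cong)
    also have "\<dots> \<longlonglongrightarrow> (\<Sum>z\<in>s ` space P. 0)"
      using A by (intro tendsto_sum set_null)
    finally show "(\<lambda>k. LINT \<omega>|P. s \<omega> (f k \<omega>)) \<longlonglongrightarrow> 0" by simp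
    show "integrable P (\<lambda>\<omega>. s \<omega> (f k \<omega>))" for k
      using i by (simp add: eq cong: Bochner_Integration.integrable_cong)
  qed
  have gf_meas: "(\<lambda>\<omega>. g \<omega> (f k \<omega>)) \<in> borel_measurable P" for k
  proof -
    have gz: "(\<lambda>\<omega>. g \<omega> x) \<in> borel_measurable P" for x
      unfolding P_def by (intro strongly_measurable_continuous_compose[OF g(1)] continuous_intros)
    have "g \<omega> (f k \<omega>) = (\<Sum>l\<in>words (n (Suc k)). indicator (cell S D l) \<omega> * g \<omega> (Y k l))" for \<omega>
    proof (cases "\<omega> \<in> S")
      case True
      then show ?thesis using code_sum_indicator[of \<omega> S "\<lambda>l. g \<omega> (Y k l)" D "n (Suc k)"]
        by (simp add: f_def)
    next
      case False
      then have "\<omega> \<notin> cell S D l" for l by (auto simp: cell_def)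
      with False show ?thesis by (simp add: f_def)
    qed
    moreover have "(\<lambda>\<omega>. \<Sum>l\<in>words (n (Suc k)). indicator (cell S D l) \<omega> * g \<omega> (Y k l)) \<in> borel_measurable P"
      using gz sets_cell[OF P(2,3)]
      by (intro borel_measurable_sum borel_measurable_times borel_measurable_indicator) auto
    ultimately show ?thesis by simp
  qed
  have gf_int: "integrable P (\<lambda>\<omega>. g \<omega> (f k \<omega>))" for k
  proof (rule Bochner_Integration.integrable_bound)
    show "integrable P (\<lambda>\<omega>. norm (g \<omega>) * B)" using g(2) by (simp add: P_def)
    show "AE \<omega> in P. norm (g \<omega> (f k \<omega>)) \<le> norm (norm (g \<omega>) * B)"
      using zb B by (intro AE_I2) (simp add: abs_mult)
  qed (rule gf_meas)
  have "(\<lambda>k. LINT \<omega>|P. g \<omega> (f k \<omega>)) \<longlonglongrightarrow> 0"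
  proof (rule LIMSEQ_I)
    fix e :: real
    assume "0 < e"
    then have "0 < e / (2 * (B + 1))" using B by simp
    then obtain s where s: "simple_function P s" "integrable P (\<lambda>\<omega>. norm (g \<omega> - s \<omega>))"
        "(LINT \<omega>|P. norm (g \<omega> - s \<omega>)) < e / (2 * (B + 1))"
      using strongly_measurable_L1_approx[OF g] unfolding P_def by blast
    have "eventually (\<lambda>k. \<bar>LINT \<omega>|P. s \<omega> (f k \<omega>)\<bar> < e / 2) sequentially"
      using \<open>0 < e\<close> tendsto_rabs[OF simple_null[OF s(1)]] by (intro order_tendstoD(2)) auto
    then obtain k0 where k0: "\<And>k. k \<ge> k0 \<Longrightarrow> \<bar>LINT \<omega>|P. s \<omega> (f k \<omega>)\<bar> < e / 2"
      by (auto simp: eventually_sequentially)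
    have "norm ((LINT \<omega>|P. g \<omega> (f k \<omega>)) - 0) < e" if "k \<ge> k0" for k
    proof -
      have "\<bar>(LINT \<omega>|P. g \<omega> (f k \<omega>)) - (LINT \<omega>|P. s \<omega> (f k \<omega>))\<bar>
          = \<bar>LINT \<omega>|P. (g \<omega> - s \<omega>) (f k \<omega>)\<bar>"
        using gf_int simple_int[OF s(1)] by (simp add: blinfun.diff_left)
      also have "\<dots> \<le> (LINT \<omega>|P. \<bar>(g \<omega> - s \<omega>) (f k \<omega>)\<bar>)"
        using integral_norm_bound[of P "\<lambda>\<omega>. (g \<omega> - s \<omega>) (f k \<omega>)"] by simp
      also have "\<dots> \<le> (LINT \<omega>|P. norm (g \<omega> - s \<omega>) * B)"
      proof (rule integral_mono)
        show "integrable P (\<lambda>\<omega>. \<bar>(g \<omega> - s \<omega>) (f k \<omega>)\<bar>)"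
          unfolding blinfun.diff_left by (intro integrable_abs Bochner_Integration.integrable_diff gf_int simple_int[OF s(1)])
        show "integrable P (\<lambda>\<omega>. norm (g \<omega> - s \<omega>) * B)" using s(2) by simp
      qed (rule zb)
      also have "\<dots> = (LINT \<omega>|P. norm (g \<omega> - s \<omega>)) * B" by simp
      also have "\<dots> \<le> e / (2 * (B + 1)) * B" using s(3) B by (intro mult_right_mono) auto
      also have "\<dots> \<le> e / 2" using \<open>0 < e\<close> B by (simp add: field_simps)
      finally show ?thesis using k0[OF that] unfolding real_norm_def diff_zero by linarith
    qed
    then show "\<exists>k0. \<forall>k\<ge>k0. norm ((LINT \<omega>|P. g \<omega> (f k \<omega>)) - 0) < e" by (intro exI allI impI)
  qed
  then show ?thesis unfolding f_def P_def .
qed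

section \<open>Koethe function spaces\<close>

text \<open>
  Banach-Alaoglu for functionals on a set of functions: the maps bounded by \<open>C p\<close> form a product of
  compact intervals, and a cluster point of the sequence inherits linearity and eventual lower bounds.
\<close>

lemma in_dual_cluster_point:
  fixes \<phi> :: "nat \<Rightarrow> ('a \<Rightarrow> 'z::real_normed_vector) \<Rightarrow> real"
  assumes V: "\<And>f g. f \<in> V \<Longrightarrow> g \<in> V \<Longrightarrow> (\<lambda>\<omega>. f \<omega> + g \<omega>) \<in> V" "\<And>c f. f \<in> V \<Longrightarrow> (\<lambda>\<omega>. c *\<^sub>R f \<omega>) \<in> V"
    and add: "\<And>j f g. f \<in> V \<Longrightarrow> g \<in> V \<Longrightarrow> \<phi> j (\<lambda>\<omega>. f \<omega> + g \<omega>) = \<phi> j f + \<phi> j g"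
    and scale: "\<And>j c f. f \<in> V \<Longrightarrow> \<phi> j (\<lambda>\<omega>. c *\<^sub>R f \<omega>) = c * \<phi> j f"
    and bnd: "\<And>j f. f \<in> V \<Longrightarrow> \<bar>\<phi> j f\<bar> \<le> C * p f"
  shows "\<exists>\<psi>. in_dual V p \<psi> \<and> (\<forall>f\<in>V. \<forall>c. eventually (\<lambda>j. c \<le> \<phi> j f) sequentially \<longrightarrow> c \<le> \<psi> f)"
proof -
  define b where "b f = (if f \<in> V then C * p f else 0)" for f
  define \<theta> where "\<theta> j f = (if f \<in> V then \<phi> j f else 0)" for j f
  define K where "K = PiE UNIV (\<lambda>f. {- b f .. b f})"
  have "compactin (product_topology (\<lambda>_. euclidean) UNIV) K"
    unfolding K_def compactin_PiE by simp
  then have "compact K" by (simp add: euclidean_product_topology)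
  moreover have "filtermap \<theta> sequentially \<noteq> bot" by (simp add: filtermap_bot_iff)
  moreover have "\<theta> j \<in> K" for j
    using bnd[of _ j] by (auto simp: K_def b_def \<theta>_def abs_le_iff minus_le_iff)
  then have "eventually (\<lambda>x. x \<in> K) (filtermap \<theta> sequentially)" by (simp add: eventually_filtermap)
  ultimately obtain \<psi> where \<psi>: "\<psi> \<in> K" "inf (nhds \<psi>) (filtermap \<theta> sequentially) \<noteq> bot"
    unfolding compact_filter by blast
  \<comment> \<open>A filter on the set of functionals, finer than both the neighbourhoods of \<open>\<psi>\<close> and the tails of
    the sequence; along it all evaluations converge.\<close>
  define G where "G = inf (nhds \<psi>) (filtermap \<theta> sequentially)"
  have G: "G \<noteq> bot" using \<psi>(2) by (simp add: G_def)
  have lim: "((\<lambda>x. x f) \<longlongrightarrow> \<psi> f) G" for f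
  proof (rule topological_tendstoI)
    fix T :: "real set"
    assume T: "open T" "\<psi> f \<in> T"
    have "open ((\<lambda>x. x f) -` T)"
      by (rule open_vimage[OF T(1)]) simp
    then have "eventually (\<lambda>x. x \<in> (\<lambda>x. x f) -` T) (nhds \<psi>)" using T(2) by (intro eventually_nhds_in_open) auto
    then show "eventually (\<lambda>x. x f \<in> T) G"
      unfolding G_def by (intro filter_leD[OF inf_le1]) simp
  qed
  have ev: "eventually Q G" if "eventually (\<lambda>j. Q (\<theta> j)) sequentially" for Q
    unfolding G_def using that by (intro filter_leD[OF inf_le2]) (simp add: eventually_filtermap)
  have "in_dual V p \<psi>"
    unfolding in_dual_def
  proof (intro conjI ballI allI)
    fix f g
    assume fg: "f \<in> V" "g \<in> V"
    have "((\<lambda>x. x f + x g) \<longlongrightarrow> \<psi> f + \<psi> g) G" by (intro tendsto_add lim)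
    moreover have "eventually (\<lambda>x. x f + x g = x (\<lambda>\<omega>. f \<omega> + g \<omega>)) G"
      using fg V by (intro ev) (simp add: \<theta>_def add)
    ultimately have "((\<lambda>x. x (\<lambda>\<omega>. f \<omega> + g \<omega>)) \<longlongrightarrow> \<psi> f + \<psi> g) G" by (rule Lim_transform_eventually)
    then show "\<psi> (\<lambda>\<omega>. f \<omega> + g \<omega>) = \<psi> f + \<psi> g" by (rule tendsto_unique[OF G lim])
  next
    fix c f
    assume f: "f \<in> V"
    have "((\<lambda>x. c * x f) \<longlongrightarrow> c * \<psi> f) G" by (intro tendsto_mult_left lim)
    moreover have "eventually (\<lambda>x. c * x f = x (\<lambda>\<omega>. c *\<^sub>R f \<omega>)) G"
      using f V by (intro ev) (simp add: \<theta>_def scale)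
    ultimately have "((\<lambda>x. x (\<lambda>\<omega>. c *\<^sub>R f \<omega>)) \<longlongrightarrow> c * \<psi> f) G" by (rule Lim_transform_eventually)
    then show "\<psi> (\<lambda>\<omega>. c *\<^sub>R f \<omega>) = c * \<psi> f" by (rule tendsto_unique[OF G lim])
  next
    have "\<bar>\<psi> f\<bar> \<le> C * p f" if "f \<in> V" for f
    proof -
      have "\<psi> f \<in> {- b f .. b f}" using \<psi>(1) unfolding K_def by (rule PiE_mem) simp
      then show ?thesis using that by (auto simp: b_def)
    qed
    then show "\<exists>C. \<forall>f\<in>V. \<bar>\<psi> f\<bar> \<le> C * p f" by blast
  qed
  moreover have "c \<le> \<psi> f" if "f \<in> V" "eventually (\<lambda>j. c \<le> \<phi> j f) sequentially" for c f
  proof (rule tendsto_lowerbound[OF lim _ G])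
    show "eventually (\<lambda>x. c \<le> x f) G" using that by (intro ev) (simp add: \<theta>_def)
  qed
  ultimately show ?thesis by blast
qed

locale koethe = prob_space M for M :: "'a measure" +
  fixes E :: "('a \<Rightarrow> real) set" and nrm :: "('a \<Rightarrow> real) \<Rightarrow> real"
  assumes koethe: "koethe_space M E nrm"
begin

abbreviation "P \<equiv> completion M"

lemmas koethe_conj = koethe[unfolded koethe_space_def]

lemma E_integrable: "f \<in> E \<Longrightarrow> integrable P f"
  by (rule koethe_conj[THEN conjunct1, rule_format])

lemma E_add: "f \<in> E \<Longrightarrow> g \<in> E \<Longrightarrow> (\<lambda>\<omega>. f \<omega> + g \<omega>) \<in> E"
  by (rule koethe_conj[THEN conjunct2, THEN conjunct1, rule_format])

lemma E_scale: "f \<in> E \<Longrightarrow> (\<lambda>\<omega>. c * f \<omega>) \<in> E"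
  by (rule koethe_conj[THEN conjunct2, THEN conjunct2, THEN conjunct1, rule_format])

lemma nrm_add: "f \<in> E \<Longrightarrow> g \<in> E \<Longrightarrow> nrm (\<lambda>\<omega>. f \<omega> + g \<omega>) \<le> nrm f + nrm g"
  by (rule koethe_conj[THEN conjunct2, THEN conjunct2, THEN conjunct2, THEN conjunct1, rule_format])

lemma nrm_scale: "f \<in> E \<Longrightarrow> nrm (\<lambda>\<omega>. c * f \<omega>) = \<bar>c\<bar> * nrm f"
  by (rule koethe_conj[THEN conjunct2, THEN conjunct2, THEN conjunct2, THEN conjunct2, THEN conjunct1, rule_format])

lemma nrm_eq_0: "f \<in> E \<Longrightarrow> nrm f = 0 \<longleftrightarrow> (AE \<omega> in M. f \<omega> = 0)"
  by (rule koethe_conj[THEN conjunct2, THEN conjunct2, THEN conjunct2, THEN conjunct2, THEN conjunct2, THEN conjunct1, rule_format])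

lemma E_complete:
  assumes "\<And>n. u n \<in> E" "\<And>e. 0 < e \<Longrightarrow> \<exists>k. \<forall>m\<ge>k. \<forall>n\<ge>k. nrm (\<lambda>\<omega>. u m \<omega> - u n \<omega>) < e"
  shows "\<exists>f\<in>E. (\<lambda>n. nrm (\<lambda>\<omega>. u n \<omega> - f \<omega>)) \<longlonglongrightarrow> 0"
  by (rule koethe_conj[THEN conjunct2, THEN conjunct2, THEN conjunct2, THEN conjunct2, THEN conjunct2, THEN conjunct2, THEN conjunct1, THEN spec, THEN mp, THEN mp])
     (use assms in \<open>intro allI impI, auto\<close>)

lemma indicator_E: "A \<in> sets M \<Longrightarrow> indicator A \<in> E"
  by (rule koethe_conj[THEN conjunct2, THEN conjunct2, THEN conjunct2, THEN conjunct2, THEN conjunct2, THEN conjunct2, THEN conjunct2, THEN conjunct1, rule_format])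

lemma E_ideal:
  assumes "f \<in> borel_measurable P" "g \<in> E" "\<And>\<omega>. \<omega> \<in> space M \<Longrightarrow> \<bar>f \<omega>\<bar> \<le> \<bar>g \<omega>\<bar>"
  shows "f \<in> E" "nrm f \<le> nrm g"
proof -
  have "AE \<omega> in M. \<bar>f \<omega>\<bar> \<le> \<bar>g \<omega>\<bar>" using assms(3) by (rule AE_I2)
  then have "f \<in> E \<and> nrm f \<le> nrm g"
    by (rule koethe_conj[THEN conjunct2, THEN conjunct2, THEN conjunct2, THEN conjunct2, THEN conjunct2, THEN conjunct2, THEN conjunct2, THEN conjunct2, rule_format, OF assms(1,2)])
  then show "f \<in> E" "nrm f \<le> nrm g" by auto
qed

lemma E_diff: "f \<in> E \<Longrightarrow> g \<in> E \<Longrightarrow> (\<lambda>\<omega>. f \<omega> - g \<omega>) \<in> E"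
  using E_add[of f "\<lambda>\<omega>. - 1 * g \<omega>"] E_scale[of g "-1"] by simp

lemma nrm_minus: "f \<in> E \<Longrightarrow> nrm (\<lambda>\<omega>. - f \<omega>) = nrm f"
  using nrm_scale[of f "-1"] by simp

lemma nrm_nonneg: "f \<in> E \<Longrightarrow> 0 \<le> nrm f"
proof -
  assume f: "f \<in> E"
  have "nrm (\<lambda>\<omega>. f \<omega> + - f \<omega>) \<le> nrm f + nrm (\<lambda>\<omega>. - f \<omega>)"
    using f E_scale[OF f, of "-1"] by (intro nrm_add) auto
  moreover have "nrm (\<lambda>\<omega>. 0) = 0" using nrm_scale[OF f, of 0] by simp
  ultimately show ?thesis using nrm_minus[OF f] by simp
qed

lemma E_abs:
  assumes "f \<in> E"
  shows "(\<lambda>\<omega>. \<bar>f \<omega>\<bar>) \<in> E" "nrm (\<lambda>\<omega>. \<bar>f \<omega>\<bar>) \<le> nrm f"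
proof -
  have "(\<lambda>\<omega>. \<bar>f \<omega>\<bar>) \<in> borel_measurable P" using E_integrable[OF assms] by measurable
  from E_ideal[OF this assms] show "(\<lambda>\<omega>. \<bar>f \<omega>\<bar>) \<in> E" "nrm (\<lambda>\<omega>. \<bar>f \<omega>\<bar>) \<le> nrm f" by auto
qed

text \<open>
  The partial sums are increasing, so their positive excess over the limit in norm is dominated by the
  distance of every later partial sum to the limit, which tends to 0.
\<close>

lemma increasing_series_bounded_by_sum:
  assumes g: "\<And>n. g n \<in> E" "\<And>n \<omega>. 0 \<le> g n \<omega>" "\<And>n. nrm (g n) \<le> 1 / 2 ^ n"
  shows "\<exists>f\<in>E. \<forall>n. AE \<omega> in M. g n \<omega> \<le> f \<omega>"
proof -
  define u where "u n \<omega> = (\<Sum>k<n. g k \<omega>)" for n \<omega>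
  have u: "u n \<in> E" for n
  proof (induction n)
    case 0
    show ?case using E_scale[OF g(1)[of 0], of 0] by (simp add: u_def)
  next
    case (Suc n)
    have "u (Suc n) = (\<lambda>\<omega>. u n \<omega> + g n \<omega>)" by (simp add: u_def fun_eq_iff)
    then show ?case using E_add[OF Suc g(1)[of n]] by simp
  qed
  have tail: "nrm (\<lambda>\<omega>. u (k + d) \<omega> - u k \<omega>) \<le> 2 / 2 ^ k - 2 / 2 ^ (k + d)" for k d
  proof (induction d)
    case 0
    have "nrm (\<lambda>\<omega>. 0 * u 0 \<omega>) = 0" using nrm_scale[OF u[of 0], of 0] by simp
    then show ?case by simp
  next
    case (Suc d)
    have "nrm (\<lambda>\<omega>. u (k + Suc d) \<omega> - u k \<omega>) = nrm (\<lambda>\<omega>. (u (k + d) \<omega> - u k \<omega>) + g (k + d) \<omega>)"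
      by (simp add: u_def algebra_simps)
    also have "\<dots> \<le> nrm (\<lambda>\<omega>. u (k + d) \<omega> - u k \<omega>) + nrm (g (k + d))"
      by (intro nrm_add E_diff u g)
    also have "\<dots> \<le> (2 / 2 ^ k - 2 / 2 ^ (k + d)) + 1 / 2 ^ (k + d)"
      by (intro add_mono Suc g)
    also have "\<dots> = 2 / 2 ^ k - 2 / 2 ^ (k + Suc d)" by (simp add: field_simps)
    finally show ?case .
  qed
  have tail': "nrm (\<lambda>\<omega>. u m \<omega> - u k \<omega>) \<le> 2 / 2 ^ k" if "k \<le> m" for k m
    using tail[of k "m - k"] that by (simp add: order_trans[OF _ less_imp_le])
  have "\<exists>f\<in>E. (\<lambda>n. nrm (\<lambda>\<omega>. u n \<omega> - f \<omega>)) \<longlonglongrightarrow> 0"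
  proof (rule E_complete)
    fix e :: real
    assume e: "0 < e"
    have "(\<lambda>k. 4 * (1 / 2) ^ k :: real) \<longlonglongrightarrow> 4 * 0" by (intro tendsto_mult_left LIMSEQ_realpow_zero) auto
    then have "eventually (\<lambda>k. 4 * (1 / 2) ^ k < e) sequentially" using e by (intro order_tendstoD(2)) auto
    then obtain k where "4 * (1 / 2) ^ k < e" using eventually_happens'[OF sequentially_bot] by blast
    then have k: "2 / 2 ^ k + 2 / 2 ^ k < e" by (simp add: power_one_over)
    have "nrm (\<lambda>\<omega>. u m \<omega> - u n \<omega>) < e" if "k \<le> m" "k \<le> n" for m n
    proof -
      have "nrm (\<lambda>\<omega>. u m \<omega> - u n \<omega>) = nrm (\<lambda>\<omega>. (u m \<omega> - u k \<omega>) + - (u n \<omega> - u k \<omega>))" by simp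
      also have "\<dots> \<le> nrm (\<lambda>\<omega>. u m \<omega> - u k \<omega>) + nrm (\<lambda>\<omega>. - (u n \<omega> - u k \<omega>))"
        using E_scale[OF E_diff[OF u u], of "-1" n k] by (intro nrm_add E_diff u) simp
      also have "\<dots> = nrm (\<lambda>\<omega>. u m \<omega> - u k \<omega>) + nrm (\<lambda>\<omega>. u n \<omega> - u k \<omega>)"
        using nrm_minus[OF E_diff[OF u u], of n k] by simp
      also have "\<dots> \<le> 2 / 2 ^ k + 2 / 2 ^ k" by (intro add_mono tail' that)
      finally show ?thesis using k by simp
    qed
    then show "\<exists>k. \<forall>m\<ge>k. \<forall>n\<ge>k. nrm (\<lambda>\<omega>. u m \<omega> - u n \<omega>) < e" by blast
  qed (rule u)
  then obtain f where f: "f \<in> E" "(\<lambda>n. nrm (\<lambda>\<omega>. u n \<omega> - f \<omega>)) \<longlonglongrightarrow> 0" by blast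
  have le: "AE \<omega> in M. u n \<omega> \<le> f \<omega>" for n
  proof -
    define h where "h \<omega> = max 0 (u n \<omega> - f \<omega>)" for \<omega>
    have hm: "h \<in> borel_measurable P"
      unfolding h_def using E_integrable[OF u[of n]] E_integrable[OF f(1)] by measurable
    have "\<bar>h \<omega>\<bar> \<le> \<bar>u m \<omega> - f \<omega>\<bar>" if "n \<le> m" for m \<omega>
    proof -
      have "u n \<omega> \<le> u m \<omega>" unfolding u_def using that g(2) by (intro sum_mono2) auto
      then show ?thesis by (auto simp: h_def max_def abs_if)
    qed
    then have "nrm h \<le> nrm (\<lambda>\<omega>. u m \<omega> - f \<omega>)" and hE: "h \<in> E" if "n \<le> m" for m
      using E_ideal[OF hm E_diff[OF u[of m] f(1)]] that by blast+
    then have "nrm h \<le> 0" "h \<in> E" by (auto intro!: LIMSEQ_le_const[OF f(2)])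
    then have "AE \<omega> in M. h \<omega> = 0" using nrm_nonneg[of h] nrm_eq_0[of h] by simp
    then show ?thesis by eventually_elim (auto simp: h_def max_def split: if_splits)
  qed
  have "AE \<omega> in M. g n \<omega> \<le> f \<omega>" for n
    using le[of "Suc n"]
  proof eventually_elim
    case (elim \<omega>)
    have "g n \<omega> \<le> u (Suc n) \<omega>" using g(2) by (auto simp: u_def intro!: sum_nonneg)
    with elim show ?case by simp
  qed
  with f(1) show ?thesis by blast
qed

text \<open>
  The inclusion of \<open>E\<close> into \<open>L\<^sub>1\<close> is bounded. Otherwise, functions of \<open>L\<^sub>1\<close> norm at least \<open>2\<^sup>n\<close> and of
  \<open>E\<close> norm at most \<open>2\<^sup>-\<^sup>n\<close> would all lie almost everywhere below one element of \<open>E\<close>,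
  which is integrable.
\<close>

lemma L1_bound:
  obtains C where "0 \<le> C" "\<And>f. f \<in> E \<Longrightarrow> (LINT \<omega>|P. \<bar>f \<omega>\<bar>) \<le> C * nrm f"
proof -
  have "\<exists>C\<ge>0. \<forall>f\<in>E. (LINT \<omega>|P. \<bar>f \<omega>\<bar>) \<le> C * nrm f"
  proof (rule ccontr)
    assume no: "\<not> ?thesis"
    have "\<exists>f\<in>E. (LINT \<omega>|P. \<bar>f \<omega>\<bar>) > 4 ^ n * nrm f" for n :: nat
    proof (rule ccontr)
      assume "\<not> ?thesis"
      then have "\<forall>f\<in>E. (LINT \<omega>|P. \<bar>f \<omega>\<bar>) \<le> 4 ^ n * nrm f" by (simp add: not_less)
      moreover have "(0::real) \<le> 4 ^ n" by simp
      ultimately show False using no by blast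
    qed
    then obtain f where f: "\<And>n. f n \<in> E" "\<And>n :: nat. (LINT \<omega>|P. \<bar>f n \<omega>\<bar>) > 4 ^ n * nrm (f n)" by metis
    have pos: "nrm (f n) > 0" for n
    proof (rule ccontr)
      assume "\<not> nrm (f n) > 0"
      with nrm_nonneg[OF f(1)[of n]] have z: "nrm (f n) = 0" by simp
      then have "AE \<omega> in P. f n \<omega> = 0" using nrm_eq_0[OF f(1)[of n]] by (auto intro: AE_completion)
      then have "(LINT \<omega>|P. \<bar>f n \<omega>\<bar>) = (LINT \<omega>|P. 0)"
        using E_integrable[OF f(1)[of n]] by (intro integral_cong_AE) auto
      with f(2)[of n] z show False by simp
    qed
    define c where "c n = 1 / (2 ^ n * nrm (f n))" for n
    have c: "c n > 0" for n using pos by (simp add: c_def)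
    define g where "g n \<omega> = c n * \<bar>f n \<omega>\<bar>" for n \<omega>
    have "\<exists>h\<in>E. \<forall>n. AE \<omega> in M. g n \<omega> \<le> h \<omega>"
    proof (rule increasing_series_bounded_by_sum)
      show "g n \<in> E" for n unfolding g_def by (intro E_scale E_abs f)
      show "0 \<le> g n \<omega>" for n \<omega> using c[of n] by (simp add: g_def)
      show "nrm (g n) \<le> 1 / 2 ^ n" for n
      proof -
        have "nrm (g n) = c n * nrm (\<lambda>\<omega>. \<bar>f n \<omega>\<bar>)"
          unfolding g_def using c[of n] by (simp add: nrm_scale E_abs f)
        also have "\<dots> \<le> c n * nrm (f n)" using c[of n] by (intro mult_left_mono E_abs f) auto
        finally show ?thesis using pos[of n] by (simp add: c_def)
      qed
    qed
    then obtain h where h: "h \<in> E" "\<And>n. AE \<omega> in M. g n \<omega> \<le> h \<omega>" by blast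
    have "2 ^ n \<le> (LINT \<omega>|P. h \<omega>)" for n
    proof -
      have "2 ^ n = c n * (4 ^ n * nrm (f n))"
      proof -
        have "(4::real) ^ n = 2 ^ n * 2 ^ n" by (simp add: power_mult_distrib[symmetric])
        then show ?thesis using pos[of n] by (simp add: c_def)
      qed
      also have "\<dots> \<le> c n * (LINT \<omega>|P. \<bar>f n \<omega>\<bar>)" using f(2)[of n] c[of n] by (intro mult_left_mono) auto
      also have "\<dots> = (LINT \<omega>|P. g n \<omega>)" by (simp add: g_def)
      also have "\<dots> \<le> (LINT \<omega>|P. h \<omega>)"
        using h E_integrable[OF E_scale[OF E_abs(1)[OF f(1)]]]
        by (intro integral_mono_AE AE_completion) (auto simp: g_def E_integrable)
      finally show ?thesis .
    qed
    moreover obtain n where "(LINT \<omega>|P. h \<omega>) < 2 ^ n"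
      using real_arch_pow[of 2 "LINT \<omega>|P. h \<omega>"] by auto
    ultimately show False by (meson not_less)
  qed
  then show thesis using that by blast
qed

lemma strongly_measurable_norm: "strongly_measurable M f \<Longrightarrow> (\<lambda>\<omega>. norm (f \<omega>)) \<in> borel_measurable P"
  by (rule strongly_measurable_continuous_compose[where T=norm]) (auto intro: continuous_intros)

lemma koethe_bochner_add:
  fixes f g :: "'a \<Rightarrow> 'z::real_normed_vector"
  assumes f: "f \<in> koethe_bochner M E" and g: "g \<in> koethe_bochner M E"
  shows "(\<lambda>\<omega>. f \<omega> + g \<omega>) \<in> koethe_bochner M E"
proof -
  obtain s where s: "\<And>n. simple_function M (s n)" "AE \<omega> in M. (\<lambda>n. s n \<omega>) \<longlonglongrightarrow> f \<omega>"
    using f unfolding koethe_bochner_def strongly_measurable_def by blast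
  obtain t where t: "\<And>n. simple_function M (t n)" "AE \<omega> in M. (\<lambda>n. t n \<omega>) \<longlonglongrightarrow> g \<omega>"
    using g unfolding koethe_bochner_def strongly_measurable_def by blast
  have st: "simple_function M (\<lambda>\<omega>. s n \<omega> + t n \<omega>)" for n
    by (rule simple_function_compose2[OF s(1) t(1)])
  have "AE \<omega> in M. (\<lambda>n. s n \<omega> + t n \<omega>) \<longlonglongrightarrow> f \<omega> + g \<omega>"
    using s(2) t(2) by eventually_elim (rule tendsto_add)
  with st have sm: "strongly_measurable M (\<lambda>\<omega>. f \<omega> + g \<omega>)"
    unfolding strongly_measurable_def by (intro exI[of _ "\<lambda>n \<omega>. s n \<omega> + t n \<omega>"]) auto
  have "(\<lambda>\<omega>. norm (f \<omega>) + norm (g \<omega>)) \<in> E"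
    using f g by (intro E_add) (auto simp: koethe_bochner_def)
  from E_ideal(1)[OF strongly_measurable_norm[OF sm] this] sm show ?thesis
    by (simp add: koethe_bochner_def norm_triangle_ineq)
qed

lemma koethe_bochner_scale:
  fixes f :: "'a \<Rightarrow> 'z::real_normed_vector"
  assumes f: "f \<in> koethe_bochner M E"
  shows "(\<lambda>\<omega>. c *\<^sub>R f \<omega>) \<in> koethe_bochner M E"
proof -
  obtain s where s: "\<And>n. simple_function M (s n)" "AE \<omega> in M. (\<lambda>n. s n \<omega>) \<longlonglongrightarrow> f \<omega>"
    using f unfolding koethe_bochner_def strongly_measurable_def by blast
  have "simple_function M (\<lambda>\<omega>. c *\<^sub>R s n \<omega>)" for n by (rule simple_function_compose1[OF s(1)])
  moreover have "AE \<omega> in M. (\<lambda>n. c *\<^sub>R s n \<omega>) \<longlonglongrightarrow> c *\<^sub>R f \<omega>"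
    using s(2) by eventually_elim (intro tendsto_intros)
  ultimately have "strongly_measurable M (\<lambda>\<omega>. c *\<^sub>R f \<omega>)"
    unfolding strongly_measurable_def by (intro exI[of _ "\<lambda>n \<omega>. c *\<^sub>R s n \<omega>"]) auto
  then show ?thesis using f E_scale[of "\<lambda>\<omega>. norm (f \<omega>)" "\<bar>c\<bar>"] by (simp add: koethe_bochner_def)
qed

lemma simple_function_code_bochner:
  fixes Y :: "bool list \<Rightarrow> 'z::real_normed_vector"
  assumes S: "S \<in> sets M" and D: "\<And>i. D i \<in> sets M" and Y: "\<And>l. norm (Y l) \<le> B"
  shows "(\<lambda>\<omega>. indicator S \<omega> *\<^sub>R Y (code D n \<omega>)) \<in> koethe_bochner M E"
    and "koethe_bochner_norm nrm (\<lambda>\<omega>. indicator S \<omega> *\<^sub>R Y (code D n \<omega>)) \<le> B * nrm (indicator (space M))"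
proof -
  have B: "0 \<le> B" using order_trans[OF norm_ge_zero Y] .
  have "simple_function M (\<lambda>\<omega>. (indicator S \<omega> :: real))" using S by (rule simple_function_indicator)
  then have "simple_function M (\<lambda>\<omega>. indicator S \<omega> *\<^sub>R Y (code D n \<omega>))"
    by (rule simple_function_compose2[OF _ simple_function_code[OF D], where h="\<lambda>x l. x *\<^sub>R Y l"])
  then have sm: "strongly_measurable M (\<lambda>\<omega>. indicator S \<omega> *\<^sub>R Y (code D n \<omega>))"
    by (rule strongly_measurable_simple)
  have i: "indicator (space M) \<in> E" by (intro indicator_E) auto
  have le: "\<bar>norm (indicator S \<omega> *\<^sub>R Y (code D n \<omega>))\<bar> \<le> \<bar>B * indicator (space M) \<omega>\<bar>" if "\<omega> \<in> space M" for \<omega>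
    using that Y B by (simp add: indicator_def)
  note * = E_ideal[OF strongly_measurable_norm[OF sm] E_scale[OF i, of B] le]
  show "(\<lambda>\<omega>. indicator S \<omega> *\<^sub>R Y (code D n \<omega>)) \<in> koethe_bochner M E"
    unfolding koethe_bochner_def using sm *(1) by blast
  show "koethe_bochner_norm nrm (\<lambda>\<omega>. indicator S \<omega> *\<^sub>R Y (code D n \<omega>)) \<le> B * nrm (indicator (space M))"
    unfolding koethe_bochner_norm_def using *(2) nrm_scale[OF i, of B] B by simp
qed

text \<open>
  Constants belong to \<open>E\<close>; hence \<open>E\<^sup>*(X\<^sup>*)\<close> consists of integrable functions.
\<close>

lemma koethe_dual_norm_integrable:
  assumes "g \<in> koethe_bochner M (koethe_dual M E)"
  shows "integrable P (\<lambda>\<omega>. norm (g \<omega>))"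
proof -
  have "indicator (space M) \<in> E" by (intro indicator_E) auto
  then have "integrable P (\<lambda>\<omega>. indicator (space M) \<omega> * norm (g \<omega>))"
    using assms unfolding koethe_bochner_def koethe_dual_def by blast
  moreover have "integrable P (\<lambda>\<omega>. indicator (space M) \<omega> * norm (g \<omega>)) \<longleftrightarrow> integrable P (\<lambda>\<omega>. norm (g \<omega>))"
    by (intro Bochner_Integration.integrable_cong) auto
  ultimately show ?thesis by blast
qed

end

section \<open>The Rainwater property forces bounded martingales to converge\<close>

lemma almost_norming_point:
  fixes \<psi> :: "'x::real_normed_vector \<Rightarrow>\<^sub>L real"
  shows "\<exists>x. norm x \<le> 1 \<and> norm \<psi> / 2 \<le> \<psi> x"
proof (rule ccontr)
  assume no: "\<not> ?thesis"
  then have less: "\<psi> x < norm \<psi> / 2" if "norm x \<le> 1" for x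
    using that by (meson not_less)
  have "norm (\<psi> y) \<le> norm \<psi> / 2 * norm y" for y
  proof (cases "y = 0")
    case False
    define x where "x = y /\<^sub>R norm y"
    have "norm x \<le> 1" "norm (- x) \<le> 1" using False by (auto simp: x_def)
    then have "\<bar>\<psi> x\<bar> < norm \<psi> / 2" using less[of x] less[of "- x"] by (simp add: blinfun.minus_right)
    moreover have "\<psi> y = norm y * \<psi> x" using False by (simp add: x_def blinfun.scaleR_right)
    ultimately show ?thesis using False by (simp add: abs_mult mult.commute mult_right_mono)
  qed simp
  then have "norm \<psi> \<le> norm \<psi> / 2" by (intro norm_blinfun_bound) auto
  moreover have "0 < norm \<psi>" using less[of 0] by simp
  ultimately show False by simp
qed

context koethe
begin

text \<open>
  The functional given by the \<open>X\<^sup>*\<close>-valued simple function that equals \<open>Q l\<close> on the cell \<open>l\<close> of level \<open>n\<close>.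
\<close>

definition functional :: "'a set \<Rightarrow> (nat \<Rightarrow> 'a set) \<Rightarrow> (bool list \<Rightarrow> 'x::real_normed_vector \<Rightarrow>\<^sub>L real) \<Rightarrow> nat
    \<Rightarrow> ('a \<Rightarrow> 'x) \<Rightarrow> real" where
  "functional S D Q n f = (LINT \<omega>|P. indicator S \<omega> * Q (code D n \<omega>) (f \<omega>))"

lemma functional_integrable:
  fixes Q :: "bool list \<Rightarrow> 'x::real_normed_vector \<Rightarrow>\<^sub>L real"
  assumes S: "S \<in> sets M" and D: "\<And>i. D i \<in> sets M" and f: "f \<in> koethe_bochner M E"
  shows "integrable P (\<lambda>\<omega>. indicator S \<omega> * Q (code D n \<omega>) (f \<omega>))"
proof -
  have sm: "strongly_measurable M f" and fE: "(\<lambda>\<omega>. norm (f \<omega>)) \<in> E"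
    using f by (auto simp: koethe_bochner_def)
  have eq: "indicator S \<omega> * Q (code D n \<omega>) (f \<omega>) = (\<Sum>l\<in>words n. indicator (cell S D l) \<omega> * Q l (f \<omega>))" for \<omega>
  proof (cases "\<omega> \<in> S")
    case True
    then show ?thesis using code_sum_indicator[of \<omega> S "\<lambda>l. Q l (f \<omega>)" D n] by simp
  next
    case False
    then have "\<omega> \<notin> cell S D l" for l by (auto simp: cell_def)
    with False show ?thesis by simp
  qed
  have "integrable P (\<lambda>\<omega>. Q l (f \<omega>))" for l
  proof (rule Bochner_Integration.integrable_bound)
    show "integrable P (\<lambda>\<omega>. norm (Q l) * norm (f \<omega>))" using E_integrable[OF fE] by simp
    show "(\<lambda>\<omega>. Q l (f \<omega>)) \<in> borel_measurable P"
      by (rule strongly_measurable_continuous_compose[OF sm]) (intro continuous_intros)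
    show "AE \<omega> in P. norm (Q l (f \<omega>)) \<le> norm (norm (Q l) * norm (f \<omega>))"
      using norm_blinfun[of "Q l"] by (intro AE_I2) simp
  qed
  moreover have "cell S D l \<in> sets P" for l by (intro sets_completionI_sets sets_cell S D)
  ultimately have "integrable P (\<lambda>\<omega>. indicator (cell S D l) \<omega> * Q l (f \<omega>))" for l
    using integrable_mult_indicator[of "cell S D l" P "\<lambda>\<omega>. Q l (f \<omega>)"] by simp
  then show ?thesis unfolding eq by (intro Bochner_Integration.integrable_sum)
qed

lemma functional_bound:
  assumes S: "S \<in> sets M" and D: "\<And>i. D i \<in> sets M" and f: "f \<in> koethe_bochner M E"
    and Q: "\<And>l. norm (Q l) \<le> K"
  shows "\<bar>functional S D Q n f\<bar> \<le> K * (LINT \<omega>|P. norm (f \<omega>))"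
proof -
  have K: "0 \<le> K" using order_trans[OF norm_ge_zero Q] .
  have fE: "(\<lambda>\<omega>. norm (f \<omega>)) \<in> E" using f by (auto simp: koethe_bochner_def)
  note i = functional_integrable[where D=D, OF S D f, where Q=Q and n=n]
  have "\<bar>functional S D Q n f\<bar> \<le> (LINT \<omega>|P. \<bar>indicator S \<omega> * Q (code D n \<omega>) (f \<omega>)\<bar>)"
    unfolding functional_def using integral_norm_bound[of P] by (simp only: real_norm_def[symmetric])
  also have "\<dots> \<le> (LINT \<omega>|P. K * norm (f \<omega>))"
  proof (rule integral_mono)
    show "\<bar>indicator S \<omega> * Q (code D n \<omega>) (f \<omega>)\<bar> \<le> K * norm (f \<omega>)" for \<omega>
    proof -
      have "\<bar>Q (code D n \<omega>) (f \<omega>)\<bar> \<le> norm (Q (code D n \<omega>)) * norm (f \<omega>)"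
        using norm_blinfun[of "Q (code D n \<omega>)" "f \<omega>"] by simp
      also have "\<dots> \<le> K * norm (f \<omega>)" by (intro mult_right_mono Q) auto
      finally show ?thesis using K by (simp add: indicator_def)
    qed
  qed (use i E_integrable[OF fE] in auto)
  finally show ?thesis by simp
qed

text \<open>
  The martingale property: against a function of an earlier level, a martingale may be replaced by its
  value at that level.
\<close>

lemma functional_at_earlier_level:
  fixes Y :: "bool list \<Rightarrow> 'x::real_normed_vector"
  assumes S: "S \<in> sets M" and D: "\<And>i. D i \<in> sets M" and v: "tree_additive v"
    and zero: "\<And>l. measure M (cell S D l) = 0 \<Longrightarrow> v l = 0" and "n \<le> N"
  shows "functional S D (\<lambda>l. v l /\<^sub>R measure M (cell S D l)) N (\<lambda>\<omega>. indicator S \<omega> *\<^sub>R Y (code D n \<omega>))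
      = (\<Sum>b\<in>words n. v b (Y b))"
proof -
  define r where "r = N - n"
  have N: "N = n + r" using \<open>n \<le> N\<close> by (simp add: r_def)
  define G where "G l = (v l /\<^sub>R measure M (cell S D l)) (Y (drop r l))" for l
  have "functional S D (\<lambda>l. v l /\<^sub>R measure M (cell S D l)) N (\<lambda>\<omega>. indicator S \<omega> *\<^sub>R Y (code D n \<omega>))
      = (LINT \<omega>|P. indicator S \<omega> * G (code D N \<omega>))"
    unfolding functional_def G_def N drop_code
    by (intro Bochner_Integration.integral_cong refl) (simp add: indicator_def)
  also have "\<dots> = (\<Sum>l\<in>words N. measure M (cell S D l) * G l)"
    using integral_code(2)[OF completion_code_facts(1,2,3)[OF prob_space_axioms S D], where F=G and n=N]
    by (simp add: completion_code_facts(4)[OF prob_space_axioms S D])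
  also have "\<dots> = (\<Sum>l\<in>words N. v l (Y (drop r l)))"
  proof (intro sum.cong refl)
    show "measure M (cell S D l) * G l = v l (Y (drop r l))" for l
      by (cases "measure M (cell S D l) = 0") (simp_all add: G_def blinfun.scaleR_left zero)
  qed
  also have "\<dots> = (\<Sum>b\<in>words n. \<Sum>t\<in>words r. v (t @ b) (Y b))"
    unfolding N sum_words_add by (intro sum.cong refl) (auto simp: words_def)
  also have "\<dots> = (\<Sum>b\<in>words n. (\<Sum>t\<in>words r. v (t @ b)) (Y b))"
    by (simp add: blinfun.sum_left)
  also have "\<dots> = (\<Sum>b\<in>words n. v b (Y b))" by (simp add: sum_descendants[OF v])
  finally show ?thesis .
qed

text \<open>
  The heart of the proof. If the increments of the bounded martingale \<open>v / w\<close> between consecutive levels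
  \<open>n 0, n 1, \<dots>\<close> all had \<open>L\<^sub>1\<close> norm more than \<open>\<delta>\<close>, then the martingale differences built from points that nearly norm these
  increments would be null against \<open>E\<^sup>*(X\<^sup>*)\<close>, but not against a cluster point of the functionals that
  the martingale defines.
\<close>

lemma rainwater_imp_martingale_Cauchy:
  fixes v :: "bool list \<Rightarrow> 'x::banach \<Rightarrow>\<^sub>L real"
  assumes RW: "rainwater_property (koethe_bochner M E :: ('a \<Rightarrow> 'x) set)
      (koethe_bochner_norm nrm) (dual_bochner_ball M E nrm)"
    and S: "S \<in> sets M" and D: "\<And>i. D i \<in> sets M"
    and v: "tree_additive v" "\<And>l. norm (v l) \<le> K * measure M (cell S D l)" and "0 < \<delta>"
  shows "\<exists>m. \<forall>d. spread (\<lambda>l. measure M (cell S D l)) v m d \<le> \<delta>"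
proof (rule ccontr)
  define w where "w l = measure M (cell S D l)" for l
  assume "\<not> ?thesis"
  then have "\<forall>m. \<exists>d. \<delta> < spread w v m d" unfolding w_def by (simp add: not_le)
  then obtain dd where dd: "\<And>m. \<delta> < spread w v m (dd m)" by metis
  define n where "n = rec_nat 0 (\<lambda>_ m. m + dd m)"
  define d where "d k = dd (n k)" for k
  have n: "n (Suc k) = n k + d k" for k by (simp add: n_def d_def)
  have big: "\<delta> < spread w v (n k) (d k)" for k unfolding d_def by (rule dd)
  have w: "0 \<le> w l" for l by (simp add: w_def)
  have wt: "tree_additive w"
    unfolding w_def using finite_measure_axioms S D by (rule tree_additive_measure_cell)
  have w_cancel: "w a * (w (u @ a) / w a) = w (u @ a)" for u a
    using tree_weight_le[OF wt w, of u a] w[of "u @ a"] by simp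
  have v0: "v l = 0" if "w l = 0" for l using v(2)[of l] that by (simp add: w_def)
  have "\<exists>x. norm x \<le> 1 \<and> norm (v (u @ a) - (w (u @ a) / w a) *\<^sub>R v a) / 2
      \<le> (v (u @ a) - (w (u @ a) / w a) *\<^sub>R v a) x" for u a
    by (rule almost_norming_point)
  then obtain x where x: "\<And>u a. norm (x u a) \<le> 1"
      "\<And>u a. norm (v (u @ a) - (w (u @ a) / w a) *\<^sub>R v a) / 2 \<le> (v (u @ a) - (w (u @ a) / w a) *\<^sub>R v a) (x u a)"
    by metis
  \<comment> \<open>The conditional expectation of \<open>x\<close> on the cell \<open>a\<close>; it is 0 if the cell has mass 0.\<close>
  define avg where "avg k a = (\<Sum>u\<in>words (d k). (w (u @ a) / w a) *\<^sub>R x u a)" for k a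
  define Y where "Y k l = x (take (d k) l) (drop (d k) l) - avg k (drop (d k) l)" for k l
  have Y: "Y k (u @ a) = x u a - avg k a" if "u \<in> words (d k)" for k u a
    using that by (simp add: Y_def words_def)
  have avg_norm: "norm (avg k a) \<le> 1" for k a
  proof -
    have "norm (avg k a) \<le> (\<Sum>u\<in>words (d k). w (u @ a) / w a * 1)"
      unfolding avg_def
    proof (rule sum_norm_le)
      fix u
      have "norm ((w (u @ a) / w a) *\<^sub>R x u a) = w (u @ a) / w a * norm (x u a)" using w by simp
      also have "\<dots> \<le> w (u @ a) / w a * 1" using w x(1) by (intro mult_left_mono) auto
      finally show "norm ((w (u @ a) / w a) *\<^sub>R x u a) \<le> w (u @ a) / w a * 1" .
    qed
    also have "\<dots> = w a / w a" by (simp add: sum_divide_distrib[symmetric] sum_descendants[OF wt])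
    finally show ?thesis by (cases "w a = 0") auto
  qed
  have Yb: "norm (Y k l) \<le> 2" for k l
  proof -
    have "norm (Y k l) \<le> norm (x (take (d k) l) (drop (d k) l)) + norm (avg k (drop (d k) l))"
      unfolding Y_def by (rule norm_triangle_ineq4)
    also have "\<dots> \<le> 1 + 1" by (intro add_mono x(1) avg_norm)
    finally show ?thesis by simp
  qed
  have mean: "(\<Sum>u\<in>words (d k). w (u @ a) *\<^sub>R Y k (u @ a)) = 0" for k a
  proof -
    have "(\<Sum>u\<in>words (d k). w (u @ a) *\<^sub>R Y k (u @ a))
        = (\<Sum>u\<in>words (d k). w (u @ a) *\<^sub>R x u a) - (\<Sum>u\<in>words (d k). w (u @ a)) *\<^sub>R avg k a"
      by (simp add: Y scaleR_diff_right sum_subtractf scaleR_sum_left)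
    also have "(\<Sum>u\<in>words (d k). w (u @ a)) *\<^sub>R avg k a = (\<Sum>u\<in>words (d k). (w a * (w (u @ a) / w a)) *\<^sub>R x u a)"
      by (simp add: sum_descendants[OF wt] avg_def scaleR_sum_right)
    finally show ?thesis by (simp only: w_cancel diff_self)
  qed
  define f where "f k \<omega> = indicator S \<omega> *\<^sub>R Y k (code D (n (Suc k)) \<omega>)" for k \<omega>
  let ?V = "koethe_bochner M E :: ('a \<Rightarrow> 'x) set" and ?p = "koethe_bochner_norm nrm :: ('a \<Rightarrow> 'x) \<Rightarrow> real"
  have fV: "f k \<in> ?V" and fn: "?p (f k) \<le> 2 * nrm (indicator (space M))" for k
    unfolding f_def using S D Yb by (rule simple_function_code_bochner)+
  have "(\<lambda>k. \<phi> (f k)) \<longlonglongrightarrow> 0" if \<phi>: "\<phi> \<in> dual_bochner_ball M E nrm" for \<phi>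
  proof -
    obtain g :: "'a \<Rightarrow> 'x \<Rightarrow>\<^sub>L real" where g: "g \<in> koethe_bochner M (koethe_dual M E)" "\<phi> = (\<lambda>f. LINT \<omega>|P. g \<omega> (f \<omega>))"
      using \<phi> unfolding dual_bochner_ball_def by blast
    have "strongly_measurable M g" using g(1) by (simp add: koethe_bochner_def)
    then show ?thesis unfolding g(2) f_def
      using koethe_dual_norm_integrable[OF g(1)] mean
      by (intro martingale_difference_null[where n=n and d=d and B=2, OF prob_space_axioms S D n _ Yb]) (simp_all add: w_def)
  qed
  then have "weakly_null ?V ?p f"
    using RW fV fn unfolding rainwater_property_def by blast
  define Q where "Q l = v l /\<^sub>R w l" for l
  have Qb: "norm (Q l) \<le> \<bar>K\<bar>" for l
  proof (cases "w l = 0")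
    case False
    with w[of l] have "0 < w l" by simp
    then have "norm (Q l) = norm (v l) / w l" by (simp add: Q_def divide_inverse mult.commute)
    also have "\<dots> \<le> K" using v(2)[of l] \<open>0 < w l\<close> by (simp add: pos_divide_le_eq w_def)
    finally show ?thesis by simp
  qed (simp add: Q_def)
  obtain C where C: "0 \<le> C" "\<And>f. f \<in> E \<Longrightarrow> (LINT \<omega>|P. \<bar>f \<omega>\<bar>) \<le> C * nrm f"
    using L1_bound by metis
  have "\<exists>\<psi>. in_dual ?V ?p \<psi> \<and> (\<forall>f\<in>?V. \<forall>c. eventually (\<lambda>j. c \<le> functional S D Q (n j) f) sequentially \<longrightarrow> c \<le> \<psi> f)"
  proof (rule in_dual_cluster_point)
    fix j and f g :: "'a \<Rightarrow> 'x" and c :: real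
    assume f: "f \<in> ?V"
    note fi = functional_integrable[where D=D, OF S D f, where Q=Q and n="n j"]
    show "(\<lambda>\<omega>. c *\<^sub>R f \<omega>) \<in> ?V" using f by (rule koethe_bochner_scale)
    show "functional S D Q (n j) (\<lambda>\<omega>. c *\<^sub>R f \<omega>) = c * functional S D Q (n j) f"
      by (simp add: functional_def blinfun.scaleR_right mult.left_commute)
    have "\<bar>functional S D Q (n j) f\<bar> \<le> \<bar>K\<bar> * (LINT \<omega>|P. norm (f \<omega>))"
      using S D f Qb by (rule functional_bound)
    also have "\<dots> \<le> \<bar>K\<bar> * (C * ?p f)"
      using C(2)[of "\<lambda>\<omega>. norm (f \<omega>)"] f by (intro mult_left_mono) (auto simp: koethe_bochner_def koethe_bochner_norm_def)
    finally show "\<bar>functional S D Q (n j) f\<bar> \<le> (\<bar>K\<bar> * C) * ?p f" by simp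
    assume g: "g \<in> ?V"
    note gi = functional_integrable[where D=D, OF S D g, where Q=Q and n="n j"]
    show "(\<lambda>\<omega>. f \<omega> + g \<omega>) \<in> ?V" using f g by (rule koethe_bochner_add)
    show "functional S D Q (n j) (\<lambda>\<omega>. f \<omega> + g \<omega>) = functional S D Q (n j) f + functional S D Q (n j) g"
      unfolding functional_def blinfun.add_right distrib_left using fi gi by (rule Bochner_Integration.integral_add)
  qed
  then obtain \<psi> where \<psi>: "in_dual ?V ?p \<psi>"
    "\<And>f c. f \<in> ?V \<Longrightarrow> eventually (\<lambda>j. c \<le> functional S D Q (n j) f) sequentially \<Longrightarrow> c \<le> \<psi> f"
    by blast
  have "mono n" using n by (simp add: mono_iff_le_Suc)
  have "\<delta> / 2 \<le> functional S D Q (n j) (f k)" if "Suc k \<le> j" for j k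
  proof -
    have "functional S D Q (n j) (f k) = (\<Sum>b\<in>words (n k + d k). v b (Y k b))"
      unfolding f_def Q_def w_def n[of k, symmetric]
      using v0 monoD[OF \<open>mono n\<close> that] by (intro functional_at_earlier_level S D v(1)) (simp_all add: w_def)
    also have "\<dots> = (\<Sum>a\<in>words (n k). \<Sum>u\<in>words (d k). v (u @ a) (x u a) - v (u @ a) (avg k a))"
      unfolding sum_words_add by (intro sum.cong refl) (simp add: Y blinfun.diff_right)
    also have "\<dots> = (\<Sum>a\<in>words (n k). (\<Sum>u\<in>words (d k). v (u @ a) (x u a)) - v a (avg k a))"
      by (simp add: sum_subtractf blinfun.sum_left[symmetric] sum_descendants[OF v(1)])
    also have "\<dots> = (\<Sum>a\<in>words (n k). \<Sum>u\<in>words (d k). (v (u @ a) - (w (u @ a) / w a) *\<^sub>R v a) (x u a))"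
      by (simp add: avg_def blinfun.diff_left blinfun.scaleR_left blinfun.scaleR_right blinfun.sum_right sum_subtractf)
    also have "\<dots> \<ge> (\<Sum>a\<in>words (n k). \<Sum>u\<in>words (d k). norm (v (u @ a) - (w (u @ a) / w a) *\<^sub>R v a) / 2)"
      by (intro sum_mono x)
    also have "(\<Sum>a\<in>words (n k). \<Sum>u\<in>words (d k). norm (v (u @ a) - (w (u @ a) / w a) *\<^sub>R v a) / 2) = spread w v (n k) (d k) / 2"
      by (simp add: spread_def sum_divide_distrib)
    finally show ?thesis using big[of k] by simp
  qed
  then have "\<delta> / 2 \<le> \<psi> (f k)" for k
    by (intro \<psi>(2) fV) (rule eventually_sequentiallyI[of "Suc k"])
  moreover have "(\<lambda>k. \<psi> (f k)) \<longlonglongrightarrow> 0"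
    using \<open>weakly_null ?V ?p f\<close> \<psi>(1) unfolding weakly_null_def by blast
  ultimately have "\<delta> / 2 \<le> 0" by (intro LIMSEQ_le_const) auto
  with \<open>0 < \<delta>\<close> show False by simp
qed

end

section \<open>From sequences of events to all finite partitions\<close>

text \<open>
  The triangle inequality through the level \<open>m\<close>. It turns smallness of the spreads that start at one
  level into smallness from all later levels on.
\<close>

lemma spread_later_level:
  assumes w: "tree_additive w" "\<And>l. 0 \<le> w l"
  shows "spread w v (m + r) d \<le> spread w v m (r + d) + spread w v m r"
proof -
  have *: "norm (v (t @ u @ a) - (w (t @ u @ a) / w (u @ a)) *\<^sub>R v (u @ a))
      \<le> norm (v (t @ u @ a) - (w (t @ u @ a) / w a) *\<^sub>R v a)
        + w (t @ u @ a) / w (u @ a) * norm (v (u @ a) - (w (u @ a) / w a) *\<^sub>R v a)" for a u t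
  proof -
    have "w (t @ u @ a) / w (u @ a) * (w (u @ a) / w a) = w (t @ u @ a) / w a"
      using tree_weight_le[OF w, of t "u @ a"] w(2)[of "t @ u @ a"] by (cases "w (u @ a) = 0") auto
    then have eq: "v (t @ u @ a) - (w (t @ u @ a) / w (u @ a)) *\<^sub>R v (u @ a)
      = (v (t @ u @ a) - (w (t @ u @ a) / w a) *\<^sub>R v a)
        - (w (t @ u @ a) / w (u @ a)) *\<^sub>R (v (u @ a) - (w (u @ a) / w a) *\<^sub>R v a)"
      by (simp only: scaleR_diff_right scaleR_scaleR) simp
    have "norm ((w (t @ u @ a) / w (u @ a)) *\<^sub>R (v (u @ a) - (w (u @ a) / w a) *\<^sub>R v a))
      = w (t @ u @ a) / w (u @ a) * norm (v (u @ a) - (w (u @ a) / w a) *\<^sub>R v a)" using w(2) by simp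
    then show ?thesis unfolding eq by (metis norm_triangle_ineq4)
  qed
  have "spread w v (m + r) d = (\<Sum>a\<in>words m. \<Sum>u\<in>words r. \<Sum>t\<in>words d.
      norm (v (t @ u @ a) - (w (t @ u @ a) / w (u @ a)) *\<^sub>R v (u @ a)))"
    by (simp add: spread_def sum_words_add)
  also have "\<dots> \<le> (\<Sum>a\<in>words m. \<Sum>u\<in>words r. \<Sum>t\<in>words d.
      norm (v (t @ u @ a) - (w (t @ u @ a) / w a) *\<^sub>R v a)
        + w (t @ u @ a) / w (u @ a) * norm (v (u @ a) - (w (u @ a) / w a) *\<^sub>R v a))"
    by (intro sum_mono *)
  also have "\<dots> = spread w v m (r + d) + (\<Sum>a\<in>words m. \<Sum>u\<in>words r.
      (\<Sum>t\<in>words d. w (t @ u @ a)) / w (u @ a) * norm (v (u @ a) - (w (u @ a) / w a) *\<^sub>R v a))"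
    by (simp add: spread_def sum_words_add sum.distrib sum_distrib_right sum_divide_distrib)
  also have "(\<Sum>a\<in>words m. \<Sum>u\<in>words r.
      (\<Sum>t\<in>words d. w (t @ u @ a)) / w (u @ a) * norm (v (u @ a) - (w (u @ a) / w a) *\<^sub>R v a)) \<le> spread w v m r"
    unfolding spread_def sum_descendants[OF w(1)] by (intro sum_mono) auto
  finally show ?thesis by simp
qed

definition event_spread :: "'b measure \<Rightarrow> ('b set \<Rightarrow> 'z::real_normed_vector) \<Rightarrow> (nat \<Rightarrow> 'b set) \<Rightarrow> nat \<Rightarrow> nat \<Rightarrow> real" where
  "event_spread N \<nu> C = spread (\<lambda>l. measure N (cell (space N) C l)) (\<lambda>l. \<nu> (cell (space N) C l))"

lemma event_spread_cong:
  assumes "\<And>i. i < m + d \<Longrightarrow> C i = C' i"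
  shows "event_spread N \<nu> C m d = event_spread N \<nu> C' m d"
proof -
  have "cell (space N) C l = cell (space N) C' l" if "length l \<le> m + d" for l
    using assms that by (intro cell_cong) auto
  then show ?thesis unfolding event_spread_def by (intro spread_cong) auto
qed

lemma not_purely_atomicE:
  assumes "\<not> purely_atomic M"
  obtains S where "S \<in> sets M" "0 < measure M S" "\<And>B. B \<subseteq> S \<Longrightarrow> \<not> is_atom M B"
  using assms unfolding purely_atomic_def by blast

definition bounded_additive :: "'b measure \<Rightarrow> real \<Rightarrow> ('b set \<Rightarrow> 'z::real_normed_vector) \<Rightarrow> bool" where
  "bounded_additive N K \<nu> \<longleftrightarrow>
     (\<forall>A\<in>sets N. \<forall>B\<in>sets N. A \<inter> B = {} \<longrightarrow> \<nu> (A \<union> B) = \<nu> A + \<nu> B) \<and>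
     (\<forall>A\<in>sets N. norm (\<nu> A) \<le> K * measure N A)"

text \<open>
  Masses and values of \<open>\<nu>\<close> on the cells are all that counts, so the martingale on \<open>N\<close> is replaced by a copy on
  a part of \<open>M\<close> without atoms, with masses multiplied by a constant.
\<close>

lemma (in koethe) rainwater_imp_event_spread_small:
  fixes \<nu> :: "'b set \<Rightarrow> 'x::banach \<Rightarrow>\<^sub>L real"
  assumes RW: "rainwater_property (koethe_bochner M E :: ('a \<Rightarrow> 'x) set)
      (koethe_bochner_norm nrm) (dual_bochner_ball M E nrm)"
    and na: "\<not> purely_atomic M" and N: "finite_measure N" and \<nu>: "bounded_additive N K \<nu>"
    and C: "range C \<subseteq> sets N" and "0 < \<delta>"
  shows "\<exists>m. \<forall>d. event_spread N \<nu> C m d \<le> \<delta>"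
proof -
  interpret N: finite_measure N by fact
  define w where "w l = measure N (cell (space N) C l)" for l
  define v where "v l = \<nu> (cell (space N) C l)" for l
  have C': "C i \<in> sets N" for i using C by auto
  have cs: "cell (space N) C l \<in> sets N" for l using C' by (intro sets_cell) auto
  have wt: "tree_additive w" unfolding w_def by (intro tree_additive_measure_cell N C') auto
  have vt: "tree_additive v"
    unfolding v_def using \<nu> by (intro tree_additive_cell[where M=N] C') (auto simp: bounded_additive_def)
  have vb: "norm (v l) \<le> K * w l" for l using \<nu> cs by (simp add: v_def w_def bounded_additive_def)
  obtain S where S: "S \<in> sets M" "0 < measure M S" "\<And>B. B \<subseteq> S \<Longrightarrow> \<not> is_atom M B"
    using not_purely_atomicE[OF na] by metis
  have "\<exists>m. \<forall>d. spread w v m d \<le> \<delta>"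
  proof (cases "measure N (space N) = 0")
    case True
    have "w l = 0" for l
      using N.bounded_measure[of "cell (space N) C l"] True by (simp add: w_def measure_le_0_iff)
    then have "v l = 0" for l using vb[of l] by simp
    then show ?thesis using \<open>0 < \<delta>\<close> by (simp add: spread_def)
  next
    case False
    then have pos: "0 < measure N (space N)" using zero_less_measure_iff by blast
    \<comment> \<open>The masses have to fill the set \<open>S\<close> exactly.\<close>
    define c where "c = measure M S / measure N (space N)"
    have c: "0 < c" using pos S(2) by (simp add: c_def)
    have "\<exists>D. (\<forall>i. D i \<in> sets M) \<and> (\<forall>l. measure M (cell S D l) = c * w l)"
    proof (rule realize_events[OF finite_measure_axioms S(1,3)])
      show "0 \<le> c * w l" for l using c by (simp add: w_def)
      show "tree_additive (\<lambda>l. c * w l)"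
        using wt unfolding tree_additive_def by (metis distrib_left)
      show "c * w [] = measure M S" using pos by (simp add: c_def w_def)
    qed
    then obtain D where D: "\<And>i. D i \<in> sets M" "\<And>l. measure M (cell S D l) = c * w l" by blast
    have "\<exists>m. \<forall>d. spread (\<lambda>l. measure M (cell S D l)) v m d \<le> \<delta>"
    proof (rule rainwater_imp_martingale_Cauchy[OF RW S(1) D(1) vt _ \<open>0 < \<delta>\<close>])
      show "norm (v l) \<le> (K / c) * measure M (cell S D l)" for l using vb c by (simp add: D(2))
    qed
    then show ?thesis using c by (simp add: D(2) spread_scale)
  qed
  then show ?thesis unfolding event_spread_def v_def w_def .
qed

text \<open>
  Sequences that are prolonged step by step, the \<open>k\<close>-th one being kept below \<open>m k\<close>, have a common
  prolongation. It satisfies every condition that depends on an initial segment only.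
\<close>

lemma diagonal_sequence:
  fixes Inv :: "(nat \<Rightarrow> 'c) \<Rightarrow> nat \<Rightarrow> bool" and Q :: "nat \<Rightarrow> nat \<Rightarrow> (nat \<Rightarrow> 'c) \<Rightarrow> nat \<Rightarrow> bool"
  assumes start: "Inv C0 m0"
    and step: "\<And>k C m. Inv C m \<Longrightarrow> \<exists>C' m'. Inv C' m' \<and> m < m' \<and> (\<forall>i<m. C' i = C i) \<and> Q k m C' m'"
    and cong: "\<And>k m C m' C'. Q k m C m' \<Longrightarrow> \<forall>i<m'. C' i = C i \<Longrightarrow> Q k m C' m'"
  shows "\<exists>C m. strict_mono m \<and> (\<forall>k. Q k (m k) C (m (Suc k))) \<and> (\<forall>k. \<exists>c. Inv c (m k) \<and> (\<forall>i<m k. C i = c i))"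
proof -
  have "\<exists>X. \<forall>n. Inv (fst (X n)) (snd (X n)) \<and> (snd (X n) < snd (X (Suc n)) \<and>
      (\<forall>i<snd (X n). fst (X (Suc n)) i = fst (X n) i) \<and> Q n (snd (X n)) (fst (X (Suc n))) (snd (X (Suc n))))"
  proof (rule dependent_nat_choice)
    show "\<exists>x. Inv (fst x) (snd x)" using start by (intro exI[of _ "(C0, m0)"]) simp
    fix x n
    assume "Inv (fst x) (snd x)"
    from step[OF this, of n] obtain C' m' where
      "Inv C' m'" "snd x < m'" "\<forall>i<snd x. C' i = fst x i" "Q n (snd x) C' m'" by blast
    then show "\<exists>y. Inv (fst y) (snd y) \<and> (snd x < snd y \<and> (\<forall>i<snd x. fst y i = fst x i) \<and> Q n (snd x) (fst y) (snd y))"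
      by (intro exI[of _ "(C', m')"]) simp
  qed
  then obtain X where X: "\<And>n. Inv (fst (X n)) (snd (X n))" "\<And>n. snd (X n) < snd (X (Suc n))"
      "\<And>n i. i < snd (X n) \<Longrightarrow> fst (X (Suc n)) i = fst (X n) i"
      "\<And>n. Q n (snd (X n)) (fst (X (Suc n))) (snd (X (Suc n)))"
    by blast
  define m where "m n = snd (X n)" for n
  define c where "c n = fst (X n)" for n
  have sm: "strict_mono m" using X(2) by (simp add: strict_mono_Suc_iff m_def)
  have ge: "n \<le> m n" for n using sm by (rule strict_mono_imp_increasing)
  have agree: "c (n + j) i = c n i" if "i < m n" for n j i
  proof (induction j)
    case (Suc j)
    have "m n \<le> m (n + j)" by (intro monoD[OF strict_mono_mono[OF sm]]) simp
    with that have "i < m (n + j)" by simp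
    then show ?case using X(3)[of i "n + j"] Suc by (simp add: m_def c_def)
  qed simp
  define C where "C i = c (Suc i) i" for i
  have C: "C i = c n i" if "i < m n" for n i
  proof (cases "n \<le> Suc i")
    case True
    then show ?thesis using agree[OF that, of "Suc i - n"] by (simp add: C_def)
  next
    case False
    have "i < m (Suc i)" using ge[of "Suc i"] by simp
    then show ?thesis using agree[of i "Suc i" "n - Suc i"] False by (simp add: C_def)
  qed
  have "Q n (m n) C (m (Suc n))" for n
  proof (rule cong)
    show "Q n (m n) (c (Suc n)) (m (Suc n))" unfolding m_def c_def by (rule X(4))
    show "\<forall>i<m (Suc n). C i = c (Suc n) i" using C by blast
  qed
  moreover have "\<exists>c'. Inv c' (m n) \<and> (\<forall>i<m n. C i = c' i)" for n
  proof (intro exI conjI)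
    show "Inv (c n) (m n)" unfolding m_def c_def by (rule X(1))
    show "\<forall>i<m n. C i = c n i" using C by blast
  qed
  ultimately show ?thesis using sm by blast
qed

text \<open>
  The first \<open>m\<close> events already generate a partition such that no refinement changes the averages of \<open>\<nu>\<close>
  by more than \<open>\<epsilon>\<close> in \<open>L\<^sub>1\<close>. Existence of such partitions for all \<open>\<epsilon>\<close> is the Cauchy condition for
  the net of averages.
\<close>

definition stable_spread :: "'b measure \<Rightarrow> ('b set \<Rightarrow> 'z::real_normed_vector) \<Rightarrow> real \<Rightarrow> (nat \<Rightarrow> 'b set) \<Rightarrow> nat \<Rightarrow> bool" where
  "stable_spread N \<nu> \<epsilon> C m \<longleftrightarrow>
     (\<forall>C' d. range C' \<subseteq> sets N \<longrightarrow> (\<forall>i<m. C' i = C i) \<longrightarrow> event_spread N \<nu> C' m d \<le> \<epsilon>)"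

text \<open>
  A net that is not Cauchy has an increasing sequence along which it is not Cauchy: otherwise every
  partition could be refined so as to move the averages by more than \<open>\<epsilon>\<close>, and all these
  refinements fit into one sequence of events.
\<close>

lemma stable_spread_exists:
  assumes N: "finite_measure N"
    and small: "\<And>C \<delta>. range C \<subseteq> sets N \<Longrightarrow> 0 < \<delta> \<Longrightarrow> \<exists>m. \<forall>d. event_spread N \<nu> C m d \<le> \<delta>"
    and C0: "range C0 \<subseteq> sets N" and "0 < \<epsilon>"
  shows "\<exists>C m. range C \<subseteq> sets N \<and> m0 \<le> m \<and> (\<forall>i<m0. C i = C0 i) \<and> stable_spread N \<nu> \<epsilon> C m"
proof (rule ccontr)
  assume no: "\<not> ?thesis"
  define Inv where "Inv C m \<longleftrightarrow> range C \<subseteq> sets N \<and> m0 \<le> m \<and> (\<forall>i<m0. C i = C0 i)" for C m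
  \<comment> \<open>The gap \<open>m + d \<le> m'\<close> lets the levels increase strictly even if \<open>d = 0\<close>.\<close>
  define Q where "Q (k::nat) m C m' \<longleftrightarrow> (\<exists>d. m + d \<le> m' \<and> \<epsilon> < event_spread N \<nu> C m d)" for k m C m'
  have "\<exists>C m. strict_mono m \<and> (\<forall>k. Q k (m k) C (m (Suc k))) \<and> (\<forall>k. \<exists>c. Inv c (m k) \<and> (\<forall>i<m k. C i = c i))"
  proof (rule diagonal_sequence)
    show "Inv C0 m0" using C0 by (simp add: Inv_def)
  next
    fix k C m
    assume "Inv C m"
    then have "\<not> stable_spread N \<nu> \<epsilon> C m" using no unfolding Inv_def by blast
    then obtain C' d where C': "range C' \<subseteq> sets N" "\<forall>i<m. C' i = C i" "\<epsilon> < event_spread N \<nu> C' m d"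
      unfolding stable_spread_def not_all not_imp not_le by blast
    then have "Inv C' (Suc (m + d))" using \<open>Inv C m\<close> by (simp add: Inv_def)
    moreover have "Q k m C' (Suc (m + d))" using C'(3) unfolding Q_def by (intro exI[of _ d]) simp
    ultimately show "\<exists>C' m'. Inv C' m' \<and> m < m' \<and> (\<forall>i<m. C' i = C i) \<and> Q k m C' m'"
      using C'(2) by (intro exI[of _ C'] exI[of _ "Suc (m + d)"]) simp
  next
    fix k m C m' C'
    assume "Q k m C m'" "\<forall>i<m'. C' i = C i"
    then obtain d where d: "m + d \<le> m'" "\<epsilon> < event_spread N \<nu> C m d" unfolding Q_def by blast
    have "event_spread N \<nu> C' m d = event_spread N \<nu> C m d"
      using d(1) \<open>\<forall>i<m'. C' i = C i\<close> by (intro event_spread_cong) auto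
    with d show "Q k m C' m'" unfolding Q_def by auto
  qed
  then obtain C m where sm: "strict_mono m" and Q: "\<And>k. Q k (m k) C (m (Suc k))"
    and Inv: "\<And>k. \<exists>c. Inv c (m k) \<and> (\<forall>i<m k. C i = c i)" by blast
  have C: "C i \<in> sets N" for i
  proof -
    have "i < m (Suc i)" using strict_mono_imp_increasing[OF sm, of "Suc i"] by simp
    then show ?thesis using Inv[of "Suc i"] unfolding Inv_def by auto
  qed
  define w where "w l = measure N (cell (space N) C l)" for l
  have wt: "tree_additive w" unfolding w_def by (intro tree_additive_measure_cell N C) auto
  obtain n where n: "\<And>d. event_spread N \<nu> C n d \<le> \<epsilon> / 2"
    using small[of C "\<epsilon> / 2"] C \<open>0 < \<epsilon>\<close> by auto
  have "n \<le> m n" using sm by (rule strict_mono_imp_increasing)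
  define r where "r = m n - n"
  have mn: "m n = n + r" using \<open>n \<le> m n\<close> by (simp add: r_def)
  obtain d where "\<epsilon> < event_spread N \<nu> C (n + r) d" using Q[of n] unfolding Q_def mn by blast
  also have "event_spread N \<nu> C (n + r) d \<le> event_spread N \<nu> C n (r + d) + event_spread N \<nu> C n r"
    unfolding event_spread_def w_def[symmetric] using wt by (rule spread_later_level) (simp add: w_def)
  also have "\<dots> \<le> \<epsilon> / 2 + \<epsilon> / 2" by (intro add_mono n)
  finally show False by simp
qed

section \<open>Truncation of vector measures of bounded variation\<close>

lemma vector_measure_empty:
  assumes "vector_measure N \<nu>"
  shows "\<nu> {} = 0"
proof -
  have "(\<lambda>i::nat. \<nu> {}) sums \<nu> (\<Union>i::nat. {})"
    using assms unfolding vector_measure_def by (auto simp: disjoint_family_on_def)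
  then have "(\<lambda>i::nat. \<nu> {}) \<longlonglongrightarrow> 0" by (intro summable_LIMSEQ_zero sums_summable)
  then show ?thesis by (simp add: LIMSEQ_const_iff)
qed

lemma vector_measure_Un:
  assumes \<nu>: "vector_measure N \<nu>" and A: "A \<in> sets N" "B \<in> sets N" "A \<inter> B = {}"
  shows "\<nu> (A \<union> B) = \<nu> A + \<nu> B"
proof -
  have "(\<lambda>i. \<nu> (binaryset A B i)) sums \<nu> (\<Union>i. binaryset A B i)"
  proof -
    have "range (binaryset A B) \<subseteq> sets N" using A by (simp add: range_binaryset_eq)
    moreover have "disjoint_family (binaryset A B)"
      using A by (simp add: disjoint_family_on_def binaryset_def Int_commute)
    ultimately show ?thesis using \<nu> unfolding vector_measure_def by blast
  qed
  moreover have "(\<lambda>i. \<nu> (binaryset A B i)) sums (\<nu> A + \<nu> B)"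
    using binaryset_sums[of \<nu> A B] vector_measure_empty[OF \<nu>] by simp
  ultimately show ?thesis by (simp add: UN_binaryset_eq sums_unique2)
qed

definition disjoint_families :: "'b measure \<Rightarrow> 'b set \<Rightarrow> 'b set set set" where
  "disjoint_families N A = {P. finite P \<and> P \<subseteq> sets N \<and> disjoint P \<and> \<Union>P \<subseteq> A}"

definition variation :: "'b measure \<Rightarrow> ('b set \<Rightarrow> 'z::real_normed_vector) \<Rightarrow> 'b set \<Rightarrow> ennreal" where
  "variation N \<nu> A = (SUP P\<in>disjoint_families N A. \<Sum>B\<in>P. ennreal (norm (\<nu> B)))"

lemma empty_disjoint_family [simp]: "{} \<in> disjoint_families N A"
  by (simp add: disjoint_families_def)

lemma variation_mono: "A \<subseteq> B \<Longrightarrow> variation N \<nu> A \<le> variation N \<nu> B"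
  unfolding variation_def by (intro SUP_subset_mono) (auto simp: disjoint_families_def)

lemma sum_le_variation:
  assumes "\<nu> {} = 0" "finite I" "\<And>i. i \<in> I \<Longrightarrow> A i \<in> sets N" "disjoint_family_on A I" "(\<Union>i\<in>I. A i) \<subseteq> X"
  shows "(\<Sum>i\<in>I. ennreal (norm (\<nu> (A i)))) \<le> variation N \<nu> X"
proof -
  have "(\<Sum>i\<in>I. ennreal (norm (\<nu> (A i)))) = (\<Sum>B\<in>A ` I. ennreal (norm (\<nu> B)))"
  proof (subst sum.reindex_nontrivial)
    fix i j
    assume "i \<in> I" "j \<in> I" "i \<noteq> j" "A i = A j"
    then have "A i = {}" using assms(4) unfolding disjoint_family_on_def by blast
    then show "ennreal (norm (\<nu> (A i))) = 0" using assms(1) by simp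
  qed (use assms in auto)
  also have "\<dots> \<le> variation N \<nu> X"
    unfolding variation_def
  proof (rule SUP_upper)
    have "disjoint (A ` I)" using assms(4) by (rule disjoint_family_on_disjoint_image)
    then show "A ` I \<in> disjoint_families N X" using assms unfolding disjoint_families_def by auto
  qed
  finally show ?thesis .
qed

lemma norm_le_variation:
  assumes "\<nu> {} = 0" "A \<in> sets N" "A \<subseteq> X"
  shows "ennreal (norm (\<nu> A)) \<le> variation N \<nu> X"
  using sum_le_variation[where I="{()}" and A="\<lambda>_. A" and N=N and X=X and \<nu>=\<nu>] assms
  by (simp add: disjoint_family_on_def)

lemma variation_superadditive:
  assumes \<nu>: "\<nu> {} = 0" and "A \<inter> B = {}"
  shows "variation N \<nu> A + variation N \<nu> B \<le> variation N \<nu> (A \<union> B)"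
proof -
  let ?s = "\<lambda>P. \<Sum>B\<in>P. ennreal (norm (\<nu> B))"
  have *: "?s P + ?s Q \<le> variation N \<nu> (A \<union> B)" if P: "P \<in> disjoint_families N A" and Q: "Q \<in> disjoint_families N B" for P Q
  proof -
    have "P \<inter> Q \<subseteq> {{}}" using P Q \<open>A \<inter> B = {}\<close> unfolding disjoint_families_def by blast
    then have "?s (P \<inter> Q) = 0" using \<nu> by (intro sum.neutral) auto
    moreover have "?s (P \<union> Q) + ?s (P \<inter> Q) = ?s P + ?s Q"
      using P Q by (intro sum.union_inter) (auto simp: disjoint_families_def)
    ultimately have "?s P + ?s Q = ?s (P \<union> Q)" by simp
    also have "\<dots> \<le> variation N \<nu> (A \<union> B)"
      unfolding variation_def
    proof (rule SUP_upper)
      have "\<Union>P \<inter> \<Union>Q = {}" using P Q \<open>A \<inter> B = {}\<close> unfolding disjoint_families_def by blast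
      then have "disjoint (P \<union> Q)" using P Q unfolding disjoint_families_def by (intro disjoint_union) auto
      then show "P \<union> Q \<in> disjoint_families N (A \<union> B)" using P Q unfolding disjoint_families_def by auto
    qed
    finally show ?thesis .
  qed
  have "?s P + variation N \<nu> B \<le> variation N \<nu> (A \<union> B)" if P: "P \<in> disjoint_families N A" for P
  proof -
    have "variation N \<nu> B + ?s P = (SUP Q\<in>disjoint_families N B. ?s Q + ?s P)"
      unfolding variation_def by (rule ennreal_SUP_add_left[symmetric]) (use empty_disjoint_family in blast)
    also have "\<dots> \<le> variation N \<nu> (A \<union> B)" using *[OF P] by (intro SUP_least) (simp add: add.commute)
    finally show ?thesis by (simp add: add.commute)
  qed
  moreover have "variation N \<nu> A + variation N \<nu> B = (SUP P\<in>disjoint_families N A. ?s P + variation N \<nu> B)"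
    unfolding variation_def[of N \<nu> A] by (rule ennreal_SUP_add_left[symmetric]) (use empty_disjoint_family in blast)
  ultimately show ?thesis by (simp add: SUP_least)
qed

text \<open>
  Superadditivity comes from joining disjoint families. For the other inequality, cut every member of a family
  along the sets \<open>A i\<close> and use that \<open>\<nu>\<close> is countably additive.
\<close>

lemma variation_countably_additive:
  assumes \<nu>: "vector_measure N \<nu>"
  shows "countably_additive (sets N) (variation N \<nu>)"
proof (rule countably_additiveI)
  fix A :: "nat \<Rightarrow> 'a set"
  assume A: "range A \<subseteq> sets N" "disjoint_family A"
  have \<nu>0: "\<nu> {} = 0" using \<nu> by (rule vector_measure_empty)
  show "(\<Sum>i. variation N \<nu> (A i)) = variation N \<nu> (\<Union>i. A i)"
  proof (rule antisym)
    have "(\<Sum>i<n. variation N \<nu> (A i)) \<le> variation N \<nu> (\<Union>i<n. A i)" for n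
    proof (induction n)
      case (Suc n)
      have "(\<Sum>i<Suc n. variation N \<nu> (A i)) \<le> variation N \<nu> (\<Union>i<n. A i) + variation N \<nu> (A n)"
        unfolding sum.lessThan_Suc using Suc by (rule add_right_mono)
      also have "\<dots> \<le> variation N \<nu> ((\<Union>i<n. A i) \<union> A n)"
      proof (rule variation_superadditive[where \<nu>=\<nu>, OF \<nu>0])
        have "A i \<inter> A n = {}" if "i < n" for i using A(2) that by (simp add: disjoint_family_on_def)
        then show "(\<Union>i<n. A i) \<inter> A n = {}" by blast
      qed
      also have "(\<Union>i<n. A i) \<union> A n = (\<Union>i<Suc n. A i)" by (auto simp: less_Suc_eq)
      finally show ?case .
    qed simp
    also have "variation N \<nu> (\<Union>i<n. A i) \<le> variation N \<nu> (\<Union>i. A i)" for n by (intro variation_mono) auto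
    finally show "(\<Sum>i. variation N \<nu> (A i)) \<le> variation N \<nu> (\<Union>i. A i)"
      unfolding suminf_eq_SUP by (intro SUP_least)
  next
    show "variation N \<nu> (\<Union>i. A i) \<le> (\<Sum>i. variation N \<nu> (A i))"
      unfolding variation_def[of N \<nu> "\<Union>i. A i"]
    proof (rule SUP_least)
      fix P
      assume P: "P \<in> disjoint_families N (\<Union>i. A i)"
      have "ennreal (norm (\<nu> B)) \<le> (\<Sum>i. ennreal (norm (\<nu> (B \<inter> A i))))" if "B \<in> P" for B
      proof -
        have B: "B \<in> sets N" "(\<Union>i. B \<inter> A i) = B" using that P unfolding disjoint_families_def by auto
        have "range (\<lambda>i. B \<inter> A i) \<subseteq> sets N" using A(1) B(1) by auto
        moreover have "disjoint_family (\<lambda>i. B \<inter> A i)" using A(2) unfolding disjoint_family_on_def by blast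
        ultimately have "(\<lambda>i. \<nu> (B \<inter> A i)) sums \<nu> B"
          using \<nu> B(2) unfolding vector_measure_def by metis
        then have lim: "(\<lambda>n. ennreal (norm (\<Sum>i<n. \<nu> (B \<inter> A i)))) \<longlonglongrightarrow> ennreal (norm (\<nu> B))"
          unfolding sums_def by (intro tendsto_ennrealI tendsto_norm)
        have "ennreal (norm (\<Sum>i<n. \<nu> (B \<inter> A i))) \<le> (\<Sum>i. ennreal (norm (\<nu> (B \<inter> A i))))" for n
        proof -
          have "ennreal (norm (\<Sum>i<n. \<nu> (B \<inter> A i))) \<le> ennreal (\<Sum>i<n. norm (\<nu> (B \<inter> A i)))"
            by (intro ennreal_leI norm_sum)
          also have "\<dots> = (\<Sum>i<n. ennreal (norm (\<nu> (B \<inter> A i))))" by (simp add: sum_ennreal)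
          also have "\<dots> \<le> (\<Sum>i. ennreal (norm (\<nu> (B \<inter> A i))))" by (intro sum_le_suminf) auto
          finally show ?thesis .
        qed
        then show ?thesis by (intro LIMSEQ_le_const2[OF lim] exI[of _ 0]) blast
      qed
      then have "(\<Sum>B\<in>P. ennreal (norm (\<nu> B))) \<le> (\<Sum>B\<in>P. \<Sum>i. ennreal (norm (\<nu> (B \<inter> A i))))"
        by (rule sum_mono)
      also have "\<dots> = (\<Sum>i. \<Sum>B\<in>P. ennreal (norm (\<nu> (B \<inter> A i))))"
        by (rule suminf_sum[symmetric]) auto
      also have "\<dots> \<le> (\<Sum>i. variation N \<nu> (A i))"
      proof (intro suminf_le)
        fix i
        show "(\<Sum>B\<in>P. ennreal (norm (\<nu> (B \<inter> A i)))) \<le> variation N \<nu> (A i)"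
        proof (rule sum_le_variation[where \<nu>=\<nu> and A="\<lambda>B. B \<inter> A i", OF \<nu>0])
          show "disjoint_family_on (\<lambda>B. B \<inter> A i) P"
            using P unfolding disjoint_families_def disjoint_family_on_def disjoint_def by blast
        qed (use P A in \<open>auto simp: disjoint_families_def\<close>)
      qed auto
      finally show "(\<Sum>B\<in>P. ennreal (norm (\<nu> B))) \<le> (\<Sum>i. variation N \<nu> (A i))" .
    qed
  qed
qed

text \<open>
  Bounded variation is formulated with partitions of the whole space; a disjoint family becomes one after
  adding its complement and removing the empty set.
\<close>

lemma variation_finite:
  assumes bv: "has_bounded_variation N \<nu>"
  shows "variation N \<nu> (space N) < \<infinity>"
proof -
  obtain C where C: "\<And>P. finite P \<Longrightarrow> P \<subseteq> sets N \<Longrightarrow> partition_on (space N) P \<Longrightarrow> (\<Sum>A\<in>P. norm (\<nu> A)) \<le> C"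
    using bv unfolding has_bounded_variation_def by blast
  \<comment> \<open>The family may contain the empty set, which a partition must not.\<close>
  define K where "K = C + norm (\<nu> {})"
  have "variation N \<nu> (space N) \<le> ennreal K"
    unfolding variation_def
  proof (rule SUP_least)
    fix P
    assume "P \<in> disjoint_families N (space N)"
    then have P: "finite P" "P \<subseteq> sets N" "disjoint P" "\<Union>P \<subseteq> space N" unfolding disjoint_families_def by auto
    define Q where "Q = insert (space N - \<Union>P) P - {{}}"
    have fin: "finite Q" and Qs: "Q \<subseteq> sets N" using P by (auto simp: Q_def intro!: sets.Diff sets.finite_Union)
    have "disjoint Q"
      using P(3) unfolding Q_def disjoint_def by (auto simp: Int_Diff)
    moreover have "\<Union>Q = space N" using P(4) unfolding Q_def by auto
    ultimately have "partition_on (space N) Q" unfolding partition_on_def Q_def by auto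
    from C[OF fin Qs this] have Q: "(\<Sum>B\<in>Q. norm (\<nu> B)) \<le> C" .
    have "(\<Sum>B\<in>P. norm (\<nu> B)) \<le> (\<Sum>B\<in>insert {} Q. norm (\<nu> B))"
      using fin by (intro sum_mono2) (auto simp: Q_def)
    also have "\<dots> = norm (\<nu> {}) + (\<Sum>B\<in>Q. norm (\<nu> B))"
      using fin by (subst sum.insert) (auto simp: Q_def)
    also have "\<dots> \<le> K" using Q by (simp add: K_def)
    finally show "(\<Sum>B\<in>P. ennreal (norm (\<nu> B))) \<le> ennreal K" by (simp add: sum_ennreal ennreal_leI)
  qed
  also have "\<dots> < \<infinity>" by simp
  finally show ?thesis .
qed

lemma variation_null:
  assumes null: "\<And>A. A \<in> null_sets N \<Longrightarrow> \<nu> A = 0" and A: "A \<in> null_sets N"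
  shows "variation N \<nu> A = 0"
proof -
  have "(\<Sum>B\<in>P. ennreal (norm (\<nu> B))) \<le> 0" if "P \<in> disjoint_families N A" for P
  proof -
    have "B \<in> null_sets N" if "B \<in> P" for B
      using that \<open>P \<in> _\<close> null_sets_subset[OF A] unfolding disjoint_families_def by blast
    then show ?thesis using null by (simp add: sum.neutral)
  qed
  then have "variation N \<nu> A \<le> 0" unfolding variation_def by (intro SUP_least)
  then show ?thesis by simp
qed

text \<open>
  The variation is a finite measure, absolutely continuous with respect to \<open>N\<close>. Let \<open>h\<close> be its scalar
  Radon-Nikodym derivative; then \<open>\<nu>\<close> is Lipschitz where \<open>h \<le> k\<close>, and the variation of the set where
  \<open>h > k\<close> tends to 0 because \<open>h\<close> is finite almost everywhere.
\<close>

lemma bounded_variation_truncation: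
  assumes N: "finite_measure N" and \<nu>: "vector_measure N \<nu>" and bv: "has_bounded_variation N \<nu>"
    and null: "\<And>A. A \<in> null_sets N \<Longrightarrow> \<nu> A = 0" and "0 < \<epsilon>"
  obtains S K where "S \<in> sets N" "\<And>A. A \<in> sets N \<Longrightarrow> A \<subseteq> S \<Longrightarrow> norm (\<nu> A) \<le> K * measure N A"
    "variation N \<nu> (space N - S) \<le> ennreal \<epsilon>"
proof -
  interpret N: finite_measure N by fact
  have \<nu>0: "\<nu> {} = 0" using \<nu> by (rule vector_measure_empty)
  define V where "V = measure_of (space N) (sets N) (variation N \<nu>)"
  have V_sets: "sets V = sets N" and V_space: "space V = space N" by (simp_all add: V_def)
  have "positive (sets N) (variation N \<nu>)"
    unfolding positive_def using null by (intro variation_null) auto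
  then have V: "emeasure V A = variation N \<nu> A" if "A \<in> sets N" for A
    unfolding V_def using that variation_countably_additive[OF \<nu>] by (intro emeasure_measure_of_sigma sets.sigma_algebra_axioms)
  have Vfin: "emeasure V (space N) < \<infinity>" using V[of "space N"] variation_finite[OF bv] by simp
  have "absolutely_continuous N V"
    unfolding absolutely_continuous_def
  proof
    fix A assume A: "A \<in> null_sets N"
    then have "A \<in> sets N" by auto
    then show "A \<in> null_sets V" using V[of A] variation_null[OF null A] V_sets by (auto intro!: null_setsI)
  qed
  then obtain h where h: "h \<in> borel_measurable N" "density N h = V"
    using N.Radon_Nikodym V_sets by blast
  have Vh: "emeasure V A = (\<integral>\<^sup>+t. h t * indicator A t \<partial>N)" if "A \<in> sets N" for A
    using emeasure_density[OF h(1) that] h(2) by simp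
  define T where "T k = {t \<in> space N. of_nat k < h t}" for k :: nat
  have T: "T k \<in> sets N" for k unfolding T_def using h(1) by measurable
  have "decseq T" unfolding T_def by (intro decseq_SucI) (auto intro: order.strict_trans[rotated] less_imp_le dest: order.strict_trans1[rotated])
  have "emeasure V (\<Inter>k. T k) = 0"
  proof -
    have "(\<integral>\<^sup>+t. h t \<partial>N) = (\<integral>\<^sup>+t. h t * indicator (space N) t \<partial>N)" by (intro nn_integral_cong) simp
    then have "(\<integral>\<^sup>+t. h t \<partial>N) \<noteq> \<infinity>" using Vh[of "space N"] Vfin by simp
    then have "AE t in N. h t \<noteq> \<infinity>" using h(1) by (intro nn_integral_PInf_AE)
    moreover have "h t = \<infinity>" if "t \<in> (\<Inter>k. T k)" for t
    proof (rule ccontr)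
      assume "h t \<noteq> \<infinity>"
      then obtain k :: nat where "h t < of_nat k" using ennreal_Ex_less_of_nat[of "h t"] by (auto simp: less_top)
      with that show False by (auto simp: T_def dest: order.strict_trans)
    qed
    ultimately have "AE t in N. t \<notin> (\<Inter>k. T k)" by (auto elim!: eventually_mono)
    moreover have "(\<Inter>k. T k) \<in> sets N" using T by auto
    ultimately have "(\<Inter>k. T k) \<in> null_sets N" by (simp add: AE_iff_null_sets)
    then show ?thesis using \<open>absolutely_continuous N V\<close> by (auto simp: absolutely_continuous_def)
  qed
  moreover have "(\<lambda>k. emeasure V (T k)) \<longlonglongrightarrow> emeasure V (\<Inter>k. T k)"
  proof (rule Lim_emeasure_decseq)
    show "emeasure V (T k) \<noteq> \<infinity>" for k
    proof -
      have "emeasure V (T k) \<le> emeasure V (space N)"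
        using sets.sets_into_space[OF T] V_sets by (intro emeasure_mono) auto
      with Vfin show ?thesis by auto
    qed
  qed (use T V_sets \<open>decseq T\<close> in auto)
  ultimately have "eventually (\<lambda>k. emeasure V (T k) < ennreal \<epsilon>) sequentially"
    using \<open>0 < \<epsilon>\<close> by (intro order_tendstoD(2)) auto
  then obtain k where k: "emeasure V (T k) < ennreal \<epsilon>" using eventually_happens'[OF sequentially_bot] by blast
  show thesis
  proof (rule that)
    show "space N - T k \<in> sets N" using T by auto
    have "space N - (space N - T k) = T k" by (auto simp: T_def)
    then show "variation N \<nu> (space N - (space N - T k)) \<le> ennreal \<epsilon>" using V[OF T] k by simp
    fix A
    assume A: "A \<in> sets N" "A \<subseteq> space N - T k"
    have "ennreal (norm (\<nu> A)) \<le> variation N \<nu> A" by (rule norm_le_variation[where \<nu>=\<nu>, OF \<nu>0 A(1)]) simp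
    also have "\<dots> = (\<integral>\<^sup>+t. h t * indicator A t \<partial>N)" using V[OF A(1)] Vh[OF A(1)] by simp
    also have "\<dots> \<le> (\<integral>\<^sup>+t. of_nat k * indicator A t \<partial>N)"
      using A(2) by (intro nn_integral_mono) (auto simp: T_def not_less split: split_indicator)
    also have "\<dots> = of_nat k * emeasure N A" using A(1) by (simp add: nn_integral_cmult)
    also have "\<dots> = ennreal (real k * measure N A)"
      by (simp add: N.emeasure_eq_measure ennreal_mult ennreal_of_nat_eq_real_of_nat)
    finally show "norm (\<nu> A) \<le> real k * measure N A" by (simp add: measure_nonneg)
  qed
qed

section \<open>Densities\<close>

lemma disjoint_family_cells: "disjoint_family_on (\<lambda>l. cell S D l) (words n)"
  by (auto simp: disjoint_family_on_def cell_def words_def)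

lemma stable_spread_cong:
  assumes "stable_spread N \<nu> \<epsilon> C m" "\<forall>i<m. C' i = C i"
  shows "stable_spread N \<nu> \<epsilon> C' m"
  using assms unfolding stable_spread_def by simp

lemma stable_spreadD:
  assumes "stable_spread N \<nu> \<epsilon> C m" "\<And>i. C' i \<in> sets N" "\<And>i. i < m \<Longrightarrow> C' i = C i"
  shows "event_spread N \<nu> C' m d \<le> \<epsilon>"
  using assms unfolding stable_spread_def by (simp add: image_subset_iff)

text \<open>
  On the large set \<open>S\<close> the measure \<open>\<nu>\<close> is Lipschitz and the previous results apply; the rest of \<open>\<nu>\<close>
  has variation at most \<open>\<epsilon> / 4\<close> and contributes at most \<open>\<epsilon> / 2\<close> to any spread.
\<close>

lemma (in koethe) rainwater_imp_stable_spread: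
  fixes \<nu> :: "'b set \<Rightarrow> 'x::banach \<Rightarrow>\<^sub>L real"
  assumes RW: "rainwater_property (koethe_bochner M E :: ('a \<Rightarrow> 'x) set)
      (koethe_bochner_norm nrm) (dual_bochner_ball M E nrm)"
    and na: "\<not> purely_atomic M" and N: "finite_measure N" and \<nu>: "vector_measure N \<nu>"
    and bv: "has_bounded_variation N \<nu>" and null: "\<And>A. A \<in> null_sets N \<Longrightarrow> \<nu> A = 0"
    and C0: "range C0 \<subseteq> sets N" and "0 < \<epsilon>"
  shows "\<exists>C m. range C \<subseteq> sets N \<and> m0 \<le> m \<and> (\<forall>i<m0. C i = C0 i) \<and> stable_spread N \<nu> \<epsilon> C m"
proof -
  interpret N: finite_measure N by fact
  have \<nu>0: "\<nu> {} = 0" using \<nu> by (rule vector_measure_empty)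
  have "0 < \<epsilon> / 4" using \<open>0 < \<epsilon>\<close> by simp
  from bounded_variation_truncation[OF N \<nu> bv null this]
  obtain S K where S: "S \<in> sets N" "\<And>A. A \<in> sets N \<Longrightarrow> A \<subseteq> S \<Longrightarrow> norm (\<nu> A) \<le> K * measure N A"
    and small: "variation N \<nu> (space N - S) \<le> ennreal (\<epsilon> / 4)" by metis
  define \<nu>1 where "\<nu>1 A = \<nu> (A \<inter> S)" for A
  define \<nu>2 where "\<nu>2 A = \<nu> (A - S)" for A
  have split: "\<nu> A = \<nu>1 A + \<nu>2 A" if "A \<in> sets N" for A
    using vector_measure_Un[OF \<nu>, of "A \<inter> S" "A - S"] that S(1) by (auto simp: \<nu>1_def \<nu>2_def Int_Diff_Un)
  have "bounded_additive N \<bar>K\<bar> \<nu>1"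
    unfolding bounded_additive_def
  proof (intro conjI ballI impI)
    fix A B
    assume AB: "A \<in> sets N" "B \<in> sets N" "A \<inter> B = {}"
    have "\<nu> ((A \<inter> S) \<union> (B \<inter> S)) = \<nu> (A \<inter> S) + \<nu> (B \<inter> S)"
      using AB S(1) by (intro vector_measure_Un[OF \<nu>]) auto
    then show "\<nu>1 (A \<union> B) = \<nu>1 A + \<nu>1 B" by (simp add: \<nu>1_def Int_Un_distrib2)
  next
    fix A
    assume A: "A \<in> sets N"
    have "norm (\<nu>1 A) \<le> K * measure N (A \<inter> S)" unfolding \<nu>1_def using A S by (intro S(2)) auto
    also have "\<dots> \<le> \<bar>K\<bar> * measure N A"
      using A by (intro mult_mono N.finite_measure_mono) auto
    finally show "norm (\<nu>1 A) \<le> \<bar>K\<bar> * measure N A" .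
  qed
  note lip = rainwater_imp_event_spread_small[OF RW na N this]
  have "\<exists>C m. range C \<subseteq> sets N \<and> m0 \<le> m \<and> (\<forall>i<m0. C i = C0 i) \<and> stable_spread N \<nu>1 (\<epsilon> / 2) C m"
    using \<open>0 < \<epsilon>\<close> by (intro stable_spread_exists N C0 lip) auto
  then obtain C m where C: "range C \<subseteq> sets N" "m0 \<le> m" "\<forall>i<m0. C i = C0 i"
    and st: "stable_spread N \<nu>1 (\<epsilon> / 2) C m" by blast
  have "event_spread N \<nu> C' m d \<le> \<epsilon>" if C': "range C' \<subseteq> sets N" "\<forall>i<m. C' i = C i" for C' d
  proof -
    have cs: "cell (space N) C' l \<in> sets N" for l using C'(1) by (intro sets_cell) auto
    have var: "(\<Sum>l\<in>words n. norm (\<nu>2 (cell (space N) C' l))) \<le> \<epsilon> / 4" for n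
    proof -
      have "(\<Sum>l\<in>words n. ennreal (norm (\<nu> (cell (space N) C' l - S)))) \<le> variation N \<nu> (space N - S)"
      proof (rule sum_le_variation[where \<nu>=\<nu> and A="\<lambda>l. cell (space N) C' l - S", OF \<nu>0])
        show "disjoint_family_on (\<lambda>l. cell (space N) C' l - S) (words n)"
          using disjoint_family_cells[of "space N" C' n] unfolding disjoint_family_on_def by blast
        show "(\<Union>l\<in>words n. cell (space N) C' l - S) \<subseteq> space N - S" by (auto simp: cell_def)
      qed (use cs S(1) in auto)
      also note small
      finally show ?thesis using \<open>0 < \<epsilon>\<close> by (simp add: \<nu>2_def sum_ennreal)
    qed
    have "event_spread N \<nu> C' m d \<le> event_spread N \<nu>1 C' m d + event_spread N \<nu>2 C' m d"
      unfolding event_spread_def by (intro spread_triangle split cs)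
    also have "event_spread N \<nu>1 C' m d \<le> \<epsilon> / 2" using st C' unfolding stable_spread_def by blast
    also have "event_spread N \<nu>2 C' m d \<le> (\<Sum>l\<in>words (m + d). norm (\<nu>2 (cell (space N) C' l)))
        + (\<Sum>l\<in>words m. norm (\<nu>2 (cell (space N) C' l)))"
      unfolding event_spread_def
    proof (rule spread_le_variation)
      show "tree_additive (\<lambda>l. measure N (cell (space N) C' l))"
        using C'(1) by (intro tree_additive_measure_cell N) auto
    qed simp
    also have "\<dots> \<le> \<epsilon> / 4 + \<epsilon> / 4" by (intro add_mono var)
    finally show ?thesis by simp
  qed
  then have "stable_spread N \<nu> \<epsilon> C m" unfolding stable_spread_def by blast
  with C show ?thesis by blast
qed

lemma nn_integral_code:
  assumes N: "finite_measure N" and D: "\<And>i. D i \<in> sets N" and F: "\<And>l. 0 \<le> F l"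
  shows "(\<integral>\<^sup>+t. ennreal (F (code D n t)) \<partial>N) = ennreal (\<Sum>l\<in>words n. measure N (cell (space N) D l) * F l)"
proof -
  note i = integral_code[OF N sets.top D, where F=F and n=n]
  have "(\<integral>\<^sup>+t. ennreal (F (code D n t)) \<partial>N) = (\<integral>\<^sup>+t. ennreal (indicator (space N) t * F (code D n t)) \<partial>N)"
    by (intro nn_integral_cong) simp
  also have "\<dots> = ennreal (LINT t|N. indicator (space N) t * F (code D n t))"
    using F by (intro nn_integral_eq_integral i(1)) auto
  finally show ?thesis by (simp only: i(2))
qed

text \<open>
  The spread is an \<open>L\<^sub>1\<close> distance indeed. Cells of mass 0 cause no difference since \<open>\<nu>\<close> vanishes on them.
\<close>

lemma nn_integral_code_ratio_diff:
  fixes \<nu> :: "'b set \<Rightarrow> 'z::real_normed_vector"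
  assumes N: "finite_measure N" and D: "\<And>i. D i \<in> sets N" and null: "\<And>A. A \<in> null_sets N \<Longrightarrow> \<nu> A = 0"
  defines "q \<equiv> \<lambda>l. \<nu> (cell (space N) D l) /\<^sub>R measure N (cell (space N) D l)"
  shows "(\<integral>\<^sup>+t. ennreal (norm (q (code D (m + d) t) - q (code D m t))) \<partial>N) = ennreal (event_spread N \<nu> D m d)"
proof -
  interpret N: finite_measure N by fact
  define w where "w l = measure N (cell (space N) D l)" for l
  define v where "v l = \<nu> (cell (space N) D l)" for l
  have w: "tree_additive w" "\<And>l. 0 \<le> w l"
    unfolding w_def using D by (auto intro!: tree_additive_measure_cell N)
  have v0: "v l = 0" if "w l = 0" for l
    using that sets_cell[OF sets.top D] unfolding v_def w_def
    by (intro null) (auto intro!: null_setsI simp: N.emeasure_eq_measure)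
  have ratio: "w (u @ a) * norm (v (u @ a) /\<^sub>R w (u @ a) - v a /\<^sub>R w a) = norm (v (u @ a) - (w (u @ a) / w a) *\<^sub>R v a)" for u a
  proof (cases "w (u @ a) = 0")
    case False
    have "w (u @ a) * norm (v (u @ a) /\<^sub>R w (u @ a) - v a /\<^sub>R w a) = norm (w (u @ a) *\<^sub>R (v (u @ a) /\<^sub>R w (u @ a) - v a /\<^sub>R w a))"
      using w(2) by simp
    also have "w (u @ a) *\<^sub>R (v (u @ a) /\<^sub>R w (u @ a) - v a /\<^sub>R w a) = v (u @ a) - (w (u @ a) / w a) *\<^sub>R v a"
      using False by (simp add: scaleR_diff_right divide_inverse)
    finally show ?thesis .
  qed (simp add: v0)
  have "code D m t = drop d (code D (m + d) t)" for t by (simp add: drop_code)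
  then have "(\<integral>\<^sup>+t. ennreal (norm (q (code D (m + d) t) - q (code D m t))) \<partial>N)
      = (\<integral>\<^sup>+t. ennreal (norm (q (code D (m + d) t) - q (drop d (code D (m + d) t)))) \<partial>N)" by simp
  also have "\<dots> = ennreal (\<Sum>l\<in>words (m + d). w l * norm (q l - q (drop d l)))"
    unfolding w_def by (rule nn_integral_code[OF N D, where F="\<lambda>l. norm (q l - q (drop d l))"]) simp
  also have "(\<Sum>l\<in>words (m + d). w l * norm (q l - q (drop d l))) = spread w v m d"
    unfolding sum_words_add spread_def
  proof (intro sum.cong refl)
    fix a u
    assume "u \<in> words d"
    then have "drop d (u @ a) = a" by (simp add: words_def)
    then show "w (u @ a) * norm (q (u @ a) - q (drop d (u @ a))) = norm (v (u @ a) - (w (u @ a) / w a) *\<^sub>R v a)"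
      using ratio[of u a] by (simp add: q_def v_def w_def)
  qed
  finally show ?thesis unfolding event_spread_def v_def w_def .
qed

lemma simple_bochner_integral_code:
  fixes F :: "bool list \<Rightarrow> 'z::real_normed_vector"
  assumes N: "finite_measure N" and D: "\<And>i. D i \<in> sets N"
  shows "Bochner_Integration.simple_bochner_integrable N (\<lambda>t. F (code D n t))"
    and "Bochner_Integration.simple_bochner_integral N (\<lambda>t. F (code D n t))
      = (\<Sum>l\<in>words n. measure N (cell (space N) D l) *\<^sub>R F l)"
proof -
  interpret N: finite_measure N by fact
  have g: "simple_function N (code D n)" using D by (rule simple_function_code)
  show i: "Bochner_Integration.simple_bochner_integrable N (\<lambda>t. F (code D n t))"
    by (rule simple_bochner_integrable.intros) (use simple_function_compose1[OF g, of F] in auto)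
  have "Bochner_Integration.simple_bochner_integral N (\<lambda>t. F (code D n t))
      = (\<Sum>y\<in>code D n ` space N. measure N {x \<in> space N. code D n x = y} *\<^sub>R F y)"
    by (rule simple_bochner_integral_partition[OF i g]) auto
  also have "\<dots> = (\<Sum>l\<in>words n. measure N {x \<in> space N. code D n x = l} *\<^sub>R F l)"
  proof (rule sum.mono_neutral_left)
    show "\<forall>l\<in>words n - code D n ` space N. measure N {x \<in> space N. code D n x = l} *\<^sub>R F l = 0"
    proof
      fix l
      assume "l \<in> words n - code D n ` space N"
      then have "{x \<in> space N. code D n x = l} = {}" by auto
      then show "measure N {x \<in> space N. code D n x = l} *\<^sub>R F l = 0" by (simp only: measure_empty scaleR_zero_left)
    qed
  qed auto
  also have "\<dots> = (\<Sum>l\<in>words n. measure N (cell (space N) D l) *\<^sub>R F l)"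
    by (intro sum.cong refl) (auto simp: cell_def words_def)
  finally show "Bochner_Integration.simple_bochner_integral N (\<lambda>t. F (code D n t))
      = (\<Sum>l\<in>words n. measure N (cell (space N) D l) *\<^sub>R F l)" .
qed

text \<open>
  Completeness of \<open>L\<^sub>1\<close> in the form needed here. The bounds are stated for the lower integral of
  \<open>\<parallel>f - u\<^sub>k\<parallel>\<close>, which spares measurability of this function.
\<close>

lemma AE_convergent_of_summable_increments:
  fixes u :: "nat \<Rightarrow> 'b \<Rightarrow> 'z::banach"
  assumes u: "\<And>k. (\<lambda>t. ennreal (norm (u (Suc k) t - u k t))) \<in> borel_measurable N"
    and int: "\<And>k. (\<integral>\<^sup>+t. ennreal (norm (u (Suc k) t - u k t)) \<partial>N) \<le> ennreal ((1 / 2) ^ k)"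
  obtains f where "AE t in N. (\<lambda>k. u k t) \<longlonglongrightarrow> f t"
    and "(\<lambda>k. \<integral>\<^sup>+t. ennreal (norm (f t - u k t)) \<partial>N) \<longlonglongrightarrow> 0"
proof -
  define g where "g k t = ennreal (norm (u (Suc k) t - u k t))" for k t
  have g: "g k \<in> borel_measurable N" for k unfolding g_def by (rule u)
  have geo: "(\<Sum>j. ennreal ((1 / 2) ^ (k + j))) = ennreal (2 * (1 / 2) ^ k)" for k
  proof -
    have "(\<lambda>j. (1 / 2) ^ k * (1 / 2) ^ j :: real) sums ((1 / 2) ^ k * (1 / (1 - 1 / 2)))"
      by (intro sums_mult geometric_sums) simp
    then have "(\<lambda>j. (1 / 2) ^ (k + j) :: real) sums (2 * (1 / 2) ^ k)" by (simp add: power_add mult.commute)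
    then show ?thesis by (intro suminf_ennreal_eq) auto
  qed
  have tail: "(\<integral>\<^sup>+t. (\<Sum>j. g (k + j) t) \<partial>N) \<le> ennreal (2 * (1 / 2) ^ k)" for k
  proof -
    have "(\<integral>\<^sup>+t. (\<Sum>j. g (k + j) t) \<partial>N) = (\<Sum>j. \<integral>\<^sup>+t. g (k + j) t \<partial>N)"
      using g by (rule nn_integral_suminf)
    also have "\<dots> \<le> (\<Sum>j. ennreal ((1 / 2) ^ (k + j)))"
      unfolding g_def by (intro suminf_le int) auto
    finally show ?thesis by (simp only: geo)
  qed
  define f where "f t = lim (\<lambda>k. u k t)" for t
  have "(\<integral>\<^sup>+t. (\<Sum>j. g j t) \<partial>N) \<noteq> \<infinity>" using tail[of 0] by (auto simp: top_unique)
  then have "AE t in N. (\<Sum>j. g j t) \<noteq> \<infinity>"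
    using g by (intro nn_integral_PInf_AE borel_measurable_suminf_order)
  then have ae: "AE t in N. (\<lambda>k. u k t) \<longlonglongrightarrow> f t \<and> (\<forall>k. ennreal (norm (f t - u k t)) \<le> (\<Sum>j. g (k + j) t))"
  proof eventually_elim
    fix t
    assume fin: "(\<Sum>j. g j t) \<noteq> \<infinity>"
    then have sn: "summable (\<lambda>j. norm (u (Suc j) t - u j t))"
      unfolding g_def by (intro summable_suminf_not_top) auto
    then have "summable (\<lambda>j. u (Suc j) t - u j t)" by (rule summable_norm_cancel)
    then have "convergent (\<lambda>k. \<Sum>j<k. u (Suc j) t - u j t)" by (simp add: summable_iff_convergent)
    then have "convergent (\<lambda>k. u k t - u 0 t)" by (simp only: sum_lessThan_telescope[of "\<lambda>j. u j t"])
    then have "convergent (\<lambda>k. (u k t - u 0 t) + u 0 t)" by (intro convergent_add convergent_const)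
    then have lim: "(\<lambda>k. u k t) \<longlonglongrightarrow> f t" unfolding f_def by (simp add: convergent_LIMSEQ_iff)
    have "ennreal (norm (f t - u k t)) \<le> (\<Sum>j. g (k + j) t)" for k
    proof -
      have "(\<lambda>j. ennreal (norm (u (k + j) t - u k t))) \<longlonglongrightarrow> ennreal (norm (f t - u k t))"
        using LIMSEQ_ignore_initial_segment[OF lim, of k]
        by (intro tendsto_ennrealI tendsto_norm tendsto_diff tendsto_const) (simp add: add.commute)
      moreover have "ennreal (norm (u (k + j) t - u k t)) \<le> (\<Sum>j. g (k + j) t)" for j
      proof -
        have "u (k + j) t - u k t = (\<Sum>i<j. u (Suc (k + i)) t - u (k + i) t)"
          using sum_lessThan_telescope[of "\<lambda>i. u (k + i) t" j] by simp
        then have "norm (u (k + j) t - u k t) \<le> (\<Sum>i<j. norm (u (Suc (k + i)) t - u (k + i) t))"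
          by (simp only: norm_sum)
        then have "ennreal (norm (u (k + j) t - u k t)) \<le> (\<Sum>i<j. g (k + i) t)"
          unfolding g_def by (simp add: sum_ennreal ennreal_leI)
        also have "\<dots> \<le> (\<Sum>j. g (k + j) t)" by (intro sum_le_suminf) auto
        finally show ?thesis .
      qed
      ultimately show ?thesis by (intro LIMSEQ_le_const2[OF _ exI[of _ 0]]) blast+
    qed
    with lim show "(\<lambda>k. u k t) \<longlonglongrightarrow> f t \<and> (\<forall>k. ennreal (norm (f t - u k t)) \<le> (\<Sum>j. g (k + j) t))" by blast
  qed
  have le: "(\<integral>\<^sup>+t. ennreal (norm (f t - u k t)) \<partial>N) \<le> ennreal (2 * (1 / 2) ^ k)" for k
  proof -
    have "(\<integral>\<^sup>+t. ennreal (norm (f t - u k t)) \<partial>N) \<le> (\<integral>\<^sup>+t. (\<Sum>j. g (k + j) t) \<partial>N)"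
    proof (rule nn_integral_mono_AE)
      show "AE t in N. ennreal (norm (f t - u k t)) \<le> (\<Sum>j. g (k + j) t)"
        using ae by eventually_elim blast
    qed
    with tail[of k] show ?thesis by (rule order_trans[rotated])
  qed
  have "(\<lambda>k. ennreal (2 * (1 / 2) ^ k)) \<longlonglongrightarrow> ennreal (2 * 0)"
    by (intro tendsto_ennrealI tendsto_mult_left LIMSEQ_realpow_zero) auto
  then have zero: "(\<lambda>k. ennreal (2 * (1 / 2) ^ k)) \<longlonglongrightarrow> 0" by simp
  have "(\<lambda>k. \<integral>\<^sup>+t. ennreal (norm (f t - u k t)) \<partial>N) \<longlonglongrightarrow> 0"
    by (rule tendsto_sandwich[OF always_eventually always_eventually tendsto_const zero]) (use le in auto)
  moreover have "AE t in N. (\<lambda>k. u k t) \<longlonglongrightarrow> f t" using ae by eventually_elim blast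
  ultimately show thesis using that by blast
qed

text \<open>
  Along stable partitions with \<open>\<epsilon> = 2\<^sup>-\<^sup>k\<close> the averages \<open>u k\<close> converge to some \<open>f\<close> almost everywhere and in
  \<open>L\<^sub>1\<close>. That \<open>f\<close> represents \<open>\<nu>\<close> on an arbitrary set \<open>A\<close>, not only on the cells, is due to stability: \<open>A\<close> may
  be added as the next event, and on the cells of this refinement the average integrates to \<open>\<nu> A\<close> exactly.
\<close>

lemma stable_spread_imp_density:
  fixes \<nu> :: "'b set \<Rightarrow> 'z::banach"
  assumes N: "finite_measure N" and \<nu>: "vector_measure N \<nu>" and null: "\<And>A. A \<in> null_sets N \<Longrightarrow> \<nu> A = 0"
    and stable: "\<And>\<epsilon> C0 m0. 0 < \<epsilon> \<Longrightarrow> range C0 \<subseteq> sets N \<Longrightarrow>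
      \<exists>C m. range C \<subseteq> sets N \<and> m0 \<le> m \<and> (\<forall>i<m0. C i = C0 i) \<and> stable_spread N \<nu> \<epsilon> C m"
  shows "\<exists>f. \<forall>A\<in>sets N. has_strong_bochner_integral N (\<lambda>t. indicator A t *\<^sub>R f t) (\<nu> A)"
proof -
  interpret N: finite_measure N by fact
  define Inv where "Inv C (m::nat) \<longleftrightarrow> range C \<subseteq> sets N" for C :: "nat \<Rightarrow> 'b set" and m
  define Q where "Q k (m::nat) C m' \<longleftrightarrow> stable_spread N \<nu> ((1 / 2) ^ k) C m'" for k m C m'
  have "\<exists>C m. strict_mono m \<and> (\<forall>k. Q k (m k) C (m (Suc k))) \<and> (\<forall>k. \<exists>c. Inv c (m k) \<and> (\<forall>i<m k. C i = c i))"
  proof (rule diagonal_sequence)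
    show "Inv (\<lambda>_. {}) 0" by (simp add: Inv_def)
    fix k C m
    assume "Inv C m"
    then obtain C' m' where "range C' \<subseteq> sets N" "Suc m \<le> m'" "\<forall>i<Suc m. C' i = C i"
        "stable_spread N \<nu> ((1 / 2) ^ k) C' m'"
      using stable[of "(1 / 2) ^ k" C "Suc m"] unfolding Inv_def by auto
    then show "\<exists>C' m'. Inv C' m' \<and> m < m' \<and> (\<forall>i<m. C' i = C i) \<and> Q k m C' m'"
      unfolding Inv_def Q_def by (intro exI[of _ C'] exI[of _ m']) auto
  next
    fix k m C m' C'
    assume "Q k m C m'" "\<forall>i<m'. C' i = C i"
    then show "Q k m C' m'" unfolding Q_def by (rule stable_spread_cong)
  qed
  then obtain C m where sm: "strict_mono m" and Q: "\<And>k. Q k (m k) C (m (Suc k))"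
    and Inv: "\<And>k. \<exists>c. Inv c (m k) \<and> (\<forall>i<m k. C i = c i)" by blast
  have C: "C i \<in> sets N" for i
  proof -
    have "i < m (Suc i)" using strict_mono_imp_increasing[OF sm, of "Suc i"] by simp
    then show ?thesis using Inv[of "Suc i"] unfolding Inv_def by auto
  qed
  define n where "n k = m (Suc k)" for k
  have st: "stable_spread N \<nu> ((1 / 2) ^ k) C (n k)" for k using Q[of k] by (simp add: Q_def n_def)
  have n: "n k \<le> n (Suc k)" for k unfolding n_def by (intro monoD[OF strict_mono_mono[OF sm]]) simp
  define q where "q l = \<nu> (cell (space N) C l) /\<^sub>R measure N (cell (space N) C l)" for l
  define u where "u k t = q (code C (n k) t)" for k t
  have u: "simple_function N (u k)" for k
    unfolding u_def by (rule simple_function_compose1[OF simple_function_code[OF C]])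
  have inc: "(\<integral>\<^sup>+t. ennreal (norm (u (Suc k) t - u k t)) \<partial>N) \<le> ennreal ((1 / 2) ^ k)" for k
  proof -
    define d where "d = n (Suc k) - n k"
    have nk: "n (Suc k) = n k + d" using n[of k] by (simp add: d_def)
    have "(\<integral>\<^sup>+t. ennreal (norm (u (Suc k) t - u k t)) \<partial>N) = ennreal (event_spread N \<nu> C (n k) d)"
      unfolding u_def nk q_def by (rule nn_integral_code_ratio_diff[OF N C null])
    also have "event_spread N \<nu> C (n k) d \<le> (1 / 2) ^ k"
      by (rule stable_spreadD[OF st C]) simp
    finally show ?thesis by (simp add: ennreal_leI)
  qed
  have meas: "(\<lambda>t. ennreal (norm (u (Suc k) t - u k t))) \<in> borel_measurable N" for k
    by (intro borel_measurable_simple_function simple_function_compose2[OF u u, where h="\<lambda>x y. ennreal (norm (x - y))"])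
  obtain f where f: "AE t in N. (\<lambda>k. u k t) \<longlonglongrightarrow> f t"
      "(\<lambda>k. \<integral>\<^sup>+t. ennreal (norm (f t - u k t)) \<partial>N) \<longlonglongrightarrow> 0"
    by (rule AE_convergent_of_summable_increments[OF meas inc])
  have "has_strong_bochner_integral N (\<lambda>t. indicator A t *\<^sub>R f t) (\<nu> A)" if A: "A \<in> sets N" for A
  proof -
    define s :: "nat \<Rightarrow> 'b \<Rightarrow> 'z" where "s k t = indicator A t *\<^sub>R u k t" for k t
    have s: "simple_function N (s k)" for k
    proof -
      have "simple_function N (\<lambda>t. indicator A t :: real)" using A by (rule simple_function_indicator)
      then show ?thesis unfolding s_def using u[of k] by (rule simple_function_compose2)
    qed
    have "AE t in N. (\<lambda>k. s k t) \<longlonglongrightarrow> indicator A t *\<^sub>R f t"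
      using f(1) unfolding s_def by eventually_elim (intro tendsto_intros)
    with s have meas: "strongly_measurable N (\<lambda>t. indicator A t *\<^sub>R f t)"
      unfolding strongly_measurable_def by blast
    have sbi: "Bochner_Integration.simple_bochner_integrable N (s k)" for k
      using s by (intro simple_bochner_integrable.intros) auto
    have "(\<integral>\<^sup>+t. ennreal (norm (indicator A t *\<^sub>R f t - s k t)) \<partial>N) \<le> (\<integral>\<^sup>+t. ennreal (norm (f t - u k t)) \<partial>N)" for k
      by (intro nn_integral_mono ennreal_leI) (simp add: s_def indicator_def)
    then have L1: "(\<lambda>k. \<integral>\<^sup>+t. ennreal (norm (indicator A t *\<^sub>R f t - s k t)) \<partial>N) \<longlonglongrightarrow> 0"
      by (intro tendsto_sandwich[OF always_eventually always_eventually tendsto_const f(2)]) auto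
    have close: "norm (Bochner_Integration.simple_bochner_integral N (s k) - \<nu> A) \<le> (1 / 2) ^ k" for k
    proof -
      \<comment> \<open>The refinement of level \<open>n k\<close> by the single event \<open>A\<close>.\<close>
      define C' where "C' = C(n k := A)"
      have C': "C' i \<in> sets N" for i using C A by (simp add: C'_def)
      have cell_eq: "cell (space N) C' l = cell (space N) C l" if "length l \<le> n k" for l
        using that by (intro cell_cong) (simp add: C'_def)
      have code_eq: "code C' (n k) t = code C (n k) t" for t
      proof -
        have "code C' i t = code C i t" if "i \<le> n k" for i using that by (induction i) (auto simp: C'_def)
        then show ?thesis by simp
      qed
      define w where "w l = measure N (cell (space N) C' l)" for l
      define v where "v l = \<nu> (cell (space N) C' l)" for l
      have q: "q a = v a /\<^sub>R w a" if "a \<in> words (n k)" for a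
        using cell_eq[of a] that by (simp add: q_def v_def w_def words_def)
      define F where "F l = (if hd l then q (tl l) else 0)" for l
      have "s k t = F (code C' (Suc (n k)) t)" for t
        by (simp add: s_def u_def F_def code_eq C'_def[THEN fun_cong, of "n k"] indicator_def)
      then have "s k = (\<lambda>t. F (code C' (Suc (n k)) t))" by (rule ext)
      then have "Bochner_Integration.simple_bochner_integral N (s k) = (\<Sum>l\<in>words (Suc (n k)). w l *\<^sub>R F l)"
        unfolding w_def using simple_bochner_integral_code(2)[OF N, of C' F "Suc (n k)"] C' by (simp only:)
      also have "\<dots> = (\<Sum>a\<in>words (n k). (w (True # a) / w a) *\<^sub>R v a)"
        unfolding sum_words_Suc by (intro sum.cong refl) (simp add: F_def q divide_inverse)
      finally have int: "Bochner_Integration.simple_bochner_integral N (s k) = (\<Sum>a\<in>words (n k). (w (True # a) / w a) *\<^sub>R v a)" .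
      have "tree_additive (\<lambda>l. \<nu> (cell A C' l))"
        by (intro tree_additive_cell[OF A C'] vector_measure_Un[OF \<nu>])
      from sum_descendants[OF this, where d="n k" and a="[]"]
      have "\<nu> A = (\<Sum>a\<in>words (n k). \<nu> (cell A C' a))" unfolding append_Nil2 cell_Nil by (rule sym)
      also have "\<dots> = (\<Sum>a\<in>words (n k). v (True # a))"
      proof (intro sum.cong refl)
        fix a
        assume "a \<in> words (n k)"
        then have "cell (space N) C' (True # a) = cell (space N) C' a \<inter> A"
          by (simp add: cell_Cons words_def C'_def)
        also have "\<dots> = cell A C' a" using sets.sets_into_space[OF A] by (simp add: cell_inter Int_absorb1)
        finally show "\<nu> (cell A C' a) = v (True # a)" by (simp add: v_def)
      qed
      finally have "norm (Bochner_Integration.simple_bochner_integral N (s k) - \<nu> A)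
          = norm (\<Sum>a\<in>words (n k). v (True # a) - (w (True # a) / w a) *\<^sub>R v a)"
        unfolding int by (simp add: sum_subtractf norm_minus_commute)
      also have "\<dots> \<le> (\<Sum>a\<in>words (n k). norm (v (True # a) - (w (True # a) / w a) *\<^sub>R v a))"
        by (rule norm_sum)
      also have "\<dots> \<le> spread w v (n k) (Suc 0)"
        unfolding spread_def sum_words_Suc by (intro sum_mono) simp
      also have "\<dots> = event_spread N \<nu> C' (n k) (Suc 0)" unfolding event_spread_def w_def v_def ..
      also have "\<dots> \<le> (1 / 2) ^ k"
        by (rule stable_spreadD[OF st C']) (simp add: C'_def)
      finally show ?thesis .
    qed
    have "(\<lambda>k. (1 / 2) ^ k :: real) \<longlonglongrightarrow> 0" by (intro LIMSEQ_realpow_zero) auto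
    then have "(\<lambda>k. Bochner_Integration.simple_bochner_integral N (s k) - \<nu> A) \<longlonglongrightarrow> 0"
      by (rule Lim_null_comparison[rotated]) (use close in auto)
    then have "(\<lambda>k. Bochner_Integration.simple_bochner_integral N (s k)) \<longlonglongrightarrow> \<nu> A"
      by (simp add: LIM_zero_iff)
    with meas sbi L1 show ?thesis unfolding has_strong_bochner_integral_def by blast
  qed
  then show ?thesis by blast
qed

theorem theorem1p1:
  fixes M :: "'a measure"
    and E :: "('a \<Rightarrow> real) set"
    and nrm :: "('a \<Rightarrow> real) \<Rightarrow> real"
  assumes "prob_space M"
    and "\<not> purely_atomic M"
    and "koethe_space M E nrm"
    and "order_continuous M E nrm"
    and "rainwater_property (koethe_bochner M E :: ('a \<Rightarrow> 'x::banach) set)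
           (koethe_bochner_norm nrm) (dual_bochner_ball M E nrm)"
  shows "radon_nikodym_property TYPE('b) TYPE('x \<Rightarrow>\<^sub>L real)"
proof -
  interpret koethe M E nrm
    using assms(1,3) by (simp add: koethe_def koethe_axioms_def)
  show ?thesis
    unfolding radon_nikodym_property_def
  proof (intro allI impI)
    fix N :: "'b measure" and \<nu> :: "'b set \<Rightarrow> 'x \<Rightarrow>\<^sub>L real"
    assume N: "finite_measure N" and \<nu>: "vector_measure N \<nu>" and bv: "has_bounded_variation N \<nu>"
      and null: "\<forall>A\<in>null_sets N. \<nu> A = 0"
    have null': "\<nu> A = 0" if "A \<in> null_sets N" for A using null that by blast
    show "\<exists>f. \<forall>A\<in>sets N. has_strong_bochner_integral N (\<lambda>\<omega>. indicator A \<omega> *\<^sub>R f \<omega>) (\<nu> A)"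
      using rainwater_imp_stable_spread[OF assms(5,2) N \<nu> bv null']
      by (intro stable_spread_imp_density[OF N \<nu> null'])
  qed
qed

end
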